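(* Adopt Assumptions 1 and 2 with $\rho_k>0$, let $\delta\in(0,1)$, and suppose the initialization $Z_0$ satisfies (surely) that $V^*Z_0$ is invertible and $\|W_0\|\le1$. Run Oja's algorithm with step sizes $\eta_i=\frac{\alpha}{(\beta+i)\rho_k}$, where $$\alpha\ge 8,\qquad \beta\ge 2\Big(\frac{C_3\alpha}{\bar\rho_k}\Big)^2\log\Big(\frac{C_3\alpha}{\bar\rho_k}\cdot\frac{2k}{\delta}\Big),\qquad C_3=2(1+\sqrt2\,\mathrm e)\sqrt{42\mathrm e^2+5}\ (<175).$$ Then for every integer $T\ge1$, with probability at least $1-\delta$, $V^*Z_T$ is invertible and $$\|U^*Q_T\|\le\|W_T\|\le 2\mathrm e\sqrt{\frac{\beta+1}{\beta+T}}.$$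
   Context: Let $d\ge2$, $1\le k<d$. $\mathrm P_A$ is a probability distribution on real symmetric $d\times d$ matrices and $A_1,A_2,\dots$ are i.i.d. samples from $\mathrm P_A$ with mean $\mathbf M=\mathbb E A_1$ (Assumption 1). Assumption 2: there is a scalar $M>0$ such that almost surely $\sup_P\|P^*(A_1-\mathbf M)\|_2\le M$, the supremum over all $d\times k$ matrices $P$ with orthonormal columns. $\lambda_1\ge\dots\ge\lambda_d$ are the eigenvalues of $\mathbf M$, $\rho_k=\lambda_k-\lambda_{k+1}$; $V\in\mathbb R^{d\times k}$ has as orthonormal columns the top $k$ eigenvectors of $\mathbf M$ and $U\in\mathbb R^{d\times(d-k)}$ has as orthonormal columns the remaining eigenvectors. Oja's algorithm with step sizes $\eta_t>0$ and initialization $Z_0\in\mathbb R^{d\times k}$ (independent of the $A_i$) sets $Z_t=(I+\eta_tA_t)Z_{t-1}$ for $t\ge1$, and outputs $Q_t$, the matrix with orthonormal columns obtained by Gram–Schmidt orthonormalization of the columns of $Z_t$. Whenever $V^*Z_t$ is invertible, $W_t:=U^*Z_t(V^*Z_t)^{-1}$. The normalized gap is $\bar\rho_k=\min\{\rho_k/M,\ \rho_k/\|\mathbf M\|,\ 1\}$. $\|\cdot\|$ is the spectral norm. *)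

theory Defs
  imports "HOL-Analysis.Analysis" "HOL-Probability.Probability"
begin

text \<open>Spectral (operator 2-) norm of a real matrix.  Note that the library's
  norm on real^'n^'m is the Frobenius norm, hence this separate definition.\<close>
definition opnorm :: "real^'n::finite^'m::finite \<Rightarrow> real" where
  "opnorm A = onorm (\<lambda>x. A *v x)"

definition orthonormal_cols :: "real^'k::finite^'d::finite \<Rightarrow> bool" where
  "orthonormal_cols P \<longleftrightarrow> transpose P ** P = mat 1"

fun gs_aux :: "('k \<times> (real^'d::finite)) list \<Rightarrow> ('k \<times> (real^'d)) list \<Rightarrow> ('k \<times> (real^'d)) list" where
  "gs_aux acc [] = acc"
| "gs_aux acc ((j, z) # zs) =
     gs_aux (acc @ [(j, (let w = z - sum_list (map (\<lambda>(i, q). (q \<bullet> z) *\<^sub>R q) acc)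
                          in (1 / norm w) *\<^sub>R w))]) zs"

definition gram_schmidt :: "(real, 'k::enum) vec^'d::finite \<Rightarrow> (real, 'k) vec^'d" where
  "gram_schmidt Z =
     (\<chi> r c. (the (map_of (gs_aux [] (map (\<lambda>j. (j, column j Z)) Enum.enum)) c)) $ r)"

primrec oja :: "(nat \<Rightarrow> real) \<Rightarrow> (nat \<Rightarrow> real^'d::finite^'d) \<Rightarrow> real^'k::finite^'d
                 \<Rightarrow> nat \<Rightarrow> real^'k^'d" where
  "oja eta A Z0 0 = Z0"
| "oja eta A Z0 (Suc t) = (mat 1 + eta (Suc t) *\<^sub>R A (Suc t)) ** oja eta A Z0 t"

definition Wmat :: "real^'m::finite^'d::finite \<Rightarrow> real^'k::finite^'d \<Rightarrow> real^'k^'d \<Rightarrow> real^'k^'m" where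
  "Wmat U V Z = transpose U ** Z ** matrix_inv (transpose V ** Z)"

definition C3 :: real where
  "C3 = 2 * (1 + sqrt 2 * exp 1) * sqrt (42 * (exp 1)^2 + 5)"

end

theory Submission
  imports Defs
begin

text \<open>On the event that \<open>V\<^sup>T Z\<close> is invertible, \<open>W\<^sub>t\<close> is a function of \<open>W\<^sub>t\<^sub>-\<^sub>1\<close> and \<open>A\<^sub>t\<close>: up to a
  mean-zero perturbation of norm \<open>O(\<eta>\<^sub>t M)\<close> and a remainder of norm \<open>O((\<eta>\<^sub>t M)\<^sup>2)\<close> it is the
  contraction \<open>(I + \<eta> \<Lambda>\<^sub>U) W (I + \<eta> \<Lambda>\<^sub>V)\<^sup>-\<^sup>1\<close>, as long as \<open>\<parallel>W\<parallel> \<le> 4\<close>.  The growth of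
  \<open>tr (w\<^sub>t\<^sup>2 W\<^sub>t\<^sup>T W\<^sub>t + c I)\<^sup>p\<close> with \<open>p \<approx> log (2k/\<delta>)\<close> is controlled by Taylor expansion along the segment
  from the contraction to \<open>W\<^sub>t\<close>: its second derivative is at most \<open>4 p\<^sup>2 e\<^sup>2 / c\<close> times its value if the
  perturbation has norm \<open>e\<close>.  Constant weights \<open>w\<^sub>t = c = 1\<close> show that \<open>\<parallel>W\<^sub>t\<parallel> > 4\<close> ever happens
  with probability at most \<open>\<delta>/2\<close>.  The weights \<open>w\<^sub>t = \<beta> + t\<close>, which the contraction still absorbs,
  together with \<open>c = (\<beta> + 1) (\<beta> + T)\<close> give the bound on \<open>\<parallel>W\<^sub>T\<parallel>\<close> with failure probability \<open>\<delta>/2\<close>.\<close>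

section \<open>Positive semidefinite matrices and their powers\<close>

text \<open>The admissible failure probability sees the dimension only through \<open>k\<close>,
  although the noise acts on all of R^d. Traces are therefore normalised on the \<open>k\<close>
  side, where they cost a factor \<open>k\<close> that an exponent of size log (2k/\<delta>)
  absorbs, and whatever is met on the other side has to be transferred back.

  The region of norm at most 4 is what makes the expansion of W legitimate: there the denominator of
  the update stays invertible with explicit bounds. Its first-order term is a linear functional of
  the centred sample with coefficients fixed by the past, so it vanishes when the newest sample
  alone is integrated out; Fubini with a frozen past plays the role of a conditional expectation.

  Both stages obey the same budget: per eigenvalue the potential starts at no more than 2X and a
  failure requires at least 17X. The quotient beats e^2 in every one of the \<open>p\<close> powers.
  Half of this gain pays for the noise, whose total logarithmic cost the lower bound on \<beta>
  keeps below \<open>p\<close>; the other half beats 2k/\<delta>.\<close>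

lemma bounded_bilinear_matrix_mult:
  "bounded_bilinear ((**) :: real^'n::finite^'m::finite \<Rightarrow> real^'p::finite^'n \<Rightarrow> real^'p^'m)"
proof -
  have "bilinear ((**) :: real^'n::finite^'m::finite \<Rightarrow> real^'p::finite^'n \<Rightarrow> real^'p^'m)"
    unfolding bilinear_def
    by (auto intro!: linearI
        simp: matrix_matrix_mult_def vec_eq_iff algebra_simps sum.distrib sum_distrib_left)
  then show ?thesis by (simp add: bilinear_conv_bounded_bilinear)
qed

interpretation mm: bounded_bilinear
  "(**) :: real^'n::finite^'m::finite \<Rightarrow> real^'p::finite^'n \<Rightarrow> real^'p^'m"
  by (rule bounded_bilinear_matrix_mult)

lemma bounded_linear_transpose:
  "bounded_linear (transpose :: real^'n::finite^'m::finite \<Rightarrow> real^'m^'n)"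
proof -
  have "linear (transpose :: real^'n::finite^'m::finite \<Rightarrow> real^'m^'n)"
    by (auto intro!: linearI simp: transpose_def vec_eq_iff)
  then show ?thesis by (simp add: linear_conv_bounded_linear)
qed

lemmas mm_dist = mm.add_left mm.add_right mm.diff_left mm.diff_right mm.scaleR_left mm.scaleR_right
  mm.minus_left mm.minus_right

lemmas tr_dist = linear_add [OF bounded_linear.linear [OF bounded_linear_transpose]]
  linear_diff [OF bounded_linear.linear [OF bounded_linear_transpose]]
  linear_scale [OF bounded_linear.linear [OF bounded_linear_transpose]]
  linear_neg [OF bounded_linear.linear [OF bounded_linear_transpose]]
  linear_0 [OF bounded_linear.linear [OF bounded_linear_transpose]]
  matrix_transpose_mul

lemma matrix_inner: "(A :: real^'n::finite^'m::finite) \<bullet> B = (\<Sum>i\<in>UNIV. \<Sum>j\<in>UNIV. A$i$j * B$i$j)"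
  by (simp add: inner_vec_def)

lemma inner_transpose:
  "transpose (A :: real^'n::finite^'m::finite) \<bullet> transpose B = A \<bullet> B"
  unfolding matrix_inner transpose_def by (simp, rule sum.swap)

lemma inner_mult_left:
  fixes A :: "real^'n::finite^'m::finite" and X :: "real^'p::finite^'n"
  shows "(A ** X) \<bullet> Y = X \<bullet> (transpose A ** Y)"
proof -
  have "(A ** X) \<bullet> Y = (\<Sum>i\<in>UNIV. \<Sum>j\<in>UNIV. \<Sum>k\<in>UNIV. A$i$k * X$k$j * Y$i$j)"
    by (simp add: matrix_inner matrix_matrix_mult_def sum_distrib_right)
  also have "\<dots> = (\<Sum>k\<in>UNIV. \<Sum>j\<in>UNIV. \<Sum>i\<in>UNIV. A$i$k * X$k$j * Y$i$j)"
    by (subst sum.swap, subst (2) sum.swap, subst sum.swap) (rule refl)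
  also have "\<dots> = X \<bullet> (transpose A ** Y)"
    by (simp add: matrix_inner matrix_matrix_mult_def transpose_def sum_distrib_left mult_ac)
  finally show ?thesis .
qed

lemma inner_mult_right:
  fixes X :: "real^'n::finite^'m::finite" and B :: "real^'p::finite^'n"
  shows "(X ** B) \<bullet> Y = X \<bullet> (Y ** transpose B)"
proof -
  have "(X ** B) \<bullet> Y = (transpose B ** transpose X) \<bullet> transpose Y"
    by (metis inner_transpose matrix_transpose_mul)
  also have "\<dots> = transpose X \<bullet> (B ** transpose Y)"
    by (simp add: inner_mult_left)
  also have "\<dots> = X \<bullet> (Y ** transpose B)"
    by (metis inner_transpose matrix_transpose_mul transpose_transpose)
  finally show ?thesis .
qed

lemma mat1_inner: "mat 1 \<bullet> (Q :: real^'n::finite^'n) = (\<Sum>i\<in>UNIV. axis i 1 \<bullet> (Q *v axis i 1))"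
proof -
  have "axis i 1 \<bullet> (Q *v axis i 1) = Q $ i $ i" for i
    by (simp add: matrix_vector_mult_basis column_def inner_axis')
  moreover have "mat 1 \<bullet> Q = (\<Sum>i\<in>UNIV. Q$i$i)"
    unfolding matrix_inner mat_def
    by (intro sum.cong refl) (simp add: if_distrib [of "\<lambda>c. c * _"] sum.delta cong: if_cong)
  ultimately show ?thesis by simp
qed

lemma mat1_inner_mat1: "(mat 1 :: real^'n::finite^'n) \<bullet> mat 1 = real CARD('n)"
  by (simp add: mat1_inner)

primrec mpow :: "real^'n::finite^'n \<Rightarrow> nat \<Rightarrow> real^'n^'n" where
  "mpow S 0 = mat 1"
| "mpow S (Suc n) = S ** mpow S n"

lemma mpow_commute: "mpow S n ** S = S ** mpow S n"
  by (induction n) (simp_all add: matrix_mul_assoc [symmetric])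

lemma mpow_add: "mpow S (m + n) = mpow S m ** mpow S n"
  by (induction m) (simp_all add: matrix_mul_assoc)

lemma transpose_mpow: "transpose S = S \<Longrightarrow> transpose (mpow S n) = mpow S n"
  by (induction n) (simp_all add: matrix_transpose_mul mpow_commute)

definition psd :: "real^'n::finite^'n \<Rightarrow> bool" where
  "psd Q \<longleftrightarrow> (\<forall>x. 0 \<le> x \<bullet> (Q *v x))"

text \<open>The dual cone of the positive semidefinite matrices for the Frobenius inner product.  It is
  closed under the operations needed below, and using it avoids the spectral theorem.\<close>

definition dcone :: "real^'n::finite^'n \<Rightarrow> bool" where
  "dcone P \<longleftrightarrow> (\<forall>Q. psd Q \<longrightarrow> 0 \<le> P \<bullet> Q)"

lemma inner_transpose_vec: "x \<bullet> ((A :: real^'n::finite^'m::finite) *v y) = (transpose A *v x) \<bullet> y"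
  by (simp add: dot_lmul_matrix)

lemma psd_congruence:
  fixes B :: "real^'p::finite^'n::finite"
  assumes "psd Q" shows "psd (transpose B ** Q ** B)"
  unfolding psd_def
proof
  fix x
  have "x \<bullet> ((transpose B ** Q ** B) *v x) = x \<bullet> (transpose B *v (Q *v (B *v x)))"
    by (simp only: matrix_vector_mul_assoc matrix_mul_assoc)
  also have "\<dots> = (B *v x) \<bullet> (Q *v (B *v x))"
    by (subst inner_transpose_vec) (simp only: transpose_transpose)
  finally show "0 \<le> x \<bullet> ((transpose B ** Q ** B) *v x)"
    using assms by (simp add: psd_def)
qed

lemma psd_mat1: "psd (mat 1)" by (simp add: psd_def)

lemma psd_gram: "psd (transpose B ** B)" for B :: "real^'p::finite^'n::finite"
  using psd_congruence[OF psd_mat1, of B] by simp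

lemma dcone_add: "dcone A \<Longrightarrow> dcone B \<Longrightarrow> dcone (A + B)"
  by (simp add: dcone_def inner_add_left)

lemma dcone_scaleR: "0 \<le> r \<Longrightarrow> dcone A \<Longrightarrow> dcone (r *\<^sub>R A)"
  by (simp add: dcone_def)

lemma dcone_zero: "dcone 0" by (simp add: dcone_def)

lemma dcone_mat1: "dcone (mat 1)"
  unfolding dcone_def mat1_inner psd_def by (auto intro: sum_nonneg)

lemma dcone_congruence:
  fixes B :: "real^'p::finite^'n::finite"
  assumes "dcone P" shows "dcone (B ** P ** transpose B)"
  unfolding dcone_def
proof (intro allI impI)
  fix Q :: "real^'n^'n" assume "psd Q"
  have "(B ** P ** transpose B) \<bullet> Q = P \<bullet> (transpose B ** Q ** B)"
    using inner_mult_right[of "B ** P" "transpose B" Q] inner_mult_left[of B P "Q ** B"]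
    by (simp add: matrix_mul_assoc)
  with assms psd_congruence[OF \<open>psd Q\<close>, of B] show "0 \<le> (B ** P ** transpose B) \<bullet> Q"
    by (simp add: dcone_def)
qed

lemma dcone_gram: "dcone (transpose B ** B)" for B :: "real^'p::finite^'n::finite"
  using dcone_congruence[OF dcone_mat1, of "transpose B"] by simp

lemma outer_product_inner:
  fixes P :: "real^'n::finite^'n"
  shows "y \<bullet> ((\<chi> i j. x$i * x$j) *v y) = (x \<bullet> y)\<^sup>2"
    and "P \<bullet> (\<chi> i j. x$i * x$j) = x \<bullet> (P *v x)"
  by (simp_all add: matrix_inner inner_vec_def matrix_vector_mult_def power2_eq_square sum_product
      sum_distrib_left mult_ac)

text \<open>Testing against the rank-one matrices x x^T recovers the quadratic form of
  \<open>P\<close>.\<close>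

lemma dcone_psd: assumes "dcone P" shows "psd P"
  unfolding psd_def
proof
  fix x :: "real^'a"
  have "psd (\<chi> i j. x$i * x$j)" by (simp add: psd_def outer_product_inner)
  then show "0 \<le> x \<bullet> (P *v x)"
    using assms by (auto simp: dcone_def outer_product_inner(2) [symmetric])
qed

text \<open>The sandwich \<open>S ** mpow S n ** transpose S\<close> is a congruence and raises the
  exponent by two, hence the induction with two base cases.\<close>

lemma dcone_mpow: assumes "dcone S" "transpose S = S" shows "dcone (mpow S n)"
proof (induction n rule: induct_nat_012)
  case (ge2 n)
  have "mpow S (Suc (Suc n)) = S ** mpow S n ** transpose S"
    using assms(2) by (simp add: matrix_mul_assoc [symmetric] mpow_commute)
  then show ?case using dcone_congruence[OF ge2(1), of S] by simp
qed (use assms in \<open>simp_all add: dcone_mat1\<close>)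

lemma dcone_inner_mono: "dcone P \<Longrightarrow> psd (B - A) \<Longrightarrow> P \<bullet> A \<le> P \<bullet> B"
  by (auto simp: dcone_def inner_diff_right dest!: spec[of _ "B - A"])

section \<open>Shifted Gram matrices on the two sides of a rectangular matrix\<close>

definition reg :: "real \<Rightarrow> real^'k::finite^'m::finite \<Rightarrow> real^'k^'k" where
  "reg c G = transpose G ** G + c *\<^sub>R mat 1"

text \<open>The trace of \<open>(G\<^sup>T G + c I)\<^sup>p\<close>.  The shift \<open>c\<close> makes the effect of a perturbation of norm
  \<open>e\<close> multiplicative, with a logarithmic cost of order \<open>p\<^sup>2 e\<^sup>2 / c\<close>.\<close>

definition ptr :: "real \<Rightarrow> nat \<Rightarrow> real^'k::finite^'m::finite \<Rightarrow> real" where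
  "ptr c p G = mpow (reg c G) p \<bullet> mat 1"

lemma transpose_reg [simp]: "transpose (reg c G) = reg c G"
  by (simp add: reg_def tr_dist)

lemma dcone_reg: "0 \<le> c \<Longrightarrow> dcone (reg c G)"
  unfolding reg_def by (intro dcone_add dcone_gram dcone_scaleR dcone_mat1)

lemma dcone_mpow_reg: "0 \<le> c \<Longrightarrow> dcone (mpow (reg c G) n)"
  by (intro dcone_mpow dcone_reg transpose_reg)

lemma transpose_mpow_reg [simp]: "transpose (mpow (reg c G) n) = mpow (reg c G) n"
  by (simp add: transpose_mpow)

lemma reg_intertwine:
  "G ** mpow (reg c G) n = mpow (reg c (transpose G)) n ** G"
proof (induction n)
  case (Suc n)
  have "G ** reg c G = reg c (transpose G) ** G"
    by (simp add: reg_def mm_dist matrix_mul_assoc)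
  then have "G ** mpow (reg c G) (Suc n) = reg c (transpose G) ** (G ** mpow (reg c G) n)"
    by (simp add: matrix_mul_assoc)
  then show ?case by (simp add: Suc.IH matrix_mul_assoc)
qed simp

text \<open>\<open>K\<close> is the polynomial ((x + c)^n - c^n) / x evaluated at G^T G. Its
  coefficients are nonnegative, which puts it into the dual cone, and the recursion K' = c K + (reg
  c G)^n avoids the division. That one \<open>K\<close> serves both Gram matrices is what permits
  moving traces between the two sides.\<close>

lemma mpow_reg_expansion:
  assumes "0 \<le> c"
  shows "\<exists>K. dcone K \<and> transpose K = K \<and> mpow (reg c G) n = c ^ n *\<^sub>R mat 1 + K ** (transpose G ** G) \<and>
    mpow (reg c (transpose G)) n = c ^ n *\<^sub>R mat 1 + G ** K ** transpose G"
  proof (induction n)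
    case 0
    show ?case by (rule exI[of _ 0]) (simp add: dcone_zero mm.zero_left mm.zero_right tr_dist)
  next
    case (Suc n)
    let ?S = "reg c G" and ?T = "reg c (transpose G)"
    obtain K where K: "dcone K" "transpose K = K"
      "mpow ?S n = c ^ n *\<^sub>R mat 1 + K ** (transpose G ** G)"
      "mpow ?T n = c ^ n *\<^sub>R mat 1 + G ** K ** transpose G"
      using Suc by blast
    let ?K = "c *\<^sub>R K + mpow ?S n"
    have 1: "mpow ?S (Suc n) = mpow ?S n ** (transpose G ** G) + c *\<^sub>R mpow ?S n"
      by (simp add: mpow_commute [symmetric]) (simp add: reg_def mm_dist)
    have 2: "mpow ?T (Suc n) = G ** mpow ?S n ** transpose G + c *\<^sub>R mpow ?T n"
    proof -
      have "mpow ?T (Suc n) = mpow ?T n ** (G ** transpose G) + c *\<^sub>R mpow ?T n"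
        by (simp add: mpow_commute [symmetric]) (simp add: reg_def mm_dist)
      then show ?thesis by (simp add: reg_intertwine matrix_mul_assoc)
    qed
    have "mpow ?S (Suc n) = c ^ Suc n *\<^sub>R mat 1 + ?K ** (transpose G ** G)"
      unfolding 1 by (subst (2) K(3)) (simp add: mm_dist scaleR_add_right)
    moreover have "mpow ?T (Suc n) = c ^ Suc n *\<^sub>R mat 1 + G ** ?K ** transpose G"
      unfolding 2 by (subst K(4)) (simp add: mm_dist scaleR_add_right)
    moreover have "dcone ?K" "transpose ?K = ?K"
      using assms K(1,2) by (auto intro!: dcone_add dcone_scaleR dcone_mpow_reg simp: tr_dist)
    ultimately show ?case by blast
  qed

text \<open>G^T G and G G^T share their nonzero eigenvalues. After subtracting c^p for every
  dimension the zero eigenvalues contribute nothing.\<close>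

lemma ptr_transpose:
  fixes G :: "real^'k::finite^'m::finite"
  assumes "0 \<le> c"
  shows "ptr c p (transpose G) - c ^ p * real CARD('m) = ptr c p G - c ^ p * real CARD('k)"
proof -
  obtain K where K: "transpose K = K" "mpow (reg c G) p = c ^ p *\<^sub>R mat 1 + K ** (transpose G ** G)"
    "mpow (reg c (transpose G)) p = c ^ p *\<^sub>R mat 1 + G ** K ** transpose G"
    using mpow_reg_expansion[OF assms, where G = G and n = p] by auto
  have "(G ** K ** transpose G) \<bullet> mat 1 = (K ** (transpose G ** G)) \<bullet> mat 1"
  proof -
    have "(G ** K ** transpose G) \<bullet> mat 1 = (G ** K) \<bullet> G"
      by (subst inner_mult_right) simp
    also have "\<dots> = K \<bullet> (transpose G ** G)"
      by (rule inner_mult_left)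
    also have "\<dots> = (K ** (transpose G ** G)) \<bullet> mat 1"
      by (subst inner_mult_right) (simp add: matrix_transpose_mul)
    finally show ?thesis .
  qed
  then show ?thesis
    by (simp add: ptr_def K inner_add_left mat1_inner_mat1)
qed

lemma ptr_nonneg: "0 \<le> c \<Longrightarrow> 0 \<le> ptr c p G"
  using dcone_mpow_reg[of c G p] psd_mat1 by (metis dcone_def ptr_def)

section \<open>Convexity of mixed traces\<close>

lemma convex_seq_le_max:
  fixes g :: "nat \<Rightarrow> real"
  assumes "\<And>i. i + 2 \<le> n \<Longrightarrow> 2 * g (i + 1) \<le> g i + g (i + 2)" "i \<le> n"
  shows "g i \<le> max (g 0) (g n)"
proof -
  define m where "m = Max (g ` {..n})"
  have le: "g j \<le> m" if "j \<le> n" for j unfolding m_def using that by (intro Max_ge) auto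
  have ex: "\<exists>j. j \<le> n \<and> g j = m"
    using Max_in[of "g ` {..n}"] unfolding m_def by fastforce
  \<comment> \<open>The leftmost maximiser has a strictly smaller left neighbour, which contradicts
    convexity unless it sits at an end.\<close>
  define j where "j = (LEAST j. j \<le> n \<and> g j = m)"
  have j: "j \<le> n" "g j = m" using LeastI_ex[OF ex] unfolding j_def by auto
  have "j = 0 \<or> j = n"
  proof (rule ccontr)
    assume *: "\<not> ?thesis"
    then obtain l where l: "j = l + 1" using not0_implies_Suc by auto
    have "g l \<noteq> m" using not_less_Least[of l "\<lambda>j. j \<le> n \<and> g j = m"] l j unfolding j_def by auto
    then have "g l < m" using le[of l] l j by auto
    moreover have "g (l + 2) \<le> m" using le[of "l+2"] * l j by auto
    ultimately show False using assms(1)[of l] * l j by auto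
  qed
  then show ?thesis using le[OF assms(2)] j by auto
qed

text \<open>In eigenbases of \<open>T\<close> and \<open>S\<close> the left-hand side is a sum of
  squares with weights t^i s^(n-i), hence convex in \<open>i\<close>. Without eigenbases, the second
  difference is the pairing of T^i C S^j with C for the commutator-like matrix C = T X - X S, and
  this is nonnegative.\<close>

lemma mixed_power_le_max:
  fixes T :: "real^'m::finite^'m" and S :: "real^'k::finite^'k" and X :: "real^'k^'m"
  assumes T: "dcone T" "transpose T = T" and S: "dcone S" "transpose S = S" and "i \<le> n"
  shows "(mpow T i ** X ** mpow S (n - i)) \<bullet> X
     \<le> max ((X ** mpow S n) \<bullet> X) ((mpow T n ** X) \<bullet> X)"
proof -
  define h where "h i = (mpow T i ** X ** mpow S (n - i)) \<bullet> X" for i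
  have "2 * h (i + 1) \<le> h i + h (i + 2)" if i: "i + 2 \<le> n" for i
  proof -
    define j where "j = n - (i + 2)"
    have n: "n - i = j + 2" "n - (i+1) = j + 1" using i by (auto simp: j_def)
    define C where "C = T ** X - X ** S"
    have tm: "transpose (mpow T i) = mpow T i" "transpose (mpow S j) = mpow S j"
      using T S by (simp_all add: transpose_mpow)
    have T2: "mpow T (i+2) = T ** mpow T i ** T" "mpow T (i+1) = T ** mpow T i"
      by (simp_all add: matrix_mul_assoc [symmetric] mpow_commute)
    have S2: "mpow S (j+2) = S ** mpow S j ** S" "mpow S (j+1) = mpow S j ** S"
      by (simp_all add: matrix_mul_assoc [symmetric] mpow_commute)
    define Y where "Y = mpow T i ** X ** mpow S j"
    have a: "(T ** Z) \<bullet> W = Z \<bullet> (T ** W)" "(Z ** S) \<bullet> W = Z \<bullet> (W ** S)" for Z W :: "real^'k^'m"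
      using inner_mult_left[of T Z W] inner_mult_right[of Z S W] T S by auto
    have h0: "h i = (Y ** S) \<bullet> (X ** S)"
    proof -
      have "h i = (mpow T i ** X ** (S ** mpow S j) ** S) \<bullet> X"
        unfolding h_def n S2 by (simp only: matrix_mul_assoc)
      also have "\<dots> = (mpow T i ** X ** (mpow S j ** S)) \<bullet> (X ** S)"
        by (simp only: a(2) mpow_commute)
      finally show ?thesis unfolding Y_def by (simp only: matrix_mul_assoc)
    qed
    have h1: "h (i+1) = (T ** Y) \<bullet> (X ** S)"
      unfolding h_def n S2 T2 Y_def
      using a(2)[of "T ** mpow T i ** X ** mpow S j" X] by (simp add: matrix_mul_assoc)
    have h1': "h (i+1) = (Y ** S) \<bullet> (T ** X)"
      unfolding h_def n S2 T2 Y_def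
      using a(1)[of "mpow T i ** X ** mpow S j ** S" X] by (simp add: matrix_mul_assoc)
    have h2: "h (i+2) = (T ** Y) \<bullet> (T ** X)"
    proof -
      have "h (i+2) = (T ** (mpow T i ** T ** X ** mpow S j)) \<bullet> X"
        unfolding h_def j_def[symmetric] T2 by (simp only: matrix_mul_assoc)
      also have "\<dots> = (mpow T i ** T ** X ** mpow S j) \<bullet> (T ** X)"
        by (simp only: a(1))
      finally show ?thesis unfolding Y_def by (simp only: matrix_mul_assoc mpow_commute)
    qed
    have CC: "mpow T i ** C ** mpow S j = T ** Y - Y ** S"
    proof -
      have "mpow T i ** C ** mpow S j = (mpow T i ** T) ** X ** mpow S j - mpow T i ** X ** (S ** mpow S j)"
        unfolding C_def mm_dist by (simp only: matrix_mul_assoc)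
      also have "\<dots> = (T ** mpow T i) ** X ** mpow S j - mpow T i ** X ** (mpow S j ** S)"
        by (simp only: mpow_commute)
      finally show ?thesis unfolding Y_def by (simp only: matrix_mul_assoc)
    qed
    have "(T ** Y - Y ** S) \<bullet> C = h (i+2) - 2 * h (i+1) + h i"
      unfolding C_def inner_diff_left inner_diff_right using h0 h1 h1' h2 by simp
    moreover have "(mpow T i ** C ** mpow S j) \<bullet> C = mpow S j \<bullet> (transpose C ** mpow T i ** C)"
      by (simp add: matrix_mul_assoc [symmetric] inner_mult_left tm)
    moreover have "0 \<le> mpow S j \<bullet> (transpose C ** mpow T i ** C)"
      using dcone_mpow[OF S, of j] psd_congruence[OF dcone_psd[OF dcone_mpow[OF T, of i]], of C]
      by (simp add: dcone_def)
    ultimately show ?thesis using CC by simp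
  qed
  from convex_seq_le_max[OF this \<open>i \<le> n\<close>] show ?thesis by (simp add: h_def)
qed

section \<open>Perturbation of regularised trace powers\<close>

text \<open>The spectral norm bound as a predicate (see \<open>opnorm_le_iff\<close>), so that sums,
  products and inverses are estimated pointwise, without suprema.\<close>

definition mbound :: "real^'n::finite^'m::finite \<Rightarrow> real \<Rightarrow> bool" where
  "mbound A e \<longleftrightarrow> (\<forall>x. norm (A *v x) \<le> e * norm x)"

lemma mbound_transpose:
  assumes "mbound A e" "0 \<le> e" shows "mbound (transpose A) e"
  unfolding mbound_def
proof
  fix y
  let ?z = "transpose A *v y"
  have "norm ?z * norm ?z = y \<bullet> (A *v ?z)"
    using inner_transpose_vec[of y A ?z] by (simp only: power2_norm_eq_inner [symmetric] power2_eq_square)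
  also have "\<dots> \<le> norm y * norm (A *v ?z)" by (rule norm_cauchy_schwarz)
  also have "\<dots> \<le> norm y * (e * norm ?z)"
    using assms by (intro mult_left_mono) (auto simp: mbound_def)
  finally have *: "norm ?z * norm ?z \<le> (e * norm y) * norm ?z" by (simp add: mult_ac)
  show "norm ?z \<le> e * norm y"
    using assms * mult_right_le_imp_le[of "norm ?z" "norm ?z" "e * norm y"]
    by (cases "?z = 0") auto
qed

lemma mbound_psd:
  fixes A :: "real^'n::finite^'m::finite"
  assumes "mbound A e" shows "psd (e\<^sup>2 *\<^sub>R mat 1 - transpose A ** A)"
  unfolding psd_def
proof
  fix x
  have "(norm (A *v x))\<^sup>2 \<le> (e * norm x)\<^sup>2"
    using assms by (intro power_mono) (auto simp: mbound_def)
  moreover have "x \<bullet> ((transpose A ** A) *v x) = (norm (A *v x))\<^sup>2"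
    by (simp only: matrix_vector_mul_assoc [symmetric] inner_transpose_vec transpose_transpose power2_norm_eq_inner)
  moreover have "x \<bullet> ((e\<^sup>2 *\<^sub>R mat 1) *v x) = e\<^sup>2 * (norm x)\<^sup>2"
    by (simp add: scaleR_matrix_vector_assoc [symmetric] power2_norm_eq_inner)
  ultimately show "0 \<le> x \<bullet> ((e\<^sup>2 *\<^sub>R mat 1 - transpose A ** A) *v x)"
    by (simp only: matrix_vector_mult_diff_rdistrib inner_diff_right power_mult_distrib)
qed

lemma dcone_inner_mbound:
  fixes A :: "real^'n::finite^'m::finite"
  assumes "dcone P" "mbound A e"
  shows "P \<bullet> (transpose A ** A) \<le> e\<^sup>2 * (P \<bullet> mat 1)"
  using dcone_inner_mono[OF assms(1) mbound_psd[OF assms(2)]] by simp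

lemma inner_gram: "(mat 1 :: real^'n^'n) \<bullet> (transpose A ** A) = A \<bullet> A" for A :: "real^'n::finite^'m::finite"
  using inner_mult_left[of "transpose A" A "mat 1"] by (simp add: inner_commute)

text \<open>The dimension of the larger side does not enter the bound, because the matrix on the left
  differs from \<open>c\<^sup>n I\<close> by a matrix that is conjugate to one on the smaller side.\<close>

lemma mpow_reg_transpose_inner_le:
  fixes G D :: "real^'k::finite^'m::finite"
  assumes c: "0 \<le> c" and D: "mbound D e" and e: "0 \<le> e"
  shows "mpow (reg c (transpose G)) n \<bullet> (D ** transpose D) \<le> e\<^sup>2 * ptr c n G"
proof -
  obtain K where K: "dcone K" "transpose K = K"
    "mpow (reg c G) n = c ^ n *\<^sub>R mat 1 + K ** (transpose G ** G)"
    "mpow (reg c (transpose G)) n = c ^ n *\<^sub>R mat 1 + G ** K ** transpose G"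
    using mpow_reg_expansion[OF c, where G = G and n = n] by auto
  have "(G ** K ** transpose G) \<bullet> (D ** transpose D) \<le> e\<^sup>2 * ((G ** K ** transpose G) \<bullet> mat 1)"
    using dcone_inner_mbound[OF dcone_congruence[OF K(1), of G] mbound_transpose[OF D e]] by simp
  moreover have "(G ** K ** transpose G) \<bullet> mat 1 = ptr c n G - c ^ n * real CARD('k)"
    using ptr_transpose[OF c, where G = G and p = n] by (simp add: ptr_def K(4) inner_add_left mat1_inner_mat1)
  moreover have "mat 1 \<bullet> (D ** transpose D) \<le> e\<^sup>2 * real CARD('k)"
    using dcone_inner_mbound[OF dcone_mat1 D] inner_gram[of D] inner_gram[of "transpose D"]
    by (simp add: inner_transpose mat1_inner_mat1)
  then have "c ^ n * (mat 1 \<bullet> (D ** transpose D)) \<le> c ^ n * (e\<^sup>2 * real CARD('k))"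
    using c by (intro mult_left_mono) auto
  ultimately show ?thesis
    by (simp add: K(4) inner_add_left algebra_simps)
qed

lemma mpow_has_vector_derivative:
  fixes S :: "real \<Rightarrow> real^'n::finite^'n"
  assumes "(S has_vector_derivative S') (at s)"
  shows "((\<lambda>s. mpow (S s) n) has_vector_derivative
    (\<Sum>i<n. mpow (S s) i ** S' ** mpow (S s) (n - 1 - i))) (at s)"
proof (induction n)
  case (Suc n)
  have "((\<lambda>s. S s ** mpow (S s) n) has_vector_derivative
     (S s ** (\<Sum>i<n. mpow (S s) i ** S' ** mpow (S s) (n - 1 - i)) + S' ** mpow (S s) n)) (at s)"
    by (rule mm.has_vector_derivative[OF assms Suc])
  also have "S s ** (\<Sum>i<n. mpow (S s) i ** S' ** mpow (S s) (n - 1 - i)) + S' ** mpow (S s) n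
    = (\<Sum>i<Suc n. mpow (S s) i ** S' ** mpow (S s) (Suc n - 1 - i))"
    by (subst sum.lessThan_Suc_shift) (simp add: mm.sum_right matrix_mul_assoc)
  finally show ?case by simp
qed simp

text \<open>Cyclicity of the trace makes all summands of the noncommutative product rule
  equal.\<close>

lemma mpow_deriv_inner_mat1:
  assumes "transpose S = S"
  shows "(\<Sum>i<Suc q. mpow S i ** S' ** mpow S (Suc q - 1 - i)) \<bullet> mat 1 = real (Suc q) * (mpow S q \<bullet> S')"
proof -
  have "(mpow S i ** S' ** mpow S (q - i)) \<bullet> mat 1 = mpow S q \<bullet> S'" if "i \<le> q" for i
  proof -
    have "(mpow S i ** S' ** mpow S (q - i)) \<bullet> mat 1 = (mpow S i ** S') \<bullet> mpow S (q - i)"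
      by (subst inner_mult_right) (simp add: transpose_mpow assms)
    also have "\<dots> = S' \<bullet> (mpow S i ** mpow S (q - i))"
      by (subst inner_mult_left) (simp add: transpose_mpow assms)
    also have "\<dots> = mpow S q \<bullet> S'"
      using that by (simp add: mpow_add[symmetric] inner_commute)
    finally show ?thesis .
  qed
  then have "(\<Sum>i\<in>{..<Suc q}. (mpow S i ** S' ** mpow S (q - i)) \<bullet> mat 1) = (\<Sum>i\<in>{..<Suc q}. mpow S q \<bullet> S')"
    by (intro sum.cong) auto
  then show ?thesis by (simp only: inner_sum_left diff_Suc_1) simp
qed

abbreviation path_deriv :: "real^'k::finite^'m::finite \<Rightarrow> real^'k^'m \<Rightarrow> real^'k^'k" where
  "path_deriv G D \<equiv> transpose D ** G + transpose G ** D"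

lemma reg_has_vector_derivative:
  fixes X D :: "real^'k::finite^'m::finite"
  shows "((\<lambda>s. reg c (X + s *\<^sub>R D)) has_vector_derivative path_deriv (X + s *\<^sub>R D) D) (at s)"
proof -
  have 1: "((\<lambda>s. X + s *\<^sub>R D) has_vector_derivative D) (at s)"
    by (auto intro!: derivative_eq_intros)
  have 2: "((\<lambda>s. transpose (X + s *\<^sub>R D)) has_vector_derivative transpose D) (at s)"
    by (rule bounded_linear.has_vector_derivative[OF bounded_linear_transpose 1])
  show ?thesis unfolding reg_def
    using mm.has_vector_derivative[OF 2 1] by (auto intro!: derivative_eq_intros simp: add.commute)
qed

lemma ptr_path_deriv1:
  fixes X D :: "real^'k::finite^'m::finite"
  defines "G \<equiv> \<lambda>s. X + s *\<^sub>R D"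
  shows "((\<lambda>s. ptr c (Suc q) (G s)) has_real_derivative
    real (Suc q) * (mpow (reg c (G s)) q \<bullet> path_deriv (G s) D)) (at s)"
proof -
  have "((\<lambda>s. mpow (reg c (G s)) (Suc q) \<bullet> mat 1) has_vector_derivative
    (\<Sum>i<Suc q. mpow (reg c (G s)) i ** path_deriv (G s) D ** mpow (reg c (G s)) (Suc q - 1 - i)) \<bullet> mat 1) (at s)"
    unfolding G_def
    by (rule bounded_linear.has_vector_derivative[OF bounded_linear_inner_left
          mpow_has_vector_derivative[OF reg_has_vector_derivative]])
  then show ?thesis
    unfolding mpow_deriv_inner_mat1[OF transpose_reg] ptr_def has_real_derivative_iff_has_vector_derivative .
qed

lemma ptr_path_deriv2:
  fixes X D :: "real^'k::finite^'m::finite"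
  defines "G \<equiv> \<lambda>s. X + s *\<^sub>R D"
  shows "((\<lambda>s. mpow (reg c (G s)) q \<bullet> path_deriv (G s) D) has_real_derivative
    (\<Sum>i<q. (mpow (reg c (G s)) i ** path_deriv (G s) D ** mpow (reg c (G s)) (q - 1 - i)) \<bullet> path_deriv (G s) D)
      + 2 * (mpow (reg c (G s)) q \<bullet> (transpose D ** D))) (at s)"
proof -
  have 1: "(G has_vector_derivative D) (at s)"
    unfolding G_def by (auto intro!: derivative_eq_intros)
  have "((\<lambda>s. path_deriv (G s) D) has_vector_derivative
      transpose D ** D + transpose D ** D) (at s)"
    by (intro has_vector_derivative_add
          bounded_linear.has_vector_derivative[OF mm.bounded_linear_right 1]
          bounded_linear.has_vector_derivative[OF mm.bounded_linear_left]
          bounded_linear.has_vector_derivative[OF bounded_linear_transpose 1])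
  note * = bounded_bilinear.has_vector_derivative[OF bounded_bilinear_inner
      mpow_has_vector_derivative[OF reg_has_vector_derivative] this, of c X D q]
  show ?thesis
    unfolding has_real_derivative_iff_has_vector_derivative G_def
    by (rule has_vector_derivative_eq_rhs[OF *[unfolded G_def]])
      (simp only: inner_sum_left inner_add_right[of _ "transpose D ** D" "transpose D ** D"] mult_2 add.commute)
qed

text \<open>By convexity of the mixed traces, all terms of the second derivative are dominated by the
  ones with a single power; those are treated by \<open>(P + P\<^sup>T)\<^sup>2 \<le> 2 (P P\<^sup>T + P\<^sup>T P)\<close>.\<close>

lemma ptr_path_deriv2_le:
  fixes G D :: "real^'k::finite^'m::finite"
  assumes c: "0 \<le> c" and D: "mbound D e" and e: "0 \<le> e"
  defines "S \<equiv> reg c G" and "S' \<equiv> path_deriv G D"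
  shows "(\<Sum>i<q. (mpow S i ** S' ** mpow S (q - 1 - i)) \<bullet> S') + 2 * (mpow S q \<bullet> (transpose D ** D))
    \<le> 2 * (2 * real q + 1) * e\<^sup>2 * ptr c q G"
proof -
  define T where "T = reg c (transpose G)"
  have dS: "dcone S" "transpose S = S" and dT: "dcone T" "transpose T = T"
    using c by (simp_all add: S_def T_def dcone_reg)
  have sym: "transpose S' = S'" unfolding S'_def by (simp add: tr_dist add.commute)
  have h0: "(D ** mpow S q) \<bullet> D \<le> e\<^sup>2 * ptr c q G" "mpow S q \<bullet> (transpose D ** D) \<le> e\<^sup>2 * ptr c q G"
  proof -
    show 1: "mpow S q \<bullet> (transpose D ** D) \<le> e\<^sup>2 * ptr c q G"
      using dcone_inner_mbound[OF dcone_mpow_reg[OF c] D] by (simp add: S_def ptr_def)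
    then show "(D ** mpow S q) \<bullet> D \<le> e\<^sup>2 * ptr c q G" by (simp add: inner_mult_left)
  qed
  have hq: "(mpow T q ** D) \<bullet> D \<le> e\<^sup>2 * ptr c q G" "mpow T q \<bullet> (D ** transpose D) \<le> e\<^sup>2 * ptr c q G"
  proof -
    show 1: "mpow T q \<bullet> (D ** transpose D) \<le> e\<^sup>2 * ptr c q G"
      using mpow_reg_transpose_inner_le[OF c D e] by (simp add: T_def)
    then show "(mpow T q ** D) \<bullet> D \<le> e\<^sup>2 * ptr c q G" by (simp add: inner_mult_right)
  qed
  have "(\<Sum>i<q. (mpow S i ** S' ** mpow S (q - 1 - i)) \<bullet> S') \<le> (\<Sum>i<q. 4 * (e\<^sup>2 * ptr c q G))"
  proof (rule sum_mono)
    fix i assume i: "i \<in> {..<q}"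
    define n where "n = q - 1"
    have q: "q = Suc n" using i by (auto simp: n_def)
    have "(mpow S i ** S' ** mpow S (n - i)) \<bullet> S' \<le> max ((S' ** mpow S n) \<bullet> S') ((mpow S n ** S') \<bullet> S')"
      using i by (intro mixed_power_le_max dS) (simp add: q)
    \<comment> \<open>Transposition exchanges the two ends of the convex sequence, so they agree
      because \<open>S'\<close> is symmetric.\<close>
    also have "(mpow S n ** S') \<bullet> S' = (S' ** mpow S n) \<bullet> S'"
    proof -
      have "(mpow S n ** S') \<bullet> S' = transpose (mpow S n ** S') \<bullet> transpose S'"
        by (simp only: inner_transpose)
      then show ?thesis using dS sym by (simp add: tr_dist transpose_mpow)
    qed
    also have "(S' ** mpow S n) \<bullet> S' = mpow S n \<bullet> (transpose S' ** S')"
      by (simp add: inner_mult_left)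
    also have "\<dots> \<le> 2 * (mpow S n \<bullet> (transpose D ** G ** transpose G ** D)) + 2 * (mpow S n \<bullet> (transpose G ** D ** transpose D ** G))"
    proof -
      define P where "P = transpose D ** G"
      have P: "S' = P + transpose P" by (simp add: S'_def P_def tr_dist)
      have "psd ((P - transpose P) ** transpose (P - transpose P))"
        using psd_gram[of "transpose (P - transpose P)"] by simp
      also have "(P - transpose P) ** transpose (P - transpose P) =
         2 *\<^sub>R (P ** transpose P) + 2 *\<^sub>R (transpose P ** P) - transpose S' ** S'"
        unfolding P by (simp add: tr_dist mm_dist scaleR_2)
      finally have "psd \<dots>" .
      from dcone_inner_mono[OF dcone_mpow[OF dS] this, of n] show ?thesis
        by (simp add: inner_add_right P_def tr_dist matrix_mul_assoc)
    qed
    also have "mpow S n \<bullet> (transpose D ** G ** transpose G ** D) \<le> e\<^sup>2 * ptr c q G"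
    proof -
      have "mpow S n \<bullet> (transpose D ** G ** transpose G ** D) =
          mpow S n \<bullet> (transpose D ** T ** D) - c * (mpow S n \<bullet> (transpose D ** D))"
        by (simp add: T_def reg_def mm_dist inner_add_right matrix_mul_assoc)
      also have "\<dots> \<le> mpow S n \<bullet> (transpose D ** T ** D)"
        using c dcone_mpow[OF dS, of n] psd_gram[of D] by (simp add: dcone_def)
      \<comment> \<open>A second mixed trace, now with \<open>T\<close> to the left of
        \<open>D\<close> and \<open>S\<close> to its right; its ends are the single-power terms
        bounded in \<open>h0\<close> and \<open>hq\<close>.\<close>
      also have "\<dots> = (mpow T 1 ** D ** mpow S (q - 1)) \<bullet> D"
        using inner_mult_left[of "T ** D" "mpow S n" D] dT
        by (simp add: q tr_dist)
      also have "\<dots> \<le> max ((D ** mpow S q) \<bullet> D) ((mpow T q ** D) \<bullet> D)"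
        by (intro mixed_power_le_max dS dT) (simp add: q)
      also have "\<dots> \<le> e\<^sup>2 * ptr c q G" using h0 hq by simp
      finally show ?thesis .
    qed
    also have "mpow S n \<bullet> (transpose G ** D ** transpose D ** G) \<le> e\<^sup>2 * ptr c q G"
    proof -
      have "mpow S n \<bullet> (transpose G ** D ** transpose D ** G) = (G ** mpow S n ** transpose G) \<bullet> (D ** transpose D)"
        using inner_mult_right[of "G ** mpow S n" "transpose G" "D ** transpose D"]
           inner_mult_left[of G "mpow S n" "D ** transpose D ** G"]
        by (simp add: matrix_mul_assoc)
      also have "\<dots> = mpow T q \<bullet> (D ** transpose D) - c * (mpow T n \<bullet> (D ** transpose D))"
      proof -
        have "mpow T q = mpow T n ** T" by (simp add: q mpow_commute)
        then have "mpow T q = G ** mpow S n ** transpose G + c *\<^sub>R mpow T n"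
          by (simp add: T_def S_def reg_intertwine) (simp add: reg_def mm_dist matrix_mul_assoc)
        then show ?thesis by (simp add: inner_add_left)
      qed
      also have "\<dots> \<le> mpow T q \<bullet> (D ** transpose D)"
        using c dcone_mpow[OF dT, of n] psd_gram[of "transpose D"] by (simp add: dcone_def)
      also have "\<dots> \<le> e\<^sup>2 * ptr c q G" using hq by simp
      finally show ?thesis .
    qed
    finally show "(mpow S i ** S' ** mpow S (q - 1 - i)) \<bullet> S' \<le> 4 * (e\<^sup>2 * ptr c q G)"
      by (simp add: n_def mult_ac)
  qed
  then show ?thesis using h0 by (simp add: algebra_simps)
qed

section \<open>From the second derivative to the size of the perturbed potential\<close>

lemma second_order_comparison:
  fixes u u' u'' :: "real \<Rightarrow> real"
  assumes "\<kappa> > 0"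
    and u: "\<And>s. (u has_real_derivative u' s) (at s)" "\<And>s. (u' has_real_derivative u'' s) (at s)"
    and le: "\<And>s. u'' s \<le> \<kappa>\<^sup>2 * u s"
  shows "u 1 \<le> cosh \<kappa> * u 0 + sinh \<kappa> / \<kappa> * u' 0"
proof -
  \<comment> \<open>Backward variation of constants: both weights solve f'' = \<kappa>^2 f,
    \<open>w 1\<close> is \<open>u 1\<close>, and \<open>w 0\<close> is the right-hand side. In the
    derivative of \<open>w\<close> only the defect u'' - \<kappa>^2 u survives, with a nonnegative
    factor.\<close>
  define w where "w s = u' s * (sinh (\<kappa> * (1 - s)) / \<kappa>) + u s * cosh (\<kappa> * (1 - s))" for s
  have "w 1 \<le> w 0"
  proof (rule DERIV_nonpos_imp_nonincreasing[of 0 1 w])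
    fix s :: real assume s: "0 \<le> s" "s \<le> 1"
    have "(w has_real_derivative (u'' s - \<kappa>\<^sup>2 * u s) * (sinh (\<kappa> * (1 - s)) / \<kappa>)) (at s)"
      unfolding w_def using \<open>\<kappa> > 0\<close>
      by (auto intro!: derivative_eq_intros u simp: field_simps power2_eq_square)
    moreover have "(u'' s - \<kappa>\<^sup>2 * u s) * (sinh (\<kappa> * (1 - s)) / \<kappa>) \<le> 0"
      using le[of s] s \<open>\<kappa> > 0\<close> by (intro mult_nonpos_nonneg divide_nonneg_pos) auto
    ultimately show "\<exists>y. (w has_real_derivative y) (at s) \<and> y \<le> 0" by blast
  qed simp
  then show ?thesis by (simp add: w_def mult_ac)
qed

lemma ptr_mono_exponent:
  assumes "0 \<le> c" shows "c * ptr c q G \<le> ptr c (Suc q) G"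
proof -
  have "mpow (reg c G) (Suc q) \<bullet> mat 1 = mpow (reg c G) q \<bullet> (transpose G ** G) + c * ptr c q G"
    by (simp add: inner_mult_left ptr_def) (simp add: reg_def inner_add_right)
  moreover have "0 \<le> mpow (reg c G) q \<bullet> (transpose G ** G)"
    using dcone_mpow_reg[OF assms, of G q] psd_gram[of G] by (simp add: dcone_def)
  ultimately show ?thesis by (simp add: ptr_def)
qed

lemma ptr_add_le:
  fixes X D :: "real^'k::finite^'m::finite"
  assumes c: "0 < c" and D: "mbound D e" and e: "0 < e"
  assumes \<kappa>: "\<kappa> = 2 * real (Suc q) * e / sqrt c"
  shows "ptr c (Suc q) (X + D) \<le> cosh \<kappa> * ptr c (Suc q) X
     + sinh \<kappa> / \<kappa> * (real (Suc q) * (mpow (reg c X) q \<bullet> path_deriv X D))"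
proof -
  define u where "u s = ptr c (Suc q) (X + s *\<^sub>R D)" for s
  define v where "v s = real (Suc q) * (mpow (reg c (X + s *\<^sub>R D)) q \<bullet> path_deriv (X + s *\<^sub>R D) D)" for s
  have "u 1 \<le> cosh \<kappa> * u 0 + sinh \<kappa> / \<kappa> * v 0"
  proof (rule second_order_comparison)
    show "\<kappa> > 0" using c e by (simp add: \<kappa>)
    show "(u has_real_derivative v s) (at s)" for s
      unfolding u_def v_def by (rule ptr_path_deriv1)
    fix s
    let ?w = "real (Suc q) * ((\<Sum>i<q. (mpow (reg c (X + s *\<^sub>R D)) i ** path_deriv (X + s *\<^sub>R D) D **
         mpow (reg c (X + s *\<^sub>R D)) (q - 1 - i)) \<bullet> path_deriv (X + s *\<^sub>R D) D)
      + 2 * (mpow (reg c (X + s *\<^sub>R D)) q \<bullet> (transpose D ** D)))"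
    show "(v has_real_derivative ?w) (at s)"
      unfolding v_def by (rule DERIV_cmult[OF ptr_path_deriv2])
    have "?w \<le> real (Suc q) * (2 * (2 * real q + 1) * e\<^sup>2 * ptr c q (X + s *\<^sub>R D))"
      using ptr_path_deriv2_le[OF _ D, where c = c and q = q and G = "X + s *\<^sub>R D"] c e by (intro mult_left_mono) auto
    \<comment> \<open>Rounding 2 (2q + 1) up to 4 (q + 1) completes the square in p = q + 1;
      \<open>ptr_mono_exponent\<close> then restores the missing power at the price 1/c.\<close>
    also have "\<dots> \<le> real (Suc q) * (4 * real (Suc q) * e\<^sup>2 * ptr c q (X + s *\<^sub>R D))"
      using ptr_nonneg[of c q "X + s *\<^sub>R D"] c by (intro mult_left_mono mult_right_mono) auto
    also have "\<dots> = (\<kappa>\<^sup>2) * (c * ptr c q (X + s *\<^sub>R D))"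
      using c by (simp add: \<kappa> power_mult_distrib power_divide power2_eq_square) (simp add: algebra_simps)
    also have "\<dots> \<le> \<kappa>\<^sup>2 * u s"
      unfolding u_def using ptr_mono_exponent[where c = c and q = q] c by (intro mult_left_mono) auto
    finally show "?w \<le> \<kappa>\<^sup>2 * u s" .
  qed
  then show ?thesis by (simp add: u_def v_def)
qed

section \<open>Comparison with the operator norm\<close>

text \<open>Powers are not operator monotone, but their traces are: along the segment from
  \<open>A\<close> to \<open>B\<close> the derivative is \<open>p\<close> times the pairing of a
  power in the dual cone with B - A.\<close>

lemma trace_mpow_mono:
  fixes A B :: "real^'n::finite^'n"
  assumes A: "dcone A" "transpose A = A" and B: "dcone B" "transpose B = B" and "psd (B - A)"
  shows "mpow A p \<bullet> mat 1 \<le> mpow B p \<bullet> mat 1"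
proof (cases p)
  case (Suc q)
  define S where "S s = A + s *\<^sub>R (B - A)" for s :: real
  have S: "dcone (S s)" "transpose (S s) = S s" if "0 \<le> s" "s \<le> 1" for s
  proof -
    have "S s = (1 - s) *\<^sub>R A + s *\<^sub>R B" by (simp add: S_def algebra_simps)
    then show "dcone (S s)" using that A B by (auto intro!: dcone_add dcone_scaleR)
    show "transpose (S s) = S s" by (simp add: S_def tr_dist A B)
  qed
  have "mpow (S 0) p \<bullet> mat 1 \<le> mpow (S 1) p \<bullet> mat 1"
  proof (rule DERIV_nonneg_imp_nondecreasing[of 0 1 "\<lambda>s. mpow (S s) p \<bullet> mat 1"])
    fix s :: real assume s: "0 \<le> s" "s \<le> 1"
    have "(S has_vector_derivative (B - A)) (at s)"
      unfolding S_def by (auto intro!: derivative_eq_intros)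
    from bounded_linear.has_vector_derivative[OF bounded_linear_inner_left mpow_has_vector_derivative[OF this]]
    have "((\<lambda>s. mpow (S s) p \<bullet> mat 1) has_real_derivative real p * (mpow (S s) q \<bullet> (B - A))) (at s)"
      unfolding has_real_derivative_iff_has_vector_derivative Suc mpow_deriv_inner_mat1[OF S(2)[OF s], symmetric] .
    moreover have "0 \<le> real p * (mpow (S s) q \<bullet> (B - A))"
      using dcone_mpow[OF S[OF s], of q] assms(5) by (simp add: dcone_def)
    ultimately show "\<exists>y. ((\<lambda>s. mpow (S s) p \<bullet> mat 1) has_real_derivative y) (at s) \<and> 0 \<le> y" by blast
  qed simp
  then show ?thesis by (simp add: S_def)
qed simp

lemma ptr_mult_left_le:
  fixes W :: "real^'k::finite^'m::finite" and N :: "real^'m^'m"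
  assumes c: "0 \<le> c" and N: "mbound N \<nu>"
  shows "ptr c p (N ** W) \<le> ptr c p (\<nu> *\<^sub>R W)"
  unfolding ptr_def
proof (rule trace_mpow_mono)
  have "psd (transpose W ** (\<nu>\<^sup>2 *\<^sub>R mat 1 - transpose N ** N) ** W)"
    by (rule psd_congruence[OF mbound_psd[OF N]])
  also have "transpose W ** (\<nu>\<^sup>2 *\<^sub>R mat 1 - transpose N ** N) ** W = reg c (\<nu> *\<^sub>R W) - reg c (N ** W)"
    by (simp add: reg_def mm_dist tr_dist matrix_mul_assoc power2_eq_square)
  finally show "psd (reg c (\<nu> *\<^sub>R W) - reg c (N ** W))" .
qed (use c in \<open>simp_all add: dcone_reg\<close>)

text \<open>B^T W^T W B and b^2 W^T W are in general not comparable as forms. After transposition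
  \<open>B\<close> acts from the left, where \<open>ptr_mult_left_le\<close> applies, and the
  dimension corrections of \<open>ptr_transpose\<close> cancel.\<close>

lemma ptr_mult_right_le:
  fixes W :: "real^'k::finite^'m::finite" and B :: "real^'k^'k"
  assumes c: "0 \<le> c" and B: "mbound B b" and b: "0 \<le> b"
  shows "ptr c p (W ** B) \<le> ptr c p (b *\<^sub>R W)"
proof -
  have "ptr c p (transpose (W ** B)) \<le> ptr c p (transpose (b *\<^sub>R W))"
    using ptr_mult_left_le[OF c mbound_transpose[OF B b], of p "transpose W"] by (simp add: tr_dist)
  then show ?thesis
    using ptr_transpose[OF c, where G = "W ** B" and p = p] ptr_transpose[OF c, where G = "b *\<^sub>R W" and p = p]
    by simp
qed

lemma ptr_scaleR_mono:
  assumes c: "0 \<le> c" and "0 \<le> r" "r \<le> s"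
  shows "ptr c p (r *\<^sub>R W) \<le> ptr c p (s *\<^sub>R W)"
proof -
  have "mbound (r *\<^sub>R mat 1) s"
    using assms by (auto simp: mbound_def scaleR_matrix_vector_assoc [symmetric] intro!: mult_right_mono)
  from ptr_mult_left_le[OF c this, of p W] show ?thesis by (simp add: mm_dist)
qed

lemma mpow_scaleR_mat1: "mpow (r *\<^sub>R mat 1) n = r ^ n *\<^sub>R mat 1"
  by (induction n) (simp_all add: mm_dist)

lemma ptr_le_of_mbound:
  fixes G :: "real^'k::finite^'m::finite"
  assumes c: "0 \<le> c" and G: "mbound G g"
  shows "ptr c p G \<le> real CARD('k) * (g\<^sup>2 + c) ^ p"
proof -
  have "ptr c p G \<le> mpow ((g\<^sup>2 + c) *\<^sub>R mat 1 :: real^'k^'k) p \<bullet> mat 1"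
    unfolding ptr_def
  proof (rule trace_mpow_mono)
    show "psd ((g\<^sup>2 + c) *\<^sub>R mat 1 - reg c G)"
      using mbound_psd[OF G] by (simp add: reg_def algebra_simps)
  qed (use c in \<open>simp_all add: dcone_reg dcone_scaleR dcone_mat1 tr_dist\<close>)
  then show ?thesis by (simp add: mpow_scaleR_mat1 mat1_inner_mat1 mult.commute)
qed

text \<open>Jensen's inequality for the spectral measure of \<open>x\<close>. Testing S^n on the
  residual S x - l x yields \<mu>(n+2) - 2 l \<mu>(n+1) + l^2 \<mu>(n) \<ge> 0, from which l
  \<mu>(n) \<le> \<mu>(n+1) follows by induction.\<close>

lemma rayleigh_power_le:
  fixes S :: "real^'n::finite^'n"
  assumes S: "dcone S" "transpose S = S" and x: "norm x = 1"
  shows "(x \<bullet> (S *v x)) ^ n \<le> x \<bullet> (mpow S n *v x)"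
proof -
  define \<mu> where "\<mu> n = x \<bullet> (mpow S n *v x)" for n
  define l where "l = \<mu> 1"
  have l: "0 \<le> l" using dcone_psd[OF S(1)] by (simp add: l_def \<mu>_def psd_def)
  have \<mu>0: "\<mu> 0 = 1" using x by (simp add: \<mu>_def norm_eq_1)
  have step: "l * \<mu> n \<le> \<mu> (Suc n)" for n
  proof (induction n)
    case 0 show ?case using \<mu>0 by (simp add: l_def)
  next
    case (Suc n)
    let ?y = "S *v x - l *\<^sub>R x"
    have e: "(S *v x) \<bullet> (mpow S n *v z) = x \<bullet> (mpow S (Suc n) *v z)" for z
      using inner_transpose_vec[of x S "mpow S n *v z"] S(2) by (simp add: matrix_vector_mul_assoc)
    have f: "x \<bullet> (mpow S n *v (S *v x)) = \<mu> (Suc n)"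
      unfolding \<mu>_def by (simp add: matrix_vector_mul_assoc mpow_commute)
    have g: "x \<bullet> (mpow S (Suc n) *v (S *v x)) = \<mu> (Suc (Suc n))"
      unfolding \<mu>_def by (simp add: matrix_vector_mul_assoc mpow_commute matrix_mul_assoc [symmetric])
    have "0 \<le> ?y \<bullet> (mpow S n *v ?y)"
      using dcone_psd[OF dcone_mpow[OF S, of n]] by (simp add: psd_def)
    also have "?y \<bullet> (mpow S n *v ?y) = \<mu> (Suc (Suc n)) - 2 * l * \<mu> (Suc n) + l * (l * \<mu> n)"
      by (simp only: matrix_vector_mult_diff_distrib inner_diff_left inner_diff_right e f g
          matrix_vector_mult_scaleR inner_scaleR_left inner_scaleR_right)
        (simp add: \<mu>_def algebra_simps)
    finally show ?case using mult_left_mono[OF Suc l] by simp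
  qed
  have "l ^ n \<le> \<mu> n"
  proof (induction n)
    case (Suc n) then show ?case using step[of n] mult_left_mono[OF Suc l] by simp
  qed (simp add: \<mu>0)
  then show ?thesis by (simp add: l_def \<mu>_def)
qed

lemma dcone_rayleigh_le_trace:
  fixes P :: "real^'n::finite^'n"
  assumes P: "dcone P" and x: "norm x = 1"
  shows "x \<bullet> (P *v x) \<le> P \<bullet> mat 1"
proof -
  let ?Q = "\<chi> i j. x$i * x$j"
  have "psd (mat 1 - ?Q)"
    unfolding psd_def
  proof
    fix y
    have "y \<bullet> (?Q *v y) = (x \<bullet> y)\<^sup>2" by (rule outer_product_inner)
    moreover have "(x \<bullet> y)\<^sup>2 \<le> y \<bullet> y"
      using Cauchy_Schwarz_ineq[of x y] x by (simp add: norm_eq_1)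
    ultimately show "0 \<le> y \<bullet> ((mat 1 - ?Q) *v y)"
      by (simp add: matrix_vector_mult_diff_rdistrib inner_diff_right)
  qed
  from dcone_inner_mono[OF P this] have "P \<bullet> ?Q \<le> P \<bullet> mat 1" .
  moreover have "P \<bullet> ?Q = x \<bullet> (P *v x)" by (rule outer_product_inner)
  ultimately show ?thesis by simp
qed

lemma ptr_ge:
  fixes G :: "real^'k::finite^'m::finite"
  assumes c: "0 \<le> c" and x: "norm x = 1"
  shows "((norm (G *v x))\<^sup>2 + c) ^ p \<le> ptr c p G"
proof -
  have "x \<bullet> (reg c G *v x) = (norm (G *v x))\<^sup>2 + c"
  proof -
    have "x \<bullet> ((transpose G ** G) *v x) = (norm (G *v x))\<^sup>2"
      by (simp only: matrix_vector_mul_assoc [symmetric] inner_transpose_vec transpose_transpose power2_norm_eq_inner)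
    moreover have "x \<bullet> ((c *\<^sub>R mat 1) *v x) = c"
      using x by (simp add: scaleR_matrix_vector_assoc [symmetric] norm_eq_1)
    ultimately show ?thesis
      by (simp only: reg_def matrix_vector_mult_add_rdistrib inner_add_right)
  qed
  then have "((norm (G *v x))\<^sup>2 + c) ^ p \<le> x \<bullet> (mpow (reg c G) p *v x)"
    using rayleigh_power_le[OF dcone_reg[OF c] transpose_reg x, of G p] by simp
  also have "\<dots> \<le> ptr c p G"
    unfolding ptr_def by (rule dcone_rayleigh_le_trace[OF dcone_mpow_reg[OF c] x])
  finally show ?thesis .
qed

lemma mbound_opnorm: "mbound A (opnorm A)"
  unfolding mbound_def opnorm_def
  by (intro allI onorm matrix_vector_mul_bounded_linear)

lemma opnorm_nonneg: "0 \<le> opnorm A"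
  unfolding opnorm_def by (intro onorm_pos_le matrix_vector_mul_bounded_linear)

lemma opnorm_le: "mbound A e \<Longrightarrow> opnorm A \<le> e"
  unfolding opnorm_def mbound_def by (intro onorm_le) auto

text \<open>The counterpart of \<open>ptr_le_of_mbound\<close>, without the factor \<open>k\<close>:
  a large norm forces a large potential, as the Markov bounds require. The strict hypothesis
  supplies a vector stretched by more than \<open>B\<close>, so no maximiser has to be
  found.\<close>

lemma ptr_ge_opnorm:
  fixes G :: "real^'k::finite^'m::finite"
  assumes c: "0 \<le> c" and B: "0 \<le> B" "B < opnorm G"
  shows "(B\<^sup>2 + c) ^ p \<le> ptr c p G"
proof -
  have "\<not> mbound G B" using opnorm_le[of G B] B by auto
  then obtain x where x: "norm (G *v x) > B * norm x" by (auto simp: mbound_def not_le)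
  then have "x \<noteq> 0" by auto
  define y where "y = (1 / norm x) *\<^sub>R x"
  have y: "norm y = 1" using \<open>x \<noteq> 0\<close> by (simp add: y_def)
  have "B \<le> norm (G *v y)"
    using x \<open>x \<noteq> 0\<close> by (simp add: y_def matrix_vector_mult_scaleR field_simps)
  then have "(B\<^sup>2 + c) ^ p \<le> ((norm (G *v y))\<^sup>2 + c) ^ p"
    using B c by (intro power_mono add_right_mono) auto
  also have "\<dots> \<le> ptr c p G" by (rule ptr_ge[OF c y])
  finally show ?thesis .
qed

text \<open>Weighted AM-GM. For the weight \<tau> = e / sqrt c the two squares become \<tau> X^T X
  and, since e^2 / \<tau> = \<tau> c, at most \<tau> c I; together they are \<tau> times
  \<open>reg c X\<close>, which raises the power from \<open>q\<close> to
  \<open>Suc q\<close>.\<close>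

lemma ptr_remainder_le:
  fixes X R :: "real^'k::finite^'m::finite"
  assumes c: "0 < c" and R: "mbound R e" and e: "0 < e"
  shows "mpow (reg c X) q \<bullet> path_deriv X R \<le> e / sqrt c * ptr c (Suc q) X"
proof -
  define \<tau> where "\<tau> = e / sqrt c"
  define P where "P = mpow (reg c X) q"
  have \<tau>: "\<tau> > 0" using c e by (simp add: \<tau>_def)
  have dP: "dcone P" using c by (simp add: P_def dcone_mpow_reg)
  let ?Z = "sqrt \<tau> *\<^sub>R X - (1 / sqrt \<tau>) *\<^sub>R R"
  have "psd (transpose ?Z ** ?Z)" by (rule psd_gram)
  also have "transpose ?Z ** ?Z = (\<tau> *\<^sub>R (transpose X ** X) + (1 / \<tau>) *\<^sub>R (transpose R ** R)) - path_deriv X R"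
    using \<tau> by (simp add: tr_dist mm_dist scaleR_diff_right)
  finally have "P \<bullet> path_deriv X R \<le> P \<bullet> (\<tau> *\<^sub>R (transpose X ** X) + (1 / \<tau>) *\<^sub>R (transpose R ** R))"
    by (rule dcone_inner_mono[OF dP])
  also have "\<dots> = \<tau> * (P \<bullet> (transpose X ** X)) + (1 / \<tau>) * (P \<bullet> (transpose R ** R))"
    by (simp add: inner_add_right)
  also have "\<dots> \<le> \<tau> * (P \<bullet> (transpose X ** X)) + (1 / \<tau>) * (e\<^sup>2 * (P \<bullet> mat 1))"
    using dcone_inner_mbound[OF dP R] \<tau> by (intro add_left_mono mult_left_mono) auto
  also have "(1 / \<tau>) * (e\<^sup>2 * (P \<bullet> mat 1)) = \<tau> * (c * (P \<bullet> mat 1))"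
    using c e by (simp add: \<tau>_def power2_eq_square field_simps)
  also have "\<tau> * (P \<bullet> (transpose X ** X)) + \<tau> * (c * (P \<bullet> mat 1)) = \<tau> * ptr c (Suc q) X"
  proof -
    have "ptr c (Suc q) X = P \<bullet> reg c X"
      by (simp add: ptr_def P_def inner_mult_left)
    then show ?thesis by (simp add: reg_def inner_add_right algebra_simps)
  qed
  finally show ?thesis by (simp add: \<tau>_def P_def)
qed

section \<open>Hyperbolic estimates and the multiplicative form of the perturbation bound\<close>

lemma sinh_le_mult_cosh: "0 \<le> x \<Longrightarrow> sinh x \<le> x * cosh (x::real)"
proof -
  assume "0 \<le> x"
  have "0 * cosh 0 - sinh 0 \<le> x * cosh x - sinh x"
  proof (rule DERIV_nonneg_imp_nondecreasing[of 0 x "\<lambda>x. x * cosh x - sinh x"])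
    fix t :: real assume "0 \<le> t"
    then show "\<exists>y. ((\<lambda>x. x * cosh x - sinh x) has_real_derivative y) (at t) \<and> 0 \<le> y"
      by (intro exI[of _ "t * sinh t"]) (auto intro!: derivative_eq_intros)
  qed fact
  then show ?thesis by simp
qed

text \<open>The logarithmic derivative of cosh is tanh, and tanh t \<le> t.\<close>

lemma cosh_le_exp_half_square: "0 \<le> x \<Longrightarrow> cosh x \<le> exp (x\<^sup>2 / 2)" for x :: real
proof -
  assume "0 \<le> x"
  have "0\<^sup>2 / 2 - ln (cosh 0) \<le> x\<^sup>2 / 2 - ln (cosh x)"
  proof (rule DERIV_nonneg_imp_nondecreasing[of 0 x "\<lambda>x. x\<^sup>2 / 2 - ln (cosh x)"])
    fix t :: real assume t: "0 \<le> t"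
    then show "\<exists>y. ((\<lambda>x. x\<^sup>2 / 2 - ln (cosh x)) has_real_derivative y) (at t) \<and> 0 \<le> y"
      using sinh_le_mult_cosh[OF t] cosh_real_pos[of t]
      by (intro exI[of _ "t - sinh t / cosh t"]) (auto intro!: derivative_eq_intros simp: field_simps)
  qed fact
  then have "ln (cosh x) \<le> x\<^sup>2 / 2" by simp
  then show ?thesis using cosh_real_pos[of x] by (metis exp_le_cancel_iff exp_ln)
qed

text \<open>\<open>L\<close> is fixed before \<open>Y\<close> and \<open>R\<close>, so the last
  summand is linear in \<open>Y\<close> and can be averaged away later, whereas \<open>R\<close> is
  paid for in the exponent.\<close>

lemma ptr_step_le:
  fixes X :: "real^'k::finite^'m::finite"
  assumes c: "0 < c" and e: "0 < e" and e2: "0 < e2"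
  shows "\<exists>L. \<forall>Y R. mbound (Y + R) e \<longrightarrow> mbound R e2 \<longrightarrow> ptr c (Suc q) (X + (Y + R :: real^'k^'m))
    \<le> exp (2 * (real (Suc q))\<^sup>2 * e\<^sup>2 / c + real (Suc q) * e2 / sqrt c) * ptr c (Suc q) X
      + L * (mpow (reg c X) q \<bullet> path_deriv X Y)"
proof (intro exI allI impI)
  fix Y R :: "real^'k^'m" assume D: "mbound (Y + R) e" and R: "mbound R e2"
  let ?p = "real (Suc q)"
  define \<kappa> where "\<kappa> = 2 * ?p * e / sqrt c"
  define s where "s = sinh \<kappa> / \<kappa>"
  have \<kappa>: "0 < \<kappa>" using c e by (simp add: \<kappa>_def)
  have s: "0 \<le> s" "s \<le> cosh \<kappa>"
    using \<kappa> sinh_le_mult_cosh[of \<kappa>] by (simp_all add: s_def field_simps)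
  have \<Phi>: "0 \<le> ptr c (Suc q) X" using c by (intro ptr_nonneg) auto
  have "ptr c (Suc q) (X + (Y + R)) \<le> cosh \<kappa> * ptr c (Suc q) X
     + s * (?p * (mpow (reg c X) q \<bullet> path_deriv X (Y + R)))"
    unfolding s_def by (rule ptr_add_le[OF c D e \<kappa>_def])
  also have "path_deriv X (Y + R) = path_deriv X Y + path_deriv X R"
    by (simp add: tr_dist mm_dist)
  also have "cosh \<kappa> * ptr c (Suc q) X + s * (?p * (mpow (reg c X) q \<bullet> (path_deriv X Y + path_deriv X R)))
    \<le> cosh \<kappa> * ptr c (Suc q) X + s * (?p * (mpow (reg c X) q \<bullet> path_deriv X Y + e2 / sqrt c * ptr c (Suc q) X))"
    unfolding inner_add_right[of _ "path_deriv X Y" "path_deriv X R"]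
    using ptr_remainder_le[OF c R e2, of X q] s by (intro add_left_mono mult_left_mono) auto
  also have "\<dots> = (cosh \<kappa> + s * (?p * e2 / sqrt c)) * ptr c (Suc q) X + (s * ?p) * (mpow (reg c X) q \<bullet> path_deriv X Y)"
    by (simp add: algebra_simps)
  also have "\<dots> \<le> exp (2 * ?p\<^sup>2 * e\<^sup>2 / c + ?p * e2 / sqrt c) * ptr c (Suc q) X + (s * ?p) * (mpow (reg c X) q \<bullet> path_deriv X Y)"
  proof (intro add_right_mono mult_right_mono \<Phi>)
    have "cosh \<kappa> + s * (?p * e2 / sqrt c) \<le> cosh \<kappa> + cosh \<kappa> * (?p * e2 / sqrt c)"
      using s c e2 by (intro add_left_mono mult_right_mono) auto
    also have "\<dots> = cosh \<kappa> * (1 + ?p * e2 / sqrt c)" by (simp add: algebra_simps)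
    also have "\<dots> \<le> exp (\<kappa>\<^sup>2 / 2) * exp (?p * e2 / sqrt c)"
      using c e2 \<kappa> cosh_le_exp_half_square[of \<kappa>] exp_ge_add_one_self[of "?p * e2 / sqrt c"]
      by (intro mult_mono) auto
    also have "\<dots> = exp (2 * ?p\<^sup>2 * e\<^sup>2 / c + ?p * e2 / sqrt c)"
      unfolding exp_add [symmetric] using c by (simp add: \<kappa>_def power_divide power_mult_distrib del: of_nat_Suc)
    finally show "cosh \<kappa> + s * (?p * e2 / sqrt c) \<le> exp (2 * ?p\<^sup>2 * e\<^sup>2 / c + ?p * e2 / sqrt c)" .
  qed
  finally show "ptr c (Suc q) (X + (Y + R))
    \<le> exp (2 * ?p\<^sup>2 * e\<^sup>2 / c + ?p * e2 / sqrt c) * ptr c (Suc q) X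
      + (sinh (2 * ?p * e / sqrt c) / (2 * ?p * e / sqrt c) * ?p) * (mpow (reg c X) q \<bullet> path_deriv X Y)"
    by (simp add: s_def \<kappa>_def)
qed

section \<open>Calculus of norm bounds\<close>

lemma mbound_mult:
  assumes "mbound A a" "mbound B b" "0 \<le> a" shows "mbound (A ** B) (a * b)"
  unfolding mbound_def
proof
  fix x
  have "norm (A *v (B *v x)) \<le> a * norm (B *v x)" using assms by (simp add: mbound_def)
  also have "\<dots> \<le> a * (b * norm x)" using assms by (intro mult_left_mono) (auto simp: mbound_def)
  finally show "norm ((A ** B) *v x) \<le> a * b * norm x" by (simp add: matrix_vector_mul_assoc mult_ac)
qed

lemma mbound_add: "mbound A a \<Longrightarrow> mbound B b \<Longrightarrow> mbound (A + B) (a + b)"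
  unfolding mbound_def matrix_vector_mult_add_rdistrib distrib_right
  by (meson add_mono norm_triangle_le)

lemma mbound_diff: "mbound A a \<Longrightarrow> mbound B b \<Longrightarrow> mbound (A - B) (a + b)"
  unfolding mbound_def matrix_vector_mult_diff_rdistrib distrib_right
  by (meson add_mono norm_triangle_le_diff)

lemma mbound_scaleR: "mbound A a \<Longrightarrow> mbound (r *\<^sub>R A) (\<bar>r\<bar> * a)"
  unfolding mbound_def scaleR_matrix_vector_assoc [symmetric]
  by (auto simp: mult.assoc intro!: mult_left_mono)

lemma mbound_minus: "mbound A a \<Longrightarrow> mbound (- A) a"
  using mbound_scaleR[of A a "-1"] by simp

lemma mbound_mono: "mbound A a \<Longrightarrow> a \<le> b \<Longrightarrow> mbound A b"
  unfolding mbound_def by (meson mult_right_mono norm_ge_zero order_trans)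

section \<open>One step of the iteration\<close>

definition diag :: "('n::finite \<Rightarrow> real) \<Rightarrow> real^'n^'n" where
  "diag f = (\<chi> i j. if i = j then f i else 0)"

lemma diag_mult_vec: "diag f *v x = (\<chi> i. f i * x$i)"
  by (simp add: diag_def matrix_vector_mult_def vec_eq_iff if_distrib [of "\<lambda>c. c * _"] cong: if_cong)

lemma diag_mult: "diag f ** diag g = diag (\<lambda>i. f i * g i)"
  by (simp add: matrix_eq matrix_vector_mul_assoc [symmetric] diag_mult_vec mult.assoc)

lemma diag_one: "diag (\<lambda>_. 1) = mat 1"
  by (simp add: diag_def mat_def)

lemma mbound_diag: assumes "\<And>i. \<bar>f i\<bar> \<le> c" shows "mbound (diag f) c"
  unfolding mbound_def
proof
  fix x :: "real^'a"
  have c: "0 \<le> c" using assms[of undefined] by linarith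
  have "norm (diag f *v x) \<le> norm (c *\<^sub>R x)"
    unfolding diag_mult_vec
    by (rule norm_le_componentwise_cart) (use assms c in \<open>auto simp: abs_mult intro!: mult_right_mono\<close>)
  then show "norm (diag f *v x) \<le> c * norm x" using c by simp
qed

lemma orthonormal_cols_norm:
  assumes "orthonormal_cols V" shows "norm (V *v x) = norm x"
proof -
  have "(norm (V *v x))\<^sup>2 = x \<bullet> ((transpose V ** V) *v x)"
    by (simp only: matrix_vector_mul_assoc [symmetric] inner_transpose_vec transpose_transpose power2_norm_eq_inner)
  also have "\<dots> = (norm x)\<^sup>2" using assms by (simp add: orthonormal_cols_def power2_norm_eq_inner)
  finally show ?thesis by simp
qed

lemma orthonormal_cols_mbound: "orthonormal_cols V \<Longrightarrow> mbound V 1" "orthonormal_cols V \<Longrightarrow> mbound (transpose V) 1"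
  by (simp add: mbound_def orthonormal_cols_norm)
     (rule mbound_transpose, simp_all add: mbound_def orthonormal_cols_norm)

lemma matrix_mult_eigen_columns:
  assumes "\<And>j. (M :: real^'d::finite^'d) *v column j V = l j *\<^sub>R column j V"
  shows "M ** V = V ** diag l"
proof -
  have "column j (M ** V) = M *v column j V" for j
    by (simp add: column_def matrix_matrix_mult_def matrix_vector_mult_def)
  moreover have "column j (V ** diag l) = l j *\<^sub>R column j V" for j
    by (simp add: column_def matrix_matrix_mult_def diag_def vec_eq_iff if_distrib [of "\<lambda>c. _ * c"] cong: if_cong)
  ultimately have "column j (M ** V) = column j (V ** diag l)" for j using assms by simp
  then show ?thesis by (simp add: column_def vec_eq_iff)
qed

lemma matrix_inv_works:
  fixes A :: "real^'n::finite^'n" assumes "invertible A"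
  shows "A ** matrix_inv A = mat 1" "matrix_inv A ** A = mat 1"
  using someI_ex[OF assms[unfolded invertible_def]] unfolding matrix_inv_def by auto

lemma matrix_inv_unique:
  fixes A :: "real^'n::finite^'n" assumes "A ** B = mat 1"
  shows "invertible A" "matrix_inv A = B"
proof -
  show inv: "invertible A" using assms by (simp add: invertible_right_inverse) blast
  have "matrix_inv A = matrix_inv A ** (A ** B)" using assms by simp
  also have "\<dots> = B" by (simp add: matrix_mul_assoc matrix_inv_works inv)
  finally show "matrix_inv A = B" .
qed

lemma mbound_matrix_inv:
  fixes A :: "real^'n::finite^'n"
  assumes "0 < e" and *: "\<And>x. norm x \<le> e * norm (A *v x)"
  shows "invertible A" "mbound (matrix_inv A) e"
proof -
  have "A *v x = 0 \<Longrightarrow> x = 0" for x using *[of x] by simp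
  then show inv: "invertible A"
    by (simp add: invertible_left_inverse matrix_left_invertible_ker)
  show "mbound (matrix_inv A) e" unfolding mbound_def
  proof
    fix x show "norm (matrix_inv A *v x) \<le> e * norm x"
      using *[of "matrix_inv A *v x"] by (simp add: matrix_vector_mul_assoc matrix_inv_works inv)
  qed
qed

text \<open>W depends only on the column space of \<open>Z\<close>, which allows renormalising the
  iterate before every step.\<close>

lemma Wmat_mult_right:
  fixes Z :: "real^'k::finite^'d::finite"
  assumes B: "invertible B"
  shows "invertible (transpose V ** (Z ** B)) \<longleftrightarrow> invertible (transpose V ** Z)"
    "invertible (transpose V ** Z) \<Longrightarrow> Wmat U V (Z ** B) = Wmat U V Z"
proof -
  have BB: "B ** matrix_inv B = mat 1" by (rule matrix_inv_works[OF B])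
  show "invertible (transpose V ** (Z ** B)) \<longleftrightarrow> invertible (transpose V ** Z)"
  proof
    assume "invertible (transpose V ** (Z ** B))"
    moreover have "invertible (matrix_inv B)"
      using matrix_inv_works[OF B] invertible_def by blast
    ultimately have "invertible (transpose V ** (Z ** B) ** matrix_inv B)" by (rule invertible_mult)
    then show "invertible (transpose V ** Z)"
      by (simp add: matrix_mul_assoc [symmetric] BB)
  next
    assume "invertible (transpose V ** Z)"
    from invertible_mult[OF this B] show "invertible (transpose V ** (Z ** B))"
      by (simp add: matrix_mul_assoc)
  qed
  assume inv: "invertible (transpose V ** Z)"
  define P where "P = transpose V ** Z"
  have "(P ** B) ** (matrix_inv B ** matrix_inv P) = P ** (B ** matrix_inv B) ** matrix_inv P"
    by (simp only: matrix_mul_assoc)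
  then have "(P ** B) ** (matrix_inv B ** matrix_inv P) = mat 1"
    using inv by (simp add: BB matrix_inv_works P_def)
  then have "matrix_inv (P ** B) = matrix_inv B ** matrix_inv P" by (rule matrix_inv_unique)
  then have "Wmat U V (Z ** B) = transpose U ** Z ** (B ** matrix_inv B) ** matrix_inv P"
    by (simp add: Wmat_def P_def matrix_mul_assoc)
  then show "Wmat U V (Z ** B) = Wmat U V Z" by (simp add: BB Wmat_def P_def)
qed

section \<open>Geometry of the eigenspace splitting and the update of W\<close>

locale eigen_split =
  fixes V :: "real^'k::finite^'d::finite" and U :: "real^'m::finite^'d" and M :: "real^'d^'d"
    and lv :: "'k \<Rightarrow> real" and lu :: "'m \<Rightarrow> real" and \<rho> :: real
  assumes card: "CARD('d) = CARD('k) + CARD('m)"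
    and V_on: "orthonormal_cols V" and U_on: "orthonormal_cols U" and VU: "transpose V ** U = 0"
    and V_eig: "\<And>j. M *v column j V = lv j *\<^sub>R column j V"
    and U_eig: "\<And>j. M *v column j U = lu j *\<^sub>R column j U"
    and \<rho>: "\<rho> = Min (range lv) - Max (range lu)" "0 < \<rho>"
begin

lemma VV: "transpose V ** V = mat 1" and UU: "transpose U ** U = mat 1" and UV: "transpose U ** V = 0"
proof -
  show "transpose V ** V = mat 1" "transpose U ** U = mat 1"
    using V_on U_on by (simp_all add: orthonormal_cols_def)
  have "transpose U ** V = transpose (transpose V ** U)" by (simp add: tr_dist)
  then show "transpose U ** V = 0" by (simp add: VU tr_dist)
qed

text \<open>The complement \<open>P\<close> of the two projections is symmetric and idempotent, so
  its squared Frobenius norm equals its trace, and this is d - k - m = 0.\<close>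

lemma resolution_of_identity: "V ** transpose V + U ** transpose U = mat 1"
proof -
  define P where "P = mat 1 - (V ** transpose V + U ** transpose U)"
  have VVx: "transpose V ** (V ** Z) = Z" "transpose U ** (U ** Y) = Y"
    "transpose V ** (U ** Y) = 0" "transpose U ** (V ** Z) = 0"
    for Z :: "real^'d^'k" and Y :: "real^'d^'m"
    by (simp_all add: matrix_mul_assoc VV UU VU UV mm.zero_left)
  have "transpose P ** P = P"
    unfolding P_def by (simp add: tr_dist mm_dist matrix_mul_assoc [symmetric] VVx mm.zero_right)
  then have "P \<bullet> P = mat 1 \<bullet> P" using inner_gram[of P] by simp
  also have "\<dots> = real CARD('d) - (V \<bullet> V + U \<bullet> U)"
    using inner_gram[of "transpose V"] inner_gram[of "transpose U"]
    by (simp add: P_def inner_diff_right inner_add_right mat1_inner_mat1 inner_transpose)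
  also have "\<dots> = 0"
    using inner_gram[of V] inner_gram[of U] by (simp add: VV UU mat1_inner_mat1 card)
  finally show ?thesis by (simp add: P_def)
qed

lemma factor_Wmat:
  assumes "invertible (transpose V ** Z)"
  shows "Z = (V + U ** Wmat U V Z) ** (transpose V ** Z)"
proof -
  have "(V + U ** Wmat U V Z) ** (transpose V ** Z) =
    V ** (transpose V ** Z) + U ** (transpose U ** Z ** (matrix_inv (transpose V ** Z) ** (transpose V ** Z)))"
    by (simp add: Wmat_def mm_dist matrix_mul_assoc)
  also have "\<dots> = (V ** transpose V + U ** transpose U) ** Z"
    unfolding matrix_inv_works(2)[OF assms] by (simp add: mm.add_left matrix_mul_assoc)
  finally show ?thesis by (simp add: resolution_of_identity)
qed

lemma mult_eq: "transpose V ** M ** V = diag lv" "transpose U ** M ** U = diag lu"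
  "transpose V ** M ** U = 0" "transpose U ** M ** V = 0"
proof -
  have MV: "M ** V = V ** diag lv" and MU: "M ** U = U ** diag lu"
    using V_eig U_eig by (auto intro!: matrix_mult_eigen_columns)
  show "transpose V ** M ** V = diag lv" "transpose U ** M ** U = diag lu"
    "transpose V ** M ** U = 0" "transpose U ** M ** V = 0"
    using MV MU by (simp_all add: matrix_mul_assoc [symmetric])
      (simp_all add: matrix_mul_assoc VV UU UV VU mm.zero_left)
qed

lemma eigenvalue_le_opnorm: "\<bar>lv i\<bar> \<le> opnorm M" "\<bar>lu j\<bar> \<le> opnorm M"
proof -
  have nV: "norm (column i V) = 1"
    using orthonormal_cols_norm[OF V_on, of "axis i 1"] by (simp add: matrix_vector_mult_basis)
  have nU: "norm (column j U) = 1"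
    using orthonormal_cols_norm[OF U_on, of "axis j 1"] by (simp add: matrix_vector_mult_basis)
  have "norm (M *v column i V) \<le> opnorm M * norm (column i V)"
    "norm (M *v column j U) \<le> opnorm M * norm (column j U)"
    using mbound_opnorm[of M] by (simp_all add: mbound_def)
  then show "\<bar>lv i\<bar> \<le> opnorm M" "\<bar>lu j\<bar> \<le> opnorm M"
    by (simp_all add: V_eig U_eig nV nU)
qed

lemma opnorm_pos: "0 < opnorm M"
proof (rule ccontr)
  assume "\<not> ?thesis"
  then have "lv i = 0" "lu j = 0" for i j
    using eigenvalue_le_opnorm(1)[of i] eigenvalue_le_opnorm(2)[of j] opnorm_nonneg[of M] by auto
  then have "lv = (\<lambda>_. 0)" "lu = (\<lambda>_. 0)" by auto
  then show False using \<rho> by simp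
qed

text \<open>One update of V + U W, the representative of the column space with V^T Z = I; by
  \<open>Wmat_update\<close> the past enters only through W.\<close>

definition step :: "real \<Rightarrow> real^'d^'d \<Rightarrow> real^'k^'m \<Rightarrow> real^'k^'d" where
  "step \<eta> A W = (mat 1 + \<eta> *\<^sub>R A) ** (V + U ** W)"

lemma Wmat_update:
  assumes "invertible (transpose V ** Z)"
  defines "W \<equiv> Wmat U V Z"
  shows "invertible (transpose V ** ((mat 1 + \<eta> *\<^sub>R A) ** Z)) \<longleftrightarrow> invertible (transpose V ** step \<eta> A W)"
    "invertible (transpose V ** step \<eta> A W) \<Longrightarrow>
      Wmat U V ((mat 1 + \<eta> *\<^sub>R A) ** Z) = Wmat U V (step \<eta> A W)"
proof -
  have *: "(mat 1 + \<eta> *\<^sub>R A) ** Z = step \<eta> A W ** (transpose V ** Z)"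
    unfolding step_def W_def using factor_Wmat[OF assms(1)] by (metis matrix_mul_assoc)
  show "invertible (transpose V ** ((mat 1 + \<eta> *\<^sub>R A) ** Z)) \<longleftrightarrow> invertible (transpose V ** step \<eta> A W)"
    unfolding * by (rule Wmat_mult_right(1)[OF assms(1)])
  assume "invertible (transpose V ** step \<eta> A W)"
  then show "Wmat U V ((mat 1 + \<eta> *\<^sub>R A) ** Z) = Wmat U V (step \<eta> A W)"
    unfolding * by (rule Wmat_mult_right(2)[OF assms(1)])
qed

lemma step_decomposition:
  fixes \<eta> :: real
  defines "D \<equiv> diag (\<lambda>i. 1 + \<eta> * lv i)" and "N \<equiv> diag (\<lambda>i. 1 + \<eta> * lu i)"
  shows "transpose V ** step \<eta> A W = D + \<eta> *\<^sub>R (transpose V ** (A - M) ** (V + U ** W))"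
    "transpose U ** step \<eta> A W = N ** W + \<eta> *\<^sub>R (transpose U ** (A - M) ** (V + U ** W))"
proof -
  have D: "D = mat 1 + \<eta> *\<^sub>R diag lv" and N: "N = mat 1 + \<eta> *\<^sub>R diag lu"
    by (simp_all add: D_def N_def diag_def mat_def vec_eq_iff)
  have A: "mat 1 + \<eta> *\<^sub>R A = mat 1 + \<eta> *\<^sub>R M + \<eta> *\<^sub>R (A - M)" by (simp add: algebra_simps)
  have z: "transpose V ** U ** W = 0" "transpose V ** M ** U ** W = 0"
    by (simp_all add: VU mult_eq mm.zero_left)
  show "transpose V ** step \<eta> A W = D + \<eta> *\<^sub>R (transpose V ** (A - M) ** (V + U ** W))"
    unfolding step_def A D mm.add_left mm.add_right mm.scaleR_left mm.scaleR_right matrix_mul_assoc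
    by (simp add: mult_eq VV VU mm.zero_left z scaleR_add_right)
  show "transpose U ** step \<eta> A W = N ** W + \<eta> *\<^sub>R (transpose U ** (A - M) ** (V + U ** W))"
    unfolding step_def A N mm.add_left mm.add_right mm.scaleR_left mm.scaleR_right matrix_mul_assoc
    by (simp add: mult_eq UU UV mm.zero_left scaleR_add_right)
qed

text \<open>The smallest eigenvalue lo on the side of \<open>V\<close> and the largest hi on the
  side of \<open>U\<close> give d = 1 / (1 + \<eta> lo) and \<nu> = 1 + \<eta> hi, hence d \<nu> = 1
  - \<eta> \<rho> / (1 + \<eta> lo). The step size keeps all factors within [0.99, 1.01], and 1 +
  \<eta> lo \<le> 2 gives the rate.\<close>

lemma contraction_factors:
  assumes \<eta>: "0 < \<eta>" "\<eta> * opnorm M \<le> 1 / 100"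
  obtains \<nu> d where "mbound (diag (\<lambda>i. 1 + \<eta> * lu i)) \<nu>" "mbound (diag (\<lambda>i. 1 / (1 + \<eta> * lv i))) d"
    "0 \<le> \<nu>" "0 < d" "d \<le> 100 / 99" "d * \<nu> \<le> 1 - \<eta> * \<rho> / 2"
    "diag (\<lambda>i. 1 + \<eta> * lv i) ** diag (\<lambda>i. 1 / (1 + \<eta> * lv i)) = mat 1"
    "diag (\<lambda>i. 1 / (1 + \<eta> * lv i)) ** diag (\<lambda>i. 1 + \<eta> * lv i) = mat 1"
proof -
  have small: "\<bar>\<eta> * l\<bar> \<le> 1 / 100" if "\<bar>l\<bar> \<le> opnorm M" for l
    using mult_left_mono[OF that, of \<eta>] \<eta> unfolding abs_mult by linarith
  define lo where "lo = Min (range lv)"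
  define hi where "hi = Max (range lu)"
  have lo: "lo \<in> range lv" "\<And>i. lo \<le> lv i" unfolding lo_def by (intro Min_in) auto
  have hi: "hi \<in> range lu" "\<And>i. lu i \<le> hi" unfolding hi_def by (intro Max_in) auto
  have slo: "\<bar>\<eta> * lo\<bar> \<le> 1 / 100" and shi: "\<bar>\<eta> * hi\<bar> \<le> 1 / 100"
    using lo(1) hi(1) small[OF eigenvalue_le_opnorm(1)] small[OF eigenvalue_le_opnorm(2)] by fastforce+
  note sv = small[OF eigenvalue_le_opnorm(1)] and su = small[OF eigenvalue_le_opnorm(2)]
  have nz: "1 + \<eta> * lv i \<noteq> 0" for i using sv[of i] by linarith
  show ?thesis
  proof (rule that)
    show "mbound (diag (\<lambda>i. 1 + \<eta> * lu i)) (1 + \<eta> * hi)"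
    proof (rule mbound_diag)
      fix i show "\<bar>1 + \<eta> * lu i\<bar> \<le> 1 + \<eta> * hi"
        using su[of i] mult_left_mono[OF hi(2)[of i], of \<eta>] \<eta> by linarith
    qed
    show "mbound (diag (\<lambda>i. 1 / (1 + \<eta> * lv i))) (1 / (1 + \<eta> * lo))"
    proof (rule mbound_diag)
      fix i
      have "0 < 1 + \<eta> * lo" "1 + \<eta> * lo \<le> 1 + \<eta> * lv i"
        using slo mult_left_mono[OF lo(2)[of i], of \<eta>] \<eta> by linarith+
      then show "\<bar>1 / (1 + \<eta> * lv i)\<bar> \<le> 1 / (1 + \<eta> * lo)"
        by (simp add: frac_le)
    qed
    show "0 \<le> 1 + \<eta> * hi" using shi by linarith
    show "0 < 1 / (1 + \<eta> * lo)" using slo by (simp add: abs_le_iff)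
    show "1 / (1 + \<eta> * lo) \<le> 100 / 99" using slo by (simp add: field_simps abs_le_iff)
    have r: "\<eta> * \<rho> = \<eta> * lo - \<eta> * hi" by (simp only: \<rho>(1) lo_def hi_def right_diff_distrib)
    have "0 \<le> (\<eta> * \<rho>) * (1 - \<eta> * lo)"
      using slo \<eta> \<rho>(2) by (intro mult_nonneg_nonneg) (auto simp: abs_le_iff)
    then have "(1 + \<eta> * hi) * 2 \<le> (2 - \<eta> * \<rho>) * (1 + \<eta> * lo)"
    proof -
      have hi_eq: "\<eta> * hi = \<eta> * lo - \<eta> * \<rho>" using r by simp
      show ?thesis using \<open>0 \<le> (\<eta> * \<rho>) * (1 - \<eta> * lo)\<close> unfolding hi_eq by (simp add: algebra_simps)
    qed
    then show "1 / (1 + \<eta> * lo) * (1 + \<eta> * hi) \<le> 1 - \<eta> * \<rho> / 2"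
      using slo by (simp add: field_simps abs_le_iff)
    show "diag (\<lambda>i. 1 + \<eta> * lv i) ** diag (\<lambda>i. 1 / (1 + \<eta> * lv i)) = mat 1"
      "diag (\<lambda>i. 1 / (1 + \<eta> * lv i)) ** diag (\<lambda>i. 1 + \<eta> * lv i) = mat 1"
      using nz by (simp_all add: diag_mult diag_one)
  qed
qed

text \<open>The weight \<open>w'\<close> belongs to W and \<open>w\<close> to its successor; the
  contraction pays for the growth of the weight. As \<open>lf\<close> does not depend on
  \<open>A\<close>, its contribution will have mean zero.\<close>

lemma one_step:
  fixes W :: "real^'k^'m"
  assumes \<eta>: "0 < \<eta>" "\<eta> * opnorm M \<le> 1 / 100" and Mb: "0 < Mb" "\<eta> * Mb \<le> 1 / 100"
    and W: "mbound W 4" and c: "0 < c" and w: "0 < w" "w * (1 - \<eta> * \<rho> / 2) \<le> w'"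
  shows "\<exists>lf. bounded_linear lf \<and> (\<forall>A. mbound (A - M) Mb \<longrightarrow> invertible (transpose V ** step \<eta> A W) \<and>
    ptr c (Suc q) (w *\<^sub>R Wmat U V (step \<eta> A W))
    \<le> exp (2000 * (real (Suc q))\<^sup>2 * (\<eta> * Mb)\<^sup>2 * (1 + w\<^sup>2 / c)) * ptr c (Suc q) (w' *\<^sub>R W) + lf (A - M))"
proof -
  define x where "x = \<eta> * Mb"
  have x: "0 < x" "x \<le> 1 / 100" using \<eta> Mb by (simp_all add: x_def)
  define D where "D = diag (\<lambda>i. 1 + \<eta> * lv i)"
  define Di where "Di = diag (\<lambda>i. 1 / (1 + \<eta> * lv i))"
  define N where "N = diag (\<lambda>i. 1 + \<eta> * lu i)"
  obtain \<nu> d where N: "mbound N \<nu>" "0 \<le> \<nu>" and d: "mbound Di d" "0 < d" "d \<le> 100 / 99"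
    and q: "d * \<nu> \<le> 1 - \<eta> * \<rho> / 2" and DD: "D ** Di = mat 1" "Di ** D = mat 1"
    unfolding D_def Di_def N_def using contraction_factors[OF \<eta>] by metis
  define H where "H = V + U ** W"
  define X where "X = N ** W ** Di"
  \<comment> \<open>\<open>K\<close> merges the noise in the numerator and in the denominator of the
    update: E - X F = \<eta> K \<Delta> H.\<close>
  define K where "K = transpose U - X ** transpose V"
  have H: "mbound H 5"
    using mbound_add[OF orthonormal_cols_mbound(1)[OF V_on] mbound_mult[OF orthonormal_cols_mbound(1)[OF U_on] W]]
    by (simp add: H_def)
  have "d * \<nu> \<le> 1" using q \<eta> \<rho>(2) mult_pos_pos[of \<eta> \<rho>] by linarith
  then have X: "mbound X 4"
    using mbound_mult[OF mbound_mult[OF N(1) W N(2)] d(1)] N(2) mbound_mono[of X "\<nu> * 4 * d" 4]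
    by (simp add: X_def mult_ac)
  have K: "mbound K 5"
    using mbound_diff[OF orthonormal_cols_mbound(2)[OF U_on] mbound_mult[OF X orthonormal_cols_mbound(2)[OF V_on]]]
    by (simp add: K_def)
  define Y where "Y \<Delta> = \<eta> *\<^sub>R (K ** \<Delta> ** H ** Di)" for \<Delta>
  \<comment> \<open>30 = 5 * 5 * (6/5) comes from \<open>K\<close>, \<open>H\<close> and the inverse
    \<open>J\<close> below; 180 covers 25 * (6/5) * 5 * (100/99) from the factors of
    \<open>R\<close>.\<close>
  define e where "e = w * (30 * x)"
  define e2 where "e2 = w * (180 * x\<^sup>2)"
  have e: "0 < e" "0 < e2" using w x by (simp_all add: e_def e2_def)
  define B where "B = exp (2 * (real (Suc q))\<^sup>2 * e\<^sup>2 / c + real (Suc q) * e2 / sqrt c)"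
  obtain L where L: "\<And>Y R. mbound (Y + R) e \<Longrightarrow> mbound R e2 \<Longrightarrow> ptr c (Suc q) (w *\<^sub>R X + (Y + R))
    \<le> B * ptr c (Suc q) (w *\<^sub>R X) + L * (mpow (reg c (w *\<^sub>R X)) q \<bullet> path_deriv (w *\<^sub>R X) Y)"
    unfolding B_def using ptr_step_le[OF c e, of q "w *\<^sub>R X"] by blast
  define lf where "lf \<Delta> = L * (mpow (reg c (w *\<^sub>R X)) q \<bullet> path_deriv (w *\<^sub>R X) (w *\<^sub>R Y \<Delta>))" for \<Delta>
  have "linear lf"
    unfolding lf_def Y_def
    by (rule linearI) (simp_all add: tr_dist mm_dist inner_add_right scaleR_add_right algebra_simps)
  then have bl: "bounded_linear lf" by (simp add: linear_conv_bounded_linear)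
  have mono: "ptr c (Suc q) (w *\<^sub>R X) \<le> ptr c (Suc q) (w' *\<^sub>R W)"
  proof -
    have c0: "0 \<le> c" using c by simp
    have "ptr c (Suc q) (w *\<^sub>R X) = ptr c (Suc q) ((N ** (w *\<^sub>R W)) ** Di)"
      by (simp add: X_def mm_dist)
    also have "\<dots> \<le> ptr c (Suc q) (d *\<^sub>R (N ** (w *\<^sub>R W)))"
      using d by (intro ptr_mult_right_le c0) auto
    also have "\<dots> = ptr c (Suc q) (N ** ((d * w) *\<^sub>R W))" by (simp add: mm_dist)
    also have "\<dots> \<le> ptr c (Suc q) (\<nu> *\<^sub>R ((d * w) *\<^sub>R W))"
      by (intro ptr_mult_left_le c0 N)
    also have "\<dots> = ptr c (Suc q) ((w * (d * \<nu>)) *\<^sub>R W)" by (simp add: mult_ac)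
    also have "\<dots> \<le> ptr c (Suc q) (w' *\<^sub>R W)"
      using order_trans[OF mult_left_mono[OF q, of w] w(2)] w(1) d N by (intro ptr_scaleR_mono c0) auto
    finally show ?thesis .
  qed
  \<comment> \<open>The quadratic term contributes 2 * 30^2 = 1800 and the remainder 180, once p
    \<le> p^2 and r \<le> 1 + r^2 bring both to the same form.\<close>
  have B: "B \<le> exp (2000 * (real (Suc q))\<^sup>2 * x\<^sup>2 * (1 + w\<^sup>2 / c))"
  proof -
    define r where "r = w / sqrt c"
    define p where "p = real (Suc q)"
    have r: "w\<^sup>2 / c = r\<^sup>2" "0 < r" using c w by (simp_all add: r_def power_divide)
    have p: "1 \<le> p" by (simp add: p_def)
    have "2 * p\<^sup>2 * e\<^sup>2 / c + p * e2 / sqrt c = 1800 * (p\<^sup>2 * x\<^sup>2) * (w\<^sup>2 / c) + 180 * (p * (x\<^sup>2 * r))"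
      using c by (simp add: e_def e2_def r_def power_mult_distrib mult_ac)
    also have "p * (x\<^sup>2 * r) \<le> p\<^sup>2 * (x\<^sup>2 * (1 + r\<^sup>2))"
    proof (intro mult_mono)
      show "p \<le> p\<^sup>2" using p by (simp add: power2_eq_square)
      have "0 \<le> (r - 1)\<^sup>2" by simp
      then show "r \<le> 1 + r\<^sup>2" using r by (simp add: power2_eq_square algebra_simps)
    qed (use r in auto)
    also have "1800 * (p\<^sup>2 * x\<^sup>2) * (w\<^sup>2 / c) + 180 * (p\<^sup>2 * (x\<^sup>2 * (1 + r\<^sup>2)))
       \<le> 2000 * p\<^sup>2 * x\<^sup>2 * (1 + w\<^sup>2 / c)"
      unfolding r(1) by (simp add: algebra_simps)
    finally show ?thesis unfolding B_def p_def by simp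
  qed
  have "invertible (transpose V ** step \<eta> A W) \<and>
    ptr c (Suc q) (w *\<^sub>R Wmat U V (step \<eta> A W))
    \<le> exp (2000 * (real (Suc q))\<^sup>2 * x\<^sup>2 * (1 + w\<^sup>2 / c)) * ptr c (Suc q) (w' *\<^sub>R W) + lf (A - M)"
    if A: "mbound (A - M) Mb" for A
  proof -
    define \<Delta> where "\<Delta> = A - M"
    define F where "F = \<eta> *\<^sub>R (transpose V ** \<Delta> ** H)"
    define E where "E = \<eta> *\<^sub>R (transpose U ** \<Delta> ** H)"
    define P where "P = D + F"
    define J where "J = matrix_inv P"
    have \<Delta>: "mbound \<Delta> Mb" using A by (simp add: \<Delta>_def)
    have VP: "transpose V ** step \<eta> A W = P" and UP: "transpose U ** step \<eta> A W = N ** W + E"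
      using step_decomposition[of \<eta> A W] by (simp_all add: P_def D_def F_def N_def E_def H_def \<Delta>_def)
    have F: "mbound F (5 * x)"
      using mbound_scaleR[OF mbound_mult[OF mbound_mult[OF orthonormal_cols_mbound(2)[OF V_on] \<Delta>] H], of \<eta>] \<eta> Mb
      by (simp add: F_def x_def mult_ac)
    \<comment> \<open>The inverse of \<open>D\<close> is bounded by 100/99 and \<open>F\<close> by
      1/20, so \<open>P\<close> is bounded below; the resulting 100/94 is rounded up to 6/5.\<close>
    have "norm z \<le> 6 / 5 * norm (P *v z)" for z
    proof -
      have "norm z = norm (Di *v (D *v z))" by (simp add: matrix_vector_mul_assoc DD)
      also have "\<dots> \<le> d * norm (D *v z)" using d by (simp add: mbound_def)
      also have "\<dots> \<le> 100 / 99 * norm (D *v z)" using d by (intro mult_right_mono) auto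
      also have "D *v z = P *v z - F *v z" by (simp add: P_def matrix_vector_mult_add_rdistrib)
      also have "norm \<dots> \<le> norm (P *v z) + norm (F *v z)" by (rule norm_triangle_ineq4)
      also have "norm (F *v z) \<le> 5 * x * norm z" using F by (simp add: mbound_def)
      also have "5 * x * norm z \<le> 1 / 20 * norm z" using x by (intro mult_right_mono) auto
      finally have "norm z \<le> 100 / 99 * (norm (P *v z) + 1 / 20 * norm z)" by simp
      then show ?thesis using norm_ge_zero[of "P *v z"] by argo
    qed
    from mbound_matrix_inv[OF _ this] have inv: "invertible P" and J: "mbound J (6 / 5)"
      by (simp_all add: J_def)
    have PJ: "P ** J = mat 1" "J ** P = mat 1" using matrix_inv_works[OF inv] by (simp_all add: J_def)
    define G where "G = \<eta> *\<^sub>R (K ** \<Delta> ** H)"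
    have G: "mbound G (25 * x)"
      using mbound_scaleR[OF mbound_mult[OF mbound_mult[OF K \<Delta>] H], of \<eta>] \<eta> Mb
      by (simp add: G_def x_def mult_ac)
    have GE: "G = E - X ** F"
      by (simp add: G_def E_def F_def K_def mm_dist scaleR_diff_right matrix_mul_assoc)
    have Wm: "Wmat U V (step \<eta> A W) = X + G ** J"
    proof -
      have "X + G ** J = X ** (P ** J) + G ** J" by (simp add: PJ)
      also have "\<dots> = (X ** D + X ** F + G) ** J"
        by (simp add: P_def mm_dist matrix_mul_assoc)
      also have "X ** D = N ** W" by (simp add: X_def matrix_mul_assoc [symmetric] DD)
      finally show ?thesis by (simp add: Wmat_def VP UP GE J_def)
    qed
    \<comment> \<open>By the resolvent identity J = Di - J F Di. The first summand yields the part
      \<open>Y \<Delta>\<close> linear in the noise, the second is quadratic.\<close>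
    define R where "R = - (G ** J ** F ** Di)"
    have YR: "Y \<Delta> + R = G ** J"
    proof -
      have "G ** J = G ** (J ** (P - F) ** Di)"
        by (simp add: P_def DD matrix_mul_assoc [symmetric])
      also have "\<dots> = G ** (J ** P ** Di) - G ** (J ** F ** Di)"
        by (simp only: mm.diff_left mm.diff_right)
      also have "\<dots> = Y \<Delta> + R"
        by (simp add: PJ R_def Y_def G_def mm_dist matrix_mul_assoc)
      finally show ?thesis by simp
    qed
    have m1: "mbound (w *\<^sub>R (Y \<Delta> + R)) e"
      using mbound_scaleR[OF mbound_mult[OF G J], of w] w x unfolding YR by (simp add: e_def)
    have m2: "mbound (w *\<^sub>R R) e2"
    proof -
      have "mbound (w *\<^sub>R R) (\<bar>w\<bar> * (25 * x * (6 / 5) * (5 * x) * d))"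
        unfolding R_def using x by (intro mbound_scaleR mbound_minus mbound_mult G J F d) auto
      moreover have "\<bar>w\<bar> * (25 * x * (6 / 5) * (5 * x) * d) \<le> e2"
      proof -
        have "150 * x\<^sup>2 * d \<le> 150 * x\<^sup>2 * (100 / 99)" using d by (intro mult_left_mono) auto
        also have "\<dots> \<le> 180 * x\<^sup>2" by simp
        finally show ?thesis using w by (simp add: e2_def power2_eq_square mult_ac)
      qed
      ultimately show ?thesis by (rule mbound_mono)
    qed
    have "ptr c (Suc q) (w *\<^sub>R Wmat U V (step \<eta> A W)) = ptr c (Suc q) (w *\<^sub>R X + (w *\<^sub>R Y \<Delta> + w *\<^sub>R R))"
      by (simp add: Wm YR [symmetric] scaleR_add_right)
    also have "\<dots> \<le> B * ptr c (Suc q) (w *\<^sub>R X) + lf \<Delta>"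
      unfolding lf_def using m1 m2 by (intro L) (simp_all add: scaleR_add_right)
    also have "B * ptr c (Suc q) (w *\<^sub>R X) \<le>
       exp (2000 * (real (Suc q))\<^sup>2 * x\<^sup>2 * (1 + w\<^sup>2 / c)) * ptr c (Suc q) (w' *\<^sub>R W)"
      using B mono c by (intro mult_mono ptr_nonneg) auto
    finally show ?thesis using inv by (simp add: VP \<Delta>_def)
  qed
  with bl show ?thesis unfolding x_def by blast
qed

end

section \<open>Compressions and Gram--Schmidt orthonormalisation\<close>

text \<open>Rotating \<open>V\<close> so that one of its columns points along D x produces a frame
  whose compression already sees the full norm of D x.\<close>

lemma mbound_of_orthonormal_compressions:
  fixes V :: "real^'k::finite^'d::finite" and D :: "real^'d^'d"
  assumes V: "orthonormal_cols V"
    and P: "\<And>P :: real^'k^'d. orthonormal_cols P \<Longrightarrow> opnorm (transpose P ** D) \<le> b"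
  shows "mbound D b"
  unfolding mbound_def
proof
  fix x
  define y where "y = D *v x"
  define j :: 'k where "j = undefined"
  show "norm (D *v x) \<le> b * norm x"
  proof (cases "y = 0")
    case True
    have "0 \<le> b" using P[OF V] opnorm_nonneg order_trans by blast
    with True show ?thesis by (simp add: y_def)
  next
    case False
    define u where "u = (1 / norm y) *\<^sub>R y"
    have u: "norm u = 1" using False by (simp add: u_def)
    have v: "norm (V *v axis j 1) = 1" using orthonormal_cols_norm[OF V, of "axis j 1"] by simp
    obtain f where f: "orthogonal_transformation f" "f (V *v axis j 1) = u"
      using orthogonal_transformation_exists[of "V *v axis j 1" u] u v by auto
    define H where "H = matrix f"
    have H: "transpose H ** H = mat 1" "H *v z = f z" for z
      using f(1) orthogonal_transformation_matrix[of f]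
      by (simp_all add: H_def orthogonal_matrix_def orthogonal_transformation_linear)
    define Q where "Q = H ** V"
    have "transpose Q ** Q = transpose V ** (transpose H ** H) ** V"
      by (simp add: Q_def tr_dist matrix_mul_assoc)
    then have "orthonormal_cols Q" using V by (simp add: H orthonormal_cols_def)
    from P[OF this] have Q: "mbound (transpose Q ** D) b"
      using mbound_mono mbound_opnorm by blast
    have "norm y = u \<bullet> y" using False by (simp add: u_def power2_norm_eq_inner [symmetric] power2_eq_square)
    also have "u = Q *v axis j 1" by (simp add: Q_def matrix_vector_mul_assoc [symmetric] H f)
    also have "(Q *v axis j 1) \<bullet> y = axis j 1 \<bullet> ((transpose Q ** D) *v x)"
      by (simp only: y_def matrix_vector_mul_assoc [symmetric] inner_transpose_vec transpose_transpose)
    also have "\<dots> \<le> norm (axis j 1 :: real^'k) * norm ((transpose Q ** D) *v x)"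
      by (rule norm_cauchy_schwarz)
    also have "\<dots> \<le> b * norm x" using Q by (simp add: mbound_def)
    finally show ?thesis by (simp add: y_def)
  qed
qed

section \<open>Gram-Schmidt for possibly dependent columns\<close>

lemma sum_list_orthogonal:
  assumes "sorted_wrt (\<lambda>a b. snd a \<bullet> snd b = 0) acc" "(j, q) \<in> set acc"
  shows "sum_list (map (\<lambda>(i, r). f r * (q \<bullet> r)) acc) = f q * (q \<bullet> q)"
  using assms
proof (induction acc)
  case (Cons a acc)
  obtain i r where a: "a = (i, r)" by (cases a)
  have orth: "r \<bullet> snd b = 0" if "b \<in> set acc" for b using Cons.prems that by (auto simp: a)
  show ?case
  proof (cases "(j, q) \<in> set acc")
    case True
    have "q \<bullet> r = 0" using orth[OF True] by (simp add: inner_commute)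
    then show ?thesis using Cons True by (simp add: a)
  next
    case False
    then have "q = r" using Cons.prems by (simp add: a)
    moreover have "sum_list (map (\<lambda>(i, s). f s * (r \<bullet> s)) acc) = 0"
      using orth by (intro sum_list_nonneg_eq_0_iff[THEN iffD2] ) force+
    ultimately show ?thesis by (simp add: a)
  qed
qed simp

text \<open>If a column depends on its predecessors, the residual \<open>w\<close> is 0 and so is
  the vector produced, because division by 0 gives 0. Squared norms are thus 0 or 1, and
  orthogonality persists in both cases.\<close>

lemma gs_aux_invariant:
  assumes S: "subspace S" "\<And>j z. (j, z) \<in> set zs \<Longrightarrow> z \<in> S"
    and acc: "\<And>j q. (j, q) \<in> set acc \<Longrightarrow> q \<in> S \<and> (q \<bullet> q = 0 \<or> q \<bullet> q = 1)"
      "sorted_wrt (\<lambda>a b. snd a \<bullet> snd b = 0) acc"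
  defines "L \<equiv> gs_aux acc zs"
  shows "map fst L = map fst acc @ map fst zs"
    and "(j, q) \<in> set L \<Longrightarrow> q \<in> S \<and> (q \<bullet> q = 0 \<or> q \<bullet> q = 1)"
    and "sorted_wrt (\<lambda>a b. snd a \<bullet> snd b = 0) L"
proof -
  have "map fst L = map fst acc @ map fst zs \<and> (\<forall>j q. (j, q) \<in> set L \<longrightarrow> q \<in> S \<and> (q \<bullet> q = 0 \<or> q \<bullet> q = 1))
    \<and> sorted_wrt (\<lambda>a b. snd a \<bullet> snd b = 0) L"
    using S(2) acc unfolding L_def
  proof (induction zs arbitrary: acc)
    case Nil
    then show ?case by auto
  next
    case (Cons jz zs)
    obtain j z where jz: "jz = (j, z)" by (cases jz)
    note zS = Cons.prems(1) and accS = Cons.prems(2) and accO = Cons.prems(3)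
    define w where "w = z - sum_list (map (\<lambda>(i, q). (q \<bullet> z) *\<^sub>R q) acc)"
    define r where "r = (1 / norm w) *\<^sub>R w"
    have "sum_list (map (\<lambda>(i, q). (q \<bullet> z) *\<^sub>R q) xs) \<in> S" if "set xs \<subseteq> set acc" for xs
      using that
    proof (induction xs)
      case (Cons x xs)
      then show ?case using accS[of "fst x" "snd x"] S(1)
        by (auto simp: case_prod_beta intro!: subspace_add subspace_scale)
    qed (simp add: subspace_0 S(1))
    then have "w \<in> S" using zS[of j z] by (simp add: jz w_def subspace_diff S(1))
    then have rS: "r \<in> S" by (simp add: r_def subspace_scale S(1))
    have rr: "r \<bullet> r = 0 \<or> r \<bullet> r = 1"
      by (cases "w = 0") (auto simp: r_def power2_norm_eq_inner [symmetric] power2_eq_square)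
    have orth: "q \<bullet> r = 0" if q: "(i, q) \<in> set acc" for i q
    proof -
      have *: "q \<bullet> sum_list (map (\<lambda>(i, q). (q \<bullet> z) *\<^sub>R q) xs) = sum_list (map (\<lambda>(i, r). (r \<bullet> z) * (q \<bullet> r)) xs)" for xs
        by (induction xs) (auto simp: inner_add_right)
      have "q \<bullet> w = q \<bullet> z - (q \<bullet> z) * (q \<bullet> q)"
        unfolding w_def inner_diff_right * using sum_list_orthogonal[OF accO q, of "\<lambda>r. r \<bullet> z"] by simp
      also have "\<dots> = 0" using accS[OF q] by auto
      finally show ?thesis by (simp add: r_def)
    qed
    have "gs_aux acc ((j, z) # zs) = gs_aux (acc @ [(j, r)]) zs"
      by (simp add: r_def w_def Let_def)
    moreover have "(i, q) \<in> set (acc @ [(j, r)]) \<Longrightarrow> q \<in> S \<and> (q \<bullet> q = 0 \<or> q \<bullet> q = 1)" for i q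
      using accS[of i q] rS rr by auto
    moreover have "sorted_wrt (\<lambda>a b. snd a \<bullet> snd b = 0) (acc @ [(j, r)])"
      using accO orth by (auto simp: sorted_wrt_append)
    moreover have "(i, y) \<in> set zs \<Longrightarrow> y \<in> S" for i y using zS[of i y] by simp
    ultimately show ?case using Cons.IH[of "acc @ [(j, r)]"] by (simp add: jz)
  qed
  then show "map fst L = map fst acc @ map fst zs"
    "(j, q) \<in> set L \<Longrightarrow> q \<in> S \<and> (q \<bullet> q = 0 \<or> q \<bullet> q = 1)"
    "sorted_wrt (\<lambda>a b. snd a \<bullet> snd b = 0) L" by auto
qed

lemma sorted_wrt_sym_distinct:
  "sorted_wrt R xs \<Longrightarrow> a \<in> set xs \<Longrightarrow> b \<in> set xs \<Longrightarrow> a \<noteq> b \<Longrightarrow> (\<And>x y. R x y \<Longrightarrow> R y x) \<Longrightarrow> R a b"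
  by (induction xs) auto

lemma gram_schmidt_properties:
  fixes Z :: "(real, 'k::enum) vec^'d::finite"
  shows "mbound (gram_schmidt Z) 1" "\<exists>T. gram_schmidt Z = Z ** T"
proof -
  define Q where "Q = gram_schmidt Z"
  define L where "L = gs_aux [] (map (\<lambda>j. (j, column j Z)) (Enum.enum :: 'k list))"
  define S where "S = range (\<lambda>x. Z *v x)"
  have S: "subspace S" unfolding S_def
    by (rule linear_subspace_image[of "\<lambda>x. Z *v x"]) auto
  have Sc: "z \<in> S" if "(j, z) \<in> set (map (\<lambda>j. (j, column j Z)) (Enum.enum :: 'k list))" for j z
    using that matrix_vector_mult_basis[of Z] unfolding S_def by (auto intro!: range_eqI[of _ _ "axis _ 1"])
  have i1: "map fst L = (Enum.enum :: 'k list)"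
    unfolding L_def using gs_aux_invariant(1)[where acc = "[]" and zs = "map (\<lambda>j. (j, column j Z)) (Enum.enum :: 'k list)", OF S Sc] by (simp add: comp_def)
  have i2: "\<And>j q. (j, q) \<in> set L \<Longrightarrow> q \<in> S \<and> (q \<bullet> q = 0 \<or> q \<bullet> q = 1)"
    unfolding L_def by (rule gs_aux_invariant(2)[OF S Sc]) auto
  have i3: "sorted_wrt (\<lambda>a b. snd a \<bullet> snd b = 0) L"
    unfolding L_def by (rule gs_aux_invariant(3)[OF S Sc]) auto
  have dist: "distinct (map fst L)" unfolding i1 by (rule enum_distinct)
  have mem: "(c, column c Q) \<in> set L" for c
  proof -
    have "c \<in> set (map fst L)" unfolding i1 by (simp add: enum_UNIV)
    then obtain q where q: "(c, q) \<in> set L" by auto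
    then have "map_of L c = Some q" using dist by simp
    then have "column c Q = q" by (simp add: Q_def gram_schmidt_def L_def column_def)
    with q show ?thesis by simp
  qed
  have orth: "column a Q \<bullet> column b Q = 0" if "a \<noteq> b" for a b
    using sorted_wrt_sym_distinct[OF i3 mem[of a] mem[of b]] that by (simp add: inner_commute)
  have gram: "transpose Q ** Q = diag (\<lambda>c. column c Q \<bullet> column c Q)"
    using orth by (simp add: matrix_mult_transpose_dot_column diag_def vec_eq_iff)
  show "mbound (gram_schmidt Z) 1"
    unfolding mbound_def Q_def [symmetric]
  proof
    fix x
    have "(norm (Q *v x))\<^sup>2 = x \<bullet> ((transpose Q ** Q) *v x)"
      by (simp only: matrix_vector_mul_assoc [symmetric] inner_transpose_vec transpose_transpose power2_norm_eq_inner)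
    also have "\<dots> \<le> norm x * norm ((transpose Q ** Q) *v x)" by (rule norm_cauchy_schwarz)
    also have "\<dots> \<le> norm x * (1 * norm x)"
    proof (intro mult_left_mono)
      have "\<bar>column c Q \<bullet> column c Q\<bar> \<le> 1" for c using i2[OF mem[of c]] by auto
      from mbound_diag[of "\<lambda>c. column c Q \<bullet> column c Q" 1, OF this] show "norm ((transpose Q ** Q) *v x) \<le> 1 * norm x"
        unfolding gram mbound_def by blast
    qed simp
    finally have "(norm (Q *v x))\<^sup>2 \<le> (norm x)\<^sup>2" by (simp add: power2_eq_square)
    then show "norm (Q *v x) \<le> 1 * norm x" by simp
  qed
  have "\<forall>c. \<exists>t. column c Q = Z *v t" using i2[OF mem] unfolding S_def by blast
  then obtain t where t: "\<And>c. column c Q = Z *v t c" by metis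
  have "Q = Z ** (\<chi> i c. t c $ i)"
    using t by (simp add: vec_eq_iff column_def matrix_matrix_mult_def matrix_vector_mult_def)
  then show "\<exists>T. gram_schmidt Z = Z ** T" unfolding Q_def by blast
qed

text \<open>Since Q = Z T, one has U^T Q = W (V^T Q), and V^T Q is a contraction.\<close>

lemma opnorm_gram_schmidt_le:
  fixes Z :: "(real, 'k::enum) vec^'d::finite"
  assumes V: "orthonormal_cols V" and inv: "invertible (transpose V ** Z)"
  shows "opnorm (transpose U ** gram_schmidt Z) \<le> opnorm (Wmat U V Z)"
proof -
  obtain T where T: "gram_schmidt Z = Z ** T" using gram_schmidt_properties(2) by blast
  have "Wmat U V Z ** (transpose V ** gram_schmidt Z)
    = transpose U ** Z ** (matrix_inv (transpose V ** Z) ** (transpose V ** Z)) ** T"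
    unfolding T Wmat_def by (simp only: matrix_mul_assoc)
  then have "transpose U ** gram_schmidt Z = Wmat U V Z ** (transpose V ** gram_schmidt Z)"
    by (simp add: matrix_inv_works inv) (simp add: T matrix_mul_assoc)
  moreover have "mbound (Wmat U V Z ** (transpose V ** gram_schmidt Z)) (opnorm (Wmat U V Z) * (1 * 1))"
    by (intro mbound_mult mbound_opnorm orthonormal_cols_mbound V gram_schmidt_properties opnorm_nonneg) simp
  ultimately show ?thesis using opnorm_le by fastforce
qed

section \<open>Measurability and independence\<close>

lemma borel_measurable_matrix_mult:
  fixes f :: "'a \<Rightarrow> real^'n::finite^'m::finite" and g :: "'a \<Rightarrow> real^'p::finite^'n"
  assumes "f \<in> borel_measurable N" "g \<in> borel_measurable N"
  shows "(\<lambda>x. f x ** g x) \<in> borel_measurable N"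
proof -
  have "continuous_on UNIV (\<lambda>p :: (real^'n^'m) \<times> (real^'p^'n). fst p ** snd p)"
    by (intro mm.continuous_on continuous_on_fst continuous_on_snd continuous_on_id)
  from borel_measurable_continuous_on[OF this borel_measurable_Pair[OF assms]] show ?thesis by simp
qed

lemma borel_measurable_matrix_nth:
  fixes f :: "'a \<Rightarrow> real^'n::finite^'m::finite"
  assumes "f \<in> borel_measurable N" shows "(\<lambda>x. f x $ i $ j) \<in> borel_measurable N"
  by (rule borel_measurable_continuous_on[OF _ assms]) (intro continuous_intros)

lemma borel_measurable_matrixI:
  fixes f :: "'a \<Rightarrow> real^'n::finite^'m::finite"
  assumes "\<And>i j. (\<lambda>x. f x $ i $ j) \<in> borel_measurable N" shows "f \<in> borel_measurable N"
proof (subst borel_measurable_euclidean_space, rule ballI)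
  fix b :: "real^'n^'m" assume "b \<in> Basis"
  then obtain i j where b: "b = axis i (axis j 1)"
    unfolding Basis_vec_def Basis_real_def by blast
  have "f x \<bullet> b = f x $ i $ j" for x unfolding b inner_axis by simp
  with assms[of i j] show "(\<lambda>x. f x \<bullet> b) \<in> borel_measurable N" by presburger
qed

lemma borel_measurable_det:
  fixes f :: "'a \<Rightarrow> real^'n::finite^'n"
  assumes "f \<in> borel_measurable N" shows "(\<lambda>x. det (f x)) \<in> borel_measurable N"
  unfolding det_def
  by (intro borel_measurable_sum borel_measurable_times borel_measurable_prod borel_measurable_const
      borel_measurable_matrix_nth assms)

lemma matrix_inv_cramer:
  fixes A :: "real^'n::finite^'n"
  assumes "det A \<noteq> 0"
  shows "matrix_inv A $ k $ l = det (\<chi> i j. if j = k then axis l 1 $ i else A $ i $ j) / det A"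
proof -
  have "invertible A" using assms by (simp add: invertible_det_nz)
  then have "A *v (matrix_inv A *v axis l 1) = axis l 1"
    by (simp add: matrix_vector_mul_assoc matrix_inv_works)
  then have "matrix_inv A *v axis l 1 = (\<chi> k. det (\<chi> i j. if j = k then axis l 1 $ i else A $ i $ j) / det A)"
    using cramer[OF assms] by blast
  moreover have "(matrix_inv A *v axis l 1) $ k = matrix_inv A $ k $ l"
    by (simp add: matrix_vector_mult_basis column_def)
  ultimately show ?thesis by simp
qed

lemma borel_measurable_matrix_inv:
  fixes f :: "'a \<Rightarrow> real^'n::finite^'n"
  assumes f: "f \<in> borel_measurable N" shows "(\<lambda>x. matrix_inv (f x)) \<in> borel_measurable N"
proof (rule borel_measurable_matrixI)
  fix k l
  \<comment> \<open>On singular matrices \<open>matrix_inv\<close> chooses from an unsatisfiable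
    condition, which gives one fixed matrix; elsewhere Cramer's rule makes the entries rational
    functions.\<close>
  define K :: "real^'n^'n" where "K = (SOME B. False)"
  have "matrix_inv A = K" if "det A = 0" for A :: "real^'n^'n"
  proof -
    have "\<not> invertible A" using that by (simp add: invertible_det_nz)
    then have eq: "(A ** B = mat 1 \<and> B ** A = mat 1) = False" for B
      unfolding invertible_def by blast
    show ?thesis unfolding matrix_inv_def K_def by (simp only: eq)
  qed
  then have "(\<lambda>x. matrix_inv (f x) $ k $ l) =
    (\<lambda>x. if det (f x) = 0 then K $ k $ l
       else det (\<chi> i j. if j = k then axis l 1 $ i else f x $ i $ j) / det (f x))"
    by (auto simp: fun_eq_iff matrix_inv_cramer)
  moreover have "\<dots> \<in> borel_measurable N"
  proof (rule measurable_If)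
    show "(\<lambda>x. det (\<chi> i j. if j = k then axis l 1 $ i else f x $ i $ j) / det (f x)) \<in> borel_measurable N"
    proof (rule borel_measurable_divide[OF borel_measurable_det[OF borel_measurable_matrixI] borel_measurable_det[OF f]])
      fix a b show "(\<lambda>x. (\<chi> i j. if j = k then axis l 1 $ i else f x $ i $ j) $ a $ b) \<in> borel_measurable N"
        using borel_measurable_matrix_nth[OF f, of a b] by (cases "b = k") auto
    qed
    show "{x \<in> space N. det (f x) = 0} \<in> sets N"
      using borel_measurable_det[OF f] by measurable
  qed simp
  ultimately show "(\<lambda>x. matrix_inv (f x) $ k $ l) \<in> borel_measurable N" by simp
qed

lemma borel_measurable_Wmat:
  assumes "f \<in> borel_measurable N" shows "(\<lambda>x. Wmat U V (f x)) \<in> borel_measurable N"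
  unfolding Wmat_def
  by (intro borel_measurable_matrix_mult borel_measurable_matrix_inv assms borel_measurable_const)

lemma opnorm_le_iff: "opnorm A \<le> e \<longleftrightarrow> mbound A e"
  using opnorm_le mbound_mono mbound_opnorm by blast

lemma borel_measurable_opnorm:
  fixes f :: "'a \<Rightarrow> real^'n::finite^'m::finite"
  assumes "f \<in> borel_measurable N" shows "(\<lambda>x. opnorm (f x)) \<in> borel_measurable N"
proof -
  have "closed {A :: real^'n^'m. opnorm A \<le> a}" for a
    unfolding opnorm_le_iff mbound_def
  proof (intro closed_Collect_all closed_Collect_le continuous_on_const continuous_on_norm)
    fix x :: "real^'n"
    have "linear (\<lambda>A :: real^'n^'m. A *v x)"
      by (rule linearI) (simp_all add: algebra_simps scaleR_matrix_vector_assoc [symmetric])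
    then show "continuous_on UNIV (\<lambda>A :: real^'n^'m. A *v x)" by (rule linear_continuous_on[OF linear_conv_bounded_linear[THEN iffD1]])
  qed
  then have "opnorm \<in> borel_measurable (borel :: (real^'n^'m) measure)"
    by (subst borel_measurable_iff_le) auto
  from measurable_compose[OF assms this] show ?thesis .
qed

lemma borel_measurable_ptr:
  assumes f: "f \<in> borel_measurable N" shows "(\<lambda>x. ptr c p (f x)) \<in> borel_measurable N"
proof -
  have tr: "(\<lambda>x. transpose (f x)) \<in> borel_measurable N"
    using borel_measurable_matrix_nth[OF f] by (intro borel_measurable_matrixI) (simp add: transpose_def)
  have "(\<lambda>x. mpow (reg c (f x)) n) \<in> borel_measurable N" for n
  proof (induction n)
    case (Suc n)
    then show ?case unfolding mpow.simps reg_def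
      by (intro borel_measurable_matrix_mult borel_measurable_add borel_measurable_const f tr)
  qed simp
  then show ?thesis unfolding ptr_def by (intro borel_measurable_inner borel_measurable_const)
qed

lemma borel_measurable_oja:
  assumes "f \<in> borel_measurable N" "\<And>i. i \<in> {1..n} \<Longrightarrow> (\<lambda>x. a x i) \<in> borel_measurable N"
  shows "(\<lambda>x. oja \<eta> (a x) (f x) n) \<in> borel_measurable N"
  using assms(2)
proof (induction n)
  case (Suc n)
  then show ?case unfolding oja.simps
    by (intro borel_measurable_matrix_mult borel_measurable_add borel_measurable_const
        borel_measurable_scaleR) auto
qed (simp add: assms)

lemma oja_cong:
  assumes "\<And>i. i \<in> {1..n} \<Longrightarrow> a i = b i" shows "oja \<eta> a z n = oja \<eta> b z n"
  using assms by (induction n) auto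

text \<open>The library notion of independent random variables requires both variables to take values in
  the same type, hence the following version for \<open>indep_set\<close>.\<close>

lemma (in prob_space) distr_pair_of_indep_set:
  assumes X: "random_variable S X" and Y: "random_variable T Y"
    and indep: "indep_set {X -` B \<inter> space M | B. B \<in> sets S} {Y -` B \<inter> space M | B. B \<in> sets T}"
  shows "distr M S X \<Otimes>\<^sub>M distr M T Y = distr M (S \<Otimes>\<^sub>M T) (\<lambda>\<omega>. (X \<omega>, Y \<omega>))"
proof (rule pair_measure_eqI)
  interpret PX: prob_space "distr M S X" by (rule prob_space_distr[OF X])
  interpret PY: prob_space "distr M T Y" by (rule prob_space_distr[OF Y])
  show "sigma_finite_measure (distr M S X)" "sigma_finite_measure (distr M T Y)"
    by unfold_locales
  show "sets (distr M S X \<Otimes>\<^sub>M distr M T Y) = sets (distr M (S \<Otimes>\<^sub>M T) (\<lambda>\<omega>. (X \<omega>, Y \<omega>)))"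
    by (simp only: sets_distr) (intro sets_pair_measure_cong sets_distr)
  fix A B assume "A \<in> sets (distr M S X)" "B \<in> sets (distr M T Y)"
  then have AB: "A \<in> sets S" "B \<in> sets T" by simp_all
  have "prob ((X -` A \<inter> space M) \<inter> (Y -` B \<inter> space M)) = prob (X -` A \<inter> space M) * prob (Y -` B \<inter> space M)"
    using indep AB unfolding indep_sets2_eq by blast
  moreover have "(\<lambda>\<omega>. (X \<omega>, Y \<omega>)) -` (A \<times> B) \<inter> space M = (X -` A \<inter> space M) \<inter> (Y -` B \<inter> space M)"
    by auto
  ultimately show "emeasure (distr M S X) A * emeasure (distr M T Y) B =
      emeasure (distr M (S \<Otimes>\<^sub>M T) (\<lambda>\<omega>. (X \<omega>, Y \<omega>))) (A \<times> B)"
    using AB X Y by (simp add: emeasure_distr measurable_Pair emeasure_eq_measure ennreal_mult)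
qed

section \<open>Integrating out the newest sample\<close>

lemma (in prob_space) indep_set_mono:
  "indep_set F G \<Longrightarrow> F' \<subseteq> F \<Longrightarrow> G' \<subseteq> G \<Longrightarrow> indep_set F' G'"
  unfolding indep_sets2_eq by blast

lemma (in prob_space) nn_integral_indep_triple:
  assumes rX: "random_variable SX X" and r1: "random_variable S1 Y1" and r2: "random_variable S2 Y2"
    and XY: "indep_set {X -` B \<inter> space M | B. B \<in> sets SX}
      {(\<lambda>\<omega>. (Y1 \<omega>, Y2 \<omega>)) -` B \<inter> space M | B. B \<in> sets (S1 \<Otimes>\<^sub>M S2)}"
    and Y: "indep_set {Y1 -` B \<inter> space M | B. B \<in> sets S1} {Y2 -` B \<inter> space M | B. B \<in> sets S2}"
    and h: "h \<in> borel_measurable (SX \<Otimes>\<^sub>M (S1 \<Otimes>\<^sub>M S2))"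
  shows "(\<integral>\<^sup>+\<omega>. h (X \<omega>, Y1 \<omega>, Y2 \<omega>) \<partial>M) =
    (\<integral>\<^sup>+x. \<integral>\<^sup>+y. \<integral>\<^sup>+z. h (x, y, z) \<partial>distr M S2 Y2 \<partial>distr M S1 Y1 \<partial>distr M SX X)"
proof -
  have rY: "random_variable (S1 \<Otimes>\<^sub>M S2) (\<lambda>\<omega>. (Y1 \<omega>, Y2 \<omega>))"
    by (rule measurable_Pair[OF r1 r2])
  note eX = distr_pair_of_indep_set[OF rX rY XY] and eY = distr_pair_of_indep_set[OF r1 r2 Y]
  interpret PX: prob_space "distr M SX X" by (rule prob_space_distr[OF rX])
  interpret PY: prob_space "distr M (S1 \<Otimes>\<^sub>M S2) (\<lambda>\<omega>. (Y1 \<omega>, Y2 \<omega>))" by (rule prob_space_distr[OF rY])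
  interpret P2: prob_space "distr M S2 Y2" by (rule prob_space_distr[OF r2])
  let ?D = "distr M (S1 \<Otimes>\<^sub>M S2) (\<lambda>\<omega>. (Y1 \<omega>, Y2 \<omega>))"
  have sets_eq: "sets (distr M SX X \<Otimes>\<^sub>M ?D) = sets (SX \<Otimes>\<^sub>M (S1 \<Otimes>\<^sub>M S2))"
    by (intro sets_pair_measure_cong sets_distr)
  have "(\<integral>\<^sup>+\<omega>. h (X \<omega>, Y1 \<omega>, Y2 \<omega>) \<partial>M) =
    integral\<^sup>N (distr M (SX \<Otimes>\<^sub>M (S1 \<Otimes>\<^sub>M S2)) (\<lambda>\<omega>. (X \<omega>, Y1 \<omega>, Y2 \<omega>))) h"
    by (rule nn_integral_distr[symmetric, OF measurable_Pair[OF rX rY]]) (simp only: measurable_distr_eq1 h)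
  also have "\<dots> = integral\<^sup>N (distr M SX X \<Otimes>\<^sub>M ?D) h"
    by (simp only: eX)
  also have "\<dots> = (\<integral>\<^sup>+x. \<integral>\<^sup>+y. h (x, y) \<partial>?D \<partial>distr M SX X)"
    by (rule PY.nn_integral_fst[symmetric]) (use h in \<open>simp only: measurable_cong_sets[OF sets_eq refl]\<close>)
  also have "\<dots> = (\<integral>\<^sup>+x. \<integral>\<^sup>+y. \<integral>\<^sup>+z. h (x, y, z) \<partial>distr M S2 Y2 \<partial>distr M S1 Y1 \<partial>distr M SX X)"
  proof (rule nn_integral_cong)
    fix x assume "x \<in> space (distr M SX X)"
    then have "(\<lambda>y. h (x, y)) \<in> borel_measurable (S1 \<Otimes>\<^sub>M S2)"
      using measurable_compose[OF measurable_Pair1' h, of x] by (simp only: space_distr)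
    moreover have sets_eq': "sets (distr M S1 Y1 \<Otimes>\<^sub>M distr M S2 Y2) = sets (S1 \<Otimes>\<^sub>M S2)"
      by (intro sets_pair_measure_cong sets_distr)
    ultimately have "(\<lambda>y. h (x, y)) \<in> borel_measurable (distr M S1 Y1 \<Otimes>\<^sub>M distr M S2 Y2)"
      by (simp only: measurable_cong_sets[OF sets_eq' refl])
    from P2.nn_integral_fst[OF this]
    show "(\<integral>\<^sup>+y. h (x, y) \<partial>?D) = (\<integral>\<^sup>+y. \<integral>\<^sup>+z. h (x, y, z) \<partial>distr M S2 Y2 \<partial>distr M S1 Y1)"
      by (simp only: eY)
  qed
  finally show ?thesis .
qed

text \<open>Stands in for a conditional expectation: an estimate valid for every frozen past, after
  integration over \<open>Y2\<close> alone, persists on average.\<close>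

lemma (in prob_space) nn_integral_indep_mono:
  assumes rX: "random_variable SX X" and r1: "random_variable S1 Y1" and r2: "random_variable S2 Y2"
    and XY: "indep_set {X -` B \<inter> space M | B. B \<in> sets SX}
      {(\<lambda>\<omega>. (Y1 \<omega>, Y2 \<omega>)) -` B \<inter> space M | B. B \<in> sets (S1 \<Otimes>\<^sub>M S2)}"
    and Y: "indep_set {Y1 -` B \<inter> space M | B. B \<in> sets S1} {Y2 -` B \<inter> space M | B. B \<in> sets S2}"
    and h: "h \<in> borel_measurable (SX \<Otimes>\<^sub>M (S1 \<Otimes>\<^sub>M S2))" and g: "g \<in> borel_measurable (SX \<Otimes>\<^sub>M S1)"
    and le: "\<And>x y. (\<integral>\<^sup>+z. h (x, y, z) \<partial>distr M S2 Y2) \<le> g (x, y)"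
  shows "(\<integral>\<^sup>+\<omega>. h (X \<omega>, Y1 \<omega>, Y2 \<omega>) \<partial>M) \<le> (\<integral>\<^sup>+\<omega>. g (X \<omega>, Y1 \<omega>) \<partial>M)"
proof -
  interpret P2: prob_space "distr M S2 Y2"
    by (rule prob_space_distr[OF r2])
  have g': "(\<lambda>p. g (fst p, fst (snd p))) \<in> borel_measurable (SX \<Otimes>\<^sub>M (S1 \<Otimes>\<^sub>M S2))"
    by (rule measurable_compose[OF _ g]) measurable
  have inner: "(\<integral>\<^sup>+z. h (x, y, z) \<partial>distr M S2 Y2) \<le> (\<integral>\<^sup>+z. g (x, y) \<partial>distr M S2 Y2)" for x y
    using le[of x y] P2.emeasure_space_1 by (simp only: nn_integral_const mult_1_right)
  have "(\<integral>\<^sup>+\<omega>. h (X \<omega>, Y1 \<omega>, Y2 \<omega>) \<partial>M) \<le>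
    (\<integral>\<^sup>+x. \<integral>\<^sup>+y. \<integral>\<^sup>+z. g (x, y) \<partial>distr M S2 Y2 \<partial>distr M S1 Y1 \<partial>distr M SX X)"
    unfolding nn_integral_indep_triple[OF rX r1 r2 XY Y h]
    by (rule nn_integral_mono, rule nn_integral_mono, rule inner)
  also have "\<dots> = (\<integral>\<^sup>+\<omega>. g (X \<omega>, Y1 \<omega>) \<partial>M)"
    using nn_integral_indep_triple[OF rX r1 r2 XY Y g'] by (simp only: fst_conv snd_conv)
  finally show ?thesis .
qed

context eigen_split begin

lemma one_step_expectation:
  fixes W :: "real^'k^'m"
  assumes PA: "prob_space PA" "integrable PA (\<lambda>X. X)" "integral\<^sup>L PA (\<lambda>X. X) = M"
      "AE X in PA. mbound (X - M) Mb"
    and \<eta>: "0 < \<eta>" "\<eta> * opnorm M \<le> 1 / 100" and Mb: "0 < Mb" "\<eta> * Mb \<le> 1 / 100"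
    and W: "mbound W 4" and c: "0 < c" and w: "0 < w" "w * (1 - \<eta> * \<rho> / 2) \<le> w'"
  shows "(\<integral>\<^sup>+A. ennreal (ptr c (Suc q) (w *\<^sub>R Wmat U V (step \<eta> A W))) \<partial>PA)
    \<le> ennreal (exp (2000 * (real (Suc q))\<^sup>2 * (\<eta> * Mb)\<^sup>2 * (1 + w\<^sup>2 / c)) * ptr c (Suc q) (w' *\<^sub>R W))"
proof -
  interpret prob_space PA by fact
  define C where "C = exp (2000 * (real (Suc q))\<^sup>2 * (\<eta> * Mb)\<^sup>2 * (1 + w\<^sup>2 / c)) * ptr c (Suc q) (w' *\<^sub>R W)"
  obtain lf where lf: "bounded_linear lf"
    "\<And>A. mbound (A - M) Mb \<Longrightarrow> ptr c (Suc q) (w *\<^sub>R Wmat U V (step \<eta> A W)) \<le> C + lf (A - M)"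
    unfolding C_def using one_step[OF \<eta> Mb W c w, of q] by blast
  have AE: "AE A in PA. ptr c (Suc q) (w *\<^sub>R Wmat U V (step \<eta> A W)) \<le> C + lf (A - M)"
    using PA(4) by eventually_elim (rule lf(2))
  have i: "integrable PA (\<lambda>A. A - M)" using PA(2) by simp
  have int: "integrable PA (\<lambda>A. C + lf (A - M))"
    by (intro Bochner_Integration.integrable_add integrable_bounded_linear[OF lf(1) i]) simp
  have "(\<integral>\<^sup>+A. ennreal (ptr c (Suc q) (w *\<^sub>R Wmat U V (step \<eta> A W))) \<partial>PA)
    \<le> (\<integral>\<^sup>+A. ennreal (C + lf (A - M)) \<partial>PA)"
    using AE by (intro nn_integral_mono_AE) (auto intro: ennreal_leI)
  also have "\<dots> = ennreal (\<integral>A. C + lf (A - M) \<partial>PA)"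
  proof (rule nn_integral_eq_integral[OF int])
    \<comment> \<open>\<open>lf\<close> has no sign; the sum is nonnegative because it dominates the
      potential almost everywhere.\<close>
    show "AE A in PA. 0 \<le> C + lf (A - M)"
      using AE by eventually_elim (use ptr_nonneg[of c] c order_trans in \<open>blast intro: less_imp_le\<close>)
  qed
  also have "(\<integral>A. C + lf (A - M) \<partial>PA) = (\<integral>A. C \<partial>PA) + (\<integral>A. lf (A - M) \<partial>PA)"
    by (intro Bochner_Integration.integral_add integrable_bounded_linear[OF lf(1) i]) simp
  also have "(\<integral>A. C \<partial>PA) = C" using prob_space by simp
  also have "(\<integral>A. lf (A - M) \<partial>PA) = lf (\<integral>A. A - M \<partial>PA)"
    by (rule integral_bounded_linear[OF lf(1) i])
  also have "(\<integral>A. A - M \<partial>PA) = 0"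
    using PA(2,3) prob_space by (subst Bochner_Integration.integral_diff) auto
  also have "lf 0 = 0" using lf(1) by (simp add: linear_simps)
  finally show ?thesis by (simp add: C_def)
qed

end

section \<open>The stopped process\<close>

lemma ptr_ge_opnorm_scaleR:
  fixes G :: "real^'k::finite^'m::finite"
  assumes c: "0 \<le> c" and w: "0 < w" and B: "0 \<le> B" "B < opnorm G"
  shows "((w * B)\<^sup>2 + c) ^ p \<le> ptr c p (w *\<^sub>R G)"
proof (rule ptr_ge_opnorm[OF c])
  show "0 \<le> w * B" using w B by simp
  show "w * B < opnorm (w *\<^sub>R G)"
  proof (rule ccontr)
    assume "\<not> ?thesis"
    then have "mbound (w *\<^sub>R G) (w * B)" by (simp add: opnorm_le_iff not_less)
    from mbound_scaleR[OF this, of "1 / w"] have "mbound G B" using w by simp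
    then show False using B by (simp add: opnorm_le_iff [symmetric])
  qed
qed

locale oja_process = eigen_split V U M lv lu \<rho>
  for V :: "real^'k::finite^'d::finite" and U :: "real^'m::finite^'d" and M :: "real^'d^'d"
    and lv :: "'k \<Rightarrow> real" and lu :: "'m \<Rightarrow> real" and \<rho> :: real +
  fixes \<Omega> :: "'w measure" and PA :: "(real^'d^'d) measure" and A :: "nat \<Rightarrow> 'w \<Rightarrow> real^'d^'d"
    and Z0 :: "'w \<Rightarrow> real^'k^'d" and Mb :: real and \<eta> :: "nat \<Rightarrow> real"
  assumes \<Omega>: "prob_space \<Omega>"
    and PA: "prob_space PA" "integrable PA (\<lambda>X. X)" "integral\<^sup>L PA (\<lambda>X. X) = M"
      "AE X in PA. mbound (X - M) Mb"
    and A_indep: "prob_space.indep_vars \<Omega> (\<lambda>_. borel) A {1..}"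
    and A_distr: "\<And>i. i \<ge> 1 \<Longrightarrow> distr \<Omega> borel (A i) = PA"
    and Z0_rv: "Z0 \<in> borel_measurable \<Omega>"
    and Z0_indep: "prob_space.indep_set \<Omega>
                     {Z0 -` B \<inter> space \<Omega> | B. B \<in> sets borel}
                     {(\<lambda>\<omega>. restrict (\<lambda>i. A i \<omega>) {1..}) -` B \<inter> space \<Omega> | B.
                        B \<in> sets (PiM {1..} (\<lambda>_. borel))}"
    and Z0_inv: "\<And>\<omega>. \<omega> \<in> space \<Omega> \<Longrightarrow> invertible (transpose V ** Z0 \<omega>)"
    and W0_le: "\<And>\<omega>. \<omega> \<in> space \<Omega> \<Longrightarrow> opnorm (Wmat U V (Z0 \<omega>)) \<le> 1"
    and Mb_pos: "0 < Mb"
    and \<eta>: "\<And>t. 1 \<le> t \<Longrightarrow> 0 < \<eta> t" "\<And>t. 1 \<le> t \<Longrightarrow> \<eta> t * opnorm M \<le> 1 / 100"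
      "\<And>t. 1 \<le> t \<Longrightarrow> \<eta> t * Mb \<le> 1 / 100"
begin

sublocale P: prob_space \<Omega> by (rule \<Omega>)

text \<open>A functional of deterministic samples, so that the past can be frozen inside an iterated
  integral. Quantifying over all s \<le> t makes the condition decreasing in \<open>t\<close>: the
  region has not been left so far.\<close>

definition good :: "(nat \<Rightarrow> real^'d^'d) \<Rightarrow> real^'k^'d \<Rightarrow> nat \<Rightarrow> bool" where
  "good a z t \<longleftrightarrow> (\<forall>s\<le>t. invertible (transpose V ** oja \<eta> a z s) \<and> opnorm (Wmat U V (oja \<eta> a z s)) \<le> 4)"

definition traj :: "nat \<Rightarrow> 'w \<Rightarrow> real^'k^'m" where
  "traj t \<omega> = Wmat U V (oja \<eta> (\<lambda>i. A i \<omega>) (Z0 \<omega>) t)"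

definition ok :: "nat \<Rightarrow> 'w \<Rightarrow> bool" where
  "ok t \<omega> \<longleftrightarrow> good (\<lambda>i. A i \<omega>) (Z0 \<omega>) t"

lemma good_cong: "(\<And>i. i \<in> {1..t} \<Longrightarrow> a i = b i) \<Longrightarrow> good a z t \<longleftrightarrow> good b z t"
proof -
  assume *: "\<And>i. i \<in> {1..t} \<Longrightarrow> a i = b i"
  have "oja \<eta> a z s = oja \<eta> b z s" if "s \<le> t" for s
    by (rule oja_cong) (use * that in auto)
  then show ?thesis unfolding good_def by simp
qed

lemma A_measurable: "1 \<le> i \<Longrightarrow> A i \<in> borel_measurable \<Omega>"
  using A_indep unfolding P.indep_vars_def by auto

lemma measurable_good:
  assumes "f \<in> borel_measurable N" "\<And>i. i \<in> {1..t} \<Longrightarrow> (\<lambda>x. a x i) \<in> borel_measurable N"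
  shows "{x \<in> space N. good (a x) (f x) t} \<in> sets N"
proof -
  have m: "(\<lambda>x. oja \<eta> (a x) (f x) s) \<in> borel_measurable N" if "s \<le> t" for s
    using assms that by (intro borel_measurable_oja) auto
  have "{x \<in> space N. invertible (transpose V ** oja \<eta> (a x) (f x) s) \<and> opnorm (Wmat U V (oja \<eta> (a x) (f x) s)) \<le> 4} \<in> sets N"
    if "s \<le> t" for s
  proof -
    define D where "D x = det (transpose V ** oja \<eta> (a x) (f x) s)" for x
    define opn where "opn x = opnorm (Wmat U V (oja \<eta> (a x) (f x) s))" for x
    have [measurable]: "D \<in> borel_measurable N"
      unfolding D_def[abs_def]
      by (rule borel_measurable_det[OF borel_measurable_matrix_mult[OF borel_measurable_const m[OF that]]])
    have [measurable]: "opn \<in> borel_measurable N"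
      unfolding opn_def[abs_def] by (rule borel_measurable_opnorm[OF borel_measurable_Wmat[OF m[OF that]]])
    have "{x \<in> space N. D x \<noteq> 0 \<and> opn x \<le> 4} \<in> sets N" by measurable
    then show ?thesis by (simp only: D_def opn_def invertible_det_nz)
  qed
  then have "{x \<in> space N. \<forall>s\<in>{..t}. invertible (transpose V ** oja \<eta> (a x) (f x) s) \<and> opnorm (Wmat U V (oja \<eta> (a x) (f x) s)) \<le> 4} \<in> sets N"
    by (intro sets.sets_Collect_finite_All) auto
  then show ?thesis by (simp only: good_def atMost_iff Ball_def)
qed

lemma measurable_ok [measurable]: "Measurable.pred \<Omega> (ok t)"
  unfolding pred_def ok_def by (rule measurable_good) (auto intro: Z0_rv A_measurable)

lemma measurable_traj [measurable]: "traj t \<in> borel_measurable \<Omega>"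
  unfolding traj_def[abs_def]
  by (intro borel_measurable_Wmat borel_measurable_oja Z0_rv) (auto intro: A_measurable)

lemma measurable_ptr_traj [measurable]: "(\<lambda>\<omega>. ptr c p (w *\<^sub>R traj t \<omega>)) \<in> borel_measurable \<Omega>"
  by (intro borel_measurable_ptr borel_measurable_scaleR borel_measurable_const measurable_traj)

lemma invertible_step:
  assumes W: "mbound W 4" and t: "1 \<le> t" and a: "mbound (a - M) Mb"
  shows "invertible (transpose V ** step (\<eta> t) a W)"
  \<comment> \<open>The weights are placeholders here; only the invertibility part of
    \<open>one_step\<close> is extracted.\<close>
  using one_step[OF \<eta>(1)[OF t] \<eta>(2)[OF t] Mb_pos \<eta>(3)[OF t] W, of 1 1 "1 - \<eta> t * \<rho> / 2"] a by auto

lemma expectation_after_step: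
  assumes good: "good a z t" and c: "0 < c" and w: "0 < w" "w * (1 - \<eta> (Suc t) * \<rho> / 2) \<le> w'"
  shows "(\<integral>\<^sup>+x. ennreal (ptr c (Suc q) (w *\<^sub>R Wmat U V ((mat 1 + \<eta> (Suc t) *\<^sub>R x) ** oja \<eta> a z t))) \<partial>PA)
    \<le> ennreal (exp (2000 * (real (Suc q))\<^sup>2 * (\<eta> (Suc t) * Mb)\<^sup>2 * (1 + w\<^sup>2 / c))
        * ptr c (Suc q) (w' *\<^sub>R Wmat U V (oja \<eta> a z t)))"
proof -
  define Z where "Z = oja \<eta> a z t"
  define W where "W = Wmat U V Z"
  have inv: "invertible (transpose V ** Z)" and W: "mbound W 4"
    using good by (simp_all add: good_def Z_def W_def opnorm_le_iff)
  have "AE x in PA. Wmat U V ((mat 1 + \<eta> (Suc t) *\<^sub>R x) ** Z) = Wmat U V (step (\<eta> (Suc t)) x W)"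
    using PA(4)
  proof eventually_elim
    case (elim x)
    show ?case unfolding W_def
      by (rule Wmat_update(2)[OF inv invertible_step]) (use W elim in \<open>simp_all add: W_def\<close>)
  qed
  then have "(\<integral>\<^sup>+x. ennreal (ptr c (Suc q) (w *\<^sub>R Wmat U V ((mat 1 + \<eta> (Suc t) *\<^sub>R x) ** Z))) \<partial>PA)
    = (\<integral>\<^sup>+x. ennreal (ptr c (Suc q) (w *\<^sub>R Wmat U V (step (\<eta> (Suc t)) x W))) \<partial>PA)"
    by (intro nn_integral_cong_AE) auto
  also have "\<dots> \<le> ennreal (exp (2000 * (real (Suc q))\<^sup>2 * (\<eta> (Suc t) * Mb)\<^sup>2 * (1 + w\<^sup>2 / c))
        * ptr c (Suc q) (w' *\<^sub>R W))"
    by (rule one_step_expectation[OF PA \<eta>(1) \<eta>(2) Mb_pos \<eta>(3) W c w]) simp_all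
  finally show ?thesis by (simp add: Z_def W_def)
qed

text \<open>The first claim coarsens the independence of \<open>Z0\<close> from the whole sample
  sequence; the second compares the disjoint index blocks {1..t} and {Suc t}.\<close>

lemma indep_past:
  "P.indep_set {Z0 -` B \<inter> space \<Omega> | B. B \<in> sets borel}
     {(\<lambda>\<omega>. (restrict (\<lambda>i. A i \<omega>) {1..t}, A (Suc t) \<omega>)) -` B \<inter> space \<Omega> | B. B \<in> sets (PiM {1..t} (\<lambda>_. borel) \<Otimes>\<^sub>M borel)}"
  "P.indep_set {(\<lambda>\<omega>. restrict (\<lambda>i. A i \<omega>) {1..t}) -` B \<inter> space \<Omega> | B. B \<in> sets (PiM {1..t} (\<lambda>_. borel))}
     {A (Suc t) -` B \<inter> space \<Omega> | B. B \<in> sets borel}"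
proof -
  let ?S = "\<lambda>I. PiM I (\<lambda>_::nat. borel :: (real^'d^'d) measure)"
  define r where "r = (\<lambda>a :: nat \<Rightarrow> real^'d^'d. (restrict a {1..t}, a (Suc t)))"
  have r: "r \<in> ?S {1..} \<rightarrow>\<^sub>M ?S {1..t} \<Otimes>\<^sub>M borel"
    unfolding r_def by (auto intro!: measurable_Pair measurable_restrict_subset)
  show "P.indep_set {Z0 -` B \<inter> space \<Omega> | B. B \<in> sets borel}
     {(\<lambda>\<omega>. (restrict (\<lambda>i. A i \<omega>) {1..t}, A (Suc t) \<omega>)) -` B \<inter> space \<Omega> | B. B \<in> sets (?S {1..t} \<Otimes>\<^sub>M borel)}"
  proof (rule P.indep_set_mono[OF Z0_indep order_refl], safe)
    fix B :: "((nat \<Rightarrow> real^'d^'d) \<times> (real^'d^'d)) set" assume B: "B \<in> sets (?S {1..t} \<Otimes>\<^sub>M borel)"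
    have "restrict (\<lambda>i. A i \<omega>) {1..} \<in> space (?S {1..})" for \<omega> by (simp add: space_PiM)
    moreover have "r (restrict (\<lambda>i. A i \<omega>) {1..}) = (restrict (\<lambda>i. A i \<omega>) {1..t}, A (Suc t) \<omega>)" for \<omega>
      by (auto simp: r_def restrict_def fun_eq_iff)
    ultimately have "(\<lambda>\<omega>. (restrict (\<lambda>i. A i \<omega>) {1..t}, A (Suc t) \<omega>)) -` B \<inter> space \<Omega>
      = (\<lambda>\<omega>. restrict (\<lambda>i. A i \<omega>) {1..}) -` (r -` B \<inter> space (?S {1..})) \<inter> space \<Omega>"
      by (simp add: set_eq_iff)
    moreover have "r -` B \<inter> space (?S {1..}) \<in> sets (?S {1..})" by (rule measurable_sets[OF r B])
    ultimately show "\<exists>C. (\<lambda>\<omega>. (restrict (\<lambda>i. A i \<omega>) {1..t}, A (Suc t) \<omega>)) -` B \<inter> space \<Omega>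
      = (\<lambda>\<omega>. restrict (\<lambda>i. A i \<omega>) {1..}) -` C \<inter> space \<Omega> \<and> C \<in> sets (?S {1..})" by blast
  qed
  have "P.indep_var (?S {1..t}) (\<lambda>\<omega>. restrict (\<lambda>i. A i \<omega>) {1..t})
     (?S {Suc t}) (\<lambda>\<omega>. restrict (\<lambda>i. A i \<omega>) {Suc t})"
    by (rule P.indep_var_restrict[OF A_indep]) auto
  then have "P.indep_set (sigma_sets (space \<Omega>) {(\<lambda>\<omega>. restrict (\<lambda>i. A i \<omega>) {1..t}) -` B \<inter> space \<Omega> | B. B \<in> sets (?S {1..t})})
     (sigma_sets (space \<Omega>) {(\<lambda>\<omega>. restrict (\<lambda>i. A i \<omega>) {Suc t}) -` B \<inter> space \<Omega> | B. B \<in> sets (?S {Suc t})})"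
    unfolding P.indep_var_eq by (rule conjunct2)
  then show "P.indep_set {(\<lambda>\<omega>. restrict (\<lambda>i. A i \<omega>) {1..t}) -` B \<inter> space \<Omega> | B. B \<in> sets (?S {1..t})}
     {A (Suc t) -` B \<inter> space \<Omega> | B. B \<in> sets borel}"
  proof (rule P.indep_set_mono)
    show "{A (Suc t) -` B \<inter> space \<Omega> | B. B \<in> sets borel} \<subseteq>
      sigma_sets (space \<Omega>) {(\<lambda>\<omega>. restrict (\<lambda>i. A i \<omega>) {Suc t}) -` B \<inter> space \<Omega> | B. B \<in> sets (?S {Suc t})}"
    proof safe
      fix B :: "(real^'d^'d) set" assume B: "B \<in> sets borel"
      have "(\<lambda>a. a (Suc t)) \<in> ?S {Suc t} \<rightarrow>\<^sub>M borel" by (rule measurable_component_singleton) simp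
      then have "(\<lambda>a. a (Suc t)) -` B \<inter> space (?S {Suc t}) \<in> sets (?S {Suc t})" by (rule measurable_sets[OF _ B])
      moreover have "A (Suc t) -` B \<inter> space \<Omega>
        = (\<lambda>\<omega>. restrict (\<lambda>i. A i \<omega>) {Suc t}) -` ((\<lambda>a. a (Suc t)) -` B \<inter> space (?S {Suc t})) \<inter> space \<Omega>"
        by (auto simp: space_PiM)
      ultimately show "A (Suc t) -` B \<inter> space \<Omega> \<in> sigma_sets (space \<Omega>)
        {(\<lambda>\<omega>. restrict (\<lambda>i. A i \<omega>) {Suc t}) -` B \<inter> space \<Omega> | B. B \<in> sets (?S {Suc t})}"
        by (intro sigma_sets.Basic) blast
    qed
  qed (rule sigma_sets_superset_generator)
qed

text \<open>The condition \<open>ok t\<close> involves \<open>Z0\<close> and the first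
  \<open>t\<close> samples only, so it is kept while \<open>A (Suc t)\<close> is integrated out.
  Paths that leave the region at time t + 1 are still counted on the left.\<close>

lemma step_integral:
  fixes q :: nat
  assumes c: "0 < c" and w: "0 < w" "w * (1 - \<eta> (Suc t) * \<rho> / 2) \<le> w'"
  defines "e \<equiv> 2000 * (real (Suc q))\<^sup>2 * (\<eta> (Suc t) * Mb)\<^sup>2 * (1 + w\<^sup>2 / c)"
  shows "(\<integral>\<^sup>+\<omega>. (if ok t \<omega> then ennreal (ptr c (Suc q) (w *\<^sub>R traj (Suc t) \<omega>)) else 0) \<partial>\<Omega>)
    \<le> ennreal (exp e) * (\<integral>\<^sup>+\<omega>. (if ok t \<omega> then ennreal (ptr c (Suc q) (w' *\<^sub>R traj t \<omega>)) else 0) \<partial>\<Omega>)"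
proof -
  let ?S = "PiM {1..t} (\<lambda>_. borel :: (real^'d^'d) measure)"
  define h where "h = (\<lambda>(z, a, x). if good a z t
    then ennreal (ptr c (Suc q) (w *\<^sub>R Wmat U V ((mat 1 + \<eta> (Suc t) *\<^sub>R x) ** oja \<eta> a z t))) else 0)"
  define g where "g = (\<lambda>(z, a). if good a z t
    then ennreal (exp e * ptr c (Suc q) (w' *\<^sub>R Wmat U V (oja \<eta> a z t))) else 0)"
  have comp: "(\<lambda>p. snd p i) \<in> borel_measurable ((borel :: (real^'k^'d) measure) \<Otimes>\<^sub>M ?S)"
    "(\<lambda>p. fst (snd p) i) \<in> borel_measurable ((borel :: (real^'k^'d) measure) \<Otimes>\<^sub>M (?S \<Otimes>\<^sub>M (borel :: (real^'d^'d) measure)))"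
    if "i \<in> {1..t}" for i
    using that by measurable
  have h: "h \<in> borel_measurable (borel \<Otimes>\<^sub>M (?S \<Otimes>\<^sub>M borel))"
  proof -
    have "(\<lambda>p. if good (fst (snd p)) (fst p) t
      then ennreal (ptr c (Suc q) (w *\<^sub>R Wmat U V ((mat 1 + \<eta> (Suc t) *\<^sub>R snd (snd p)) ** oja \<eta> (fst (snd p)) (fst p) t))) else 0)
      \<in> borel_measurable (borel \<Otimes>\<^sub>M (?S \<Otimes>\<^sub>M borel))"
    proof (rule measurable_If)
      show "{p \<in> space (borel \<Otimes>\<^sub>M (?S \<Otimes>\<^sub>M borel)). good (fst (snd p)) (fst p) t} \<in> sets (borel \<Otimes>\<^sub>M (?S \<Otimes>\<^sub>M borel))"
        by (rule measurable_good) (auto intro: comp)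
      show "(\<lambda>p. ennreal (ptr c (Suc q) (w *\<^sub>R Wmat U V ((mat 1 + \<eta> (Suc t) *\<^sub>R snd (snd p)) ** oja \<eta> (fst (snd p)) (fst p) t))))
        \<in> borel_measurable (borel \<Otimes>\<^sub>M (?S \<Otimes>\<^sub>M borel))"
        by (intro measurable_compose[OF _ measurable_ennreal] borel_measurable_ptr borel_measurable_scaleR
            borel_measurable_const borel_measurable_Wmat borel_measurable_matrix_mult borel_measurable_add
            borel_measurable_oja comp) auto
    qed simp
    then show ?thesis by (simp add: h_def case_prod_beta)
  qed
  have g: "g \<in> borel_measurable (borel \<Otimes>\<^sub>M ?S)"
  proof -
    have "(\<lambda>p. if good (snd p) (fst p) t
      then ennreal (exp e * ptr c (Suc q) (w' *\<^sub>R Wmat U V (oja \<eta> (snd p) (fst p) t))) else 0)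
      \<in> borel_measurable (borel \<Otimes>\<^sub>M ?S)"
    proof (rule measurable_If)
      show "{p \<in> space (borel \<Otimes>\<^sub>M ?S). good (snd p) (fst p) t} \<in> sets (borel \<Otimes>\<^sub>M ?S)"
        by (rule measurable_good) (auto intro: comp)
      show "(\<lambda>p. ennreal (exp e * ptr c (Suc q) (w' *\<^sub>R Wmat U V (oja \<eta> (snd p) (fst p) t))))
        \<in> borel_measurable (borel \<Otimes>\<^sub>M ?S)"
        by (intro measurable_compose[OF _ measurable_ennreal] borel_measurable_times borel_measurable_ptr
            borel_measurable_scaleR borel_measurable_const borel_measurable_Wmat
            borel_measurable_oja comp) auto
    qed simp
    then show ?thesis by (simp add: g_def case_prod_beta)
  qed
  have le: "(\<integral>\<^sup>+x. h (z, a, x) \<partial>distr \<Omega> borel (A (Suc t))) \<le> g (z, a)" for z a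
    unfolding A_distr[of "Suc t", simplified]
    using expectation_after_step[OF _ c w, of a z q] by (simp add: h_def g_def e_def)
  have oj: "oja \<eta> (\<lambda>i\<in>{1..t}. A i \<omega>) (Z0 \<omega>) t = oja \<eta> (\<lambda>i. A i \<omega>) (Z0 \<omega>) t"
    "good (\<lambda>i\<in>{1..t}. A i \<omega>) (Z0 \<omega>) t = ok t \<omega>" for \<omega>
    unfolding ok_def by (rule oja_cong, simp) (rule good_cong, simp)
  have "(\<integral>\<^sup>+\<omega>. (if ok t \<omega> then ennreal (ptr c (Suc q) (w *\<^sub>R traj (Suc t) \<omega>)) else 0) \<partial>\<Omega>)
    = (\<integral>\<^sup>+\<omega>. h (Z0 \<omega>, restrict (\<lambda>i. A i \<omega>) {1..t}, A (Suc t) \<omega>) \<partial>\<Omega>)"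
    unfolding h_def prod.case oj traj_def oja.simps by (rule refl)
  also have "\<dots> \<le> (\<integral>\<^sup>+\<omega>. g (Z0 \<omega>, restrict (\<lambda>i. A i \<omega>) {1..t}) \<partial>\<Omega>)"
    by (rule P.nn_integral_indep_mono[OF Z0_rv _ _ indep_past h g le])
       (auto intro!: measurable_restrict A_measurable)
  also have "\<dots> = (\<integral>\<^sup>+\<omega>. ennreal (exp e) * (if ok t \<omega> then ennreal (ptr c (Suc q) (w' *\<^sub>R traj t \<omega>)) else 0) \<partial>\<Omega>)"
    using c by (intro nn_integral_cong) (simp add: g_def oj traj_def ennreal_mult ptr_nonneg del: One_nat_def)
  also have "\<dots> = ennreal (exp e) * (\<integral>\<^sup>+\<omega>. (if ok t \<omega> then ennreal (ptr c (Suc q) (w' *\<^sub>R traj t \<omega>)) else 0) \<partial>\<Omega>)"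
    by (rule nn_integral_cmult) measurable
  finally show ?thesis .
qed

text \<open>\<open>ok\<close> could fail through the norm or through a singular V^T Z. Up to a null
  set this excludes the second cause, so an exit means a norm above 4.\<close>

lemma AE_invertible_Suc: "AE \<omega> in \<Omega>. ok t \<omega> \<longrightarrow> invertible (transpose V ** oja \<eta> (\<lambda>i. A i \<omega>) (Z0 \<omega>) (Suc t))"
proof -
  have "AE x in distr \<Omega> borel (A (Suc t)). mbound (x - M) Mb"
    unfolding A_distr[of "Suc t", simplified] by (rule PA(4))
  from AE_distrD[OF A_measurable this] have "AE \<omega> in \<Omega>. mbound (A (Suc t) \<omega> - M) Mb" by simp
  then show ?thesis
  proof eventually_elim
    case (elim \<omega>)
    show ?case
    proof
      assume "ok t \<omega>"
      then have inv: "invertible (transpose V ** oja \<eta> (\<lambda>i. A i \<omega>) (Z0 \<omega>) t)"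
        and W: "mbound (Wmat U V (oja \<eta> (\<lambda>i. A i \<omega>) (Z0 \<omega>) t)) 4"
        by (simp_all add: ok_def good_def opnorm_le_iff)
      show "invertible (transpose V ** oja \<eta> (\<lambda>i. A i \<omega>) (Z0 \<omega>) (Suc t))"
        using Wmat_update(1)[OF inv] invertible_step[OF W _ elim] by simp
    qed
  qed
qed

text \<open>Since \<open>l\<close> is a lower bound for the potential at the time of leaving the region \<open>\<parallel>W\<parallel> \<le> 4\<close>,
  freezing the potential at the value \<open>l\<close> from then on preserves the supermartingale estimate, and
  it bounds the exit probability uniformly in time.\<close>

lemma stopped_bound:
  fixes q :: nat
  assumes c: "0 < c" and w: "\<And>t. 0 < w t" "\<And>t. w (Suc t) * (1 - \<eta> (Suc t) * \<rho> / 2) \<le> w t"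
    and l: "0 \<le> l" "\<And>t. l \<le> ((w t * 4)\<^sup>2 + c) ^ Suc q"
  defines "e \<equiv> \<lambda>s. 2000 * (real (Suc q))\<^sup>2 * (\<eta> s * Mb)\<^sup>2 * (1 + (w s)\<^sup>2 / c)"
  shows "(\<integral>\<^sup>+\<omega>. (if ok t \<omega> then ennreal (ptr c (Suc q) (w t *\<^sub>R traj t \<omega>)) else ennreal l) \<partial>\<Omega>)
    \<le> ennreal (exp (\<Sum>s=1..t. e s) * (real CARD('k) * ((w 0)\<^sup>2 + c) ^ Suc q))"
proof (induction t)
  case 0
  have "(if ok 0 \<omega> then ennreal (ptr c (Suc q) (w 0 *\<^sub>R traj 0 \<omega>)) else ennreal l)
    \<le> ennreal (real CARD('k) * ((w 0)\<^sup>2 + c) ^ Suc q)" if "\<omega> \<in> space \<Omega>" for \<omega>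
  proof -
    have W: "opnorm (Wmat U V (Z0 \<omega>)) \<le> 1" using W0_le[OF that] .
    then have "ok 0 \<omega>" using Z0_inv[OF that] by (simp add: ok_def good_def)
    moreover have "mbound (w 0 *\<^sub>R traj 0 \<omega>) (w 0)"
      using mbound_scaleR[of "Wmat U V (Z0 \<omega>)" 1 "w 0"] W w(1)[of 0] by (simp add: traj_def opnorm_le_iff)
    then have "ptr c (Suc q) (w 0 *\<^sub>R traj 0 \<omega>) \<le> real CARD('k) * ((w 0)\<^sup>2 + c) ^ Suc q"
      using c by (intro ptr_le_of_mbound) auto
    ultimately show ?thesis by (simp only: if_True ennreal_leI)
  qed
  then have "(\<integral>\<^sup>+\<omega>. (if ok 0 \<omega> then ennreal (ptr c (Suc q) (w 0 *\<^sub>R traj 0 \<omega>)) else ennreal l) \<partial>\<Omega>)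
    \<le> (\<integral>\<^sup>+\<omega>. ennreal (real CARD('k) * ((w 0)\<^sup>2 + c) ^ Suc q) \<partial>\<Omega>)"
    by (rule nn_integral_mono)
  then show ?case by (simp add: P.emeasure_space_1)
next
  case (Suc t)
  let ?\<Phi> = "\<lambda>t \<omega>. ennreal (ptr c (Suc q) (w t *\<^sub>R traj t \<omega>))"
  have "AE \<omega> in \<Omega>. (if ok (Suc t) \<omega> then ?\<Phi> (Suc t) \<omega> else ennreal l)
    \<le> (if ok t \<omega> then ?\<Phi> (Suc t) \<omega> else 0) + (if ok t \<omega> then 0 else ennreal l)"
    using AE_invertible_Suc[of t]
  proof eventually_elim
    case (elim \<omega>)
    show ?case
    proof (cases "ok t \<omega> \<and> \<not> ok (Suc t) \<omega>")
      case True
      have "ok (Suc t) \<omega>" if "opnorm (traj (Suc t) \<omega>) \<le> 4"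
        using True elim that unfolding ok_def good_def traj_def by (auto simp: le_Suc_eq simp del: oja.simps)
      with True have "4 < opnorm (traj (Suc t) \<omega>)" by (meson not_le)
      then have "((w (Suc t) * 4)\<^sup>2 + c) ^ Suc q \<le> ptr c (Suc q) (w (Suc t) *\<^sub>R traj (Suc t) \<omega>)"
        using c w(1) by (intro ptr_ge_opnorm_scaleR) auto
      with l(2)[of "Suc t"] have "ennreal l \<le> ?\<Phi> (Suc t) \<omega>" by (intro ennreal_leI) simp
      with True show ?thesis by simp
    next
      case False
      have "ok (Suc t) \<omega> \<Longrightarrow> ok t \<omega>" by (simp add: ok_def good_def)
      with False show ?thesis by auto
    qed
  qed
  then have "(\<integral>\<^sup>+\<omega>. (if ok (Suc t) \<omega> then ?\<Phi> (Suc t) \<omega> else ennreal l) \<partial>\<Omega>)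
    \<le> (\<integral>\<^sup>+\<omega>. (if ok t \<omega> then ?\<Phi> (Suc t) \<omega> else 0) + (if ok t \<omega> then 0 else ennreal l) \<partial>\<Omega>)"
    by (rule nn_integral_mono_AE)
  also have "\<dots> = (\<integral>\<^sup>+\<omega>. (if ok t \<omega> then ?\<Phi> (Suc t) \<omega> else 0) \<partial>\<Omega>) + (\<integral>\<^sup>+\<omega>. (if ok t \<omega> then 0 else ennreal l) \<partial>\<Omega>)"
    by (rule nn_integral_add) measurable
  also have "\<dots> \<le> ennreal (exp (e (Suc t))) * (\<integral>\<^sup>+\<omega>. (if ok t \<omega> then ?\<Phi> t \<omega> else 0) \<partial>\<Omega>)
     + ennreal (exp (e (Suc t))) * (\<integral>\<^sup>+\<omega>. (if ok t \<omega> then 0 else ennreal l) \<partial>\<Omega>)"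
  proof (rule add_mono)
    show "(\<integral>\<^sup>+\<omega>. (if ok t \<omega> then ?\<Phi> (Suc t) \<omega> else 0) \<partial>\<Omega>) \<le> ennreal (exp (e (Suc t))) * (\<integral>\<^sup>+\<omega>. (if ok t \<omega> then ?\<Phi> t \<omega> else 0) \<partial>\<Omega>)"
      unfolding e_def by (rule step_integral[OF c w])
    have "0 \<le> e (Suc t)" using c by (simp add: e_def)
    then have "1 \<le> ennreal (exp (e (Suc t)))" by simp
    from mult_right_mono[OF this] show "(\<integral>\<^sup>+\<omega>. (if ok t \<omega> then 0 else ennreal l) \<partial>\<Omega>) \<le> ennreal (exp (e (Suc t))) * (\<integral>\<^sup>+\<omega>. (if ok t \<omega> then 0 else ennreal l) \<partial>\<Omega>)"
      by simp
  qed
  also have "\<dots> = ennreal (exp (e (Suc t))) * (\<integral>\<^sup>+\<omega>. (if ok t \<omega> then ?\<Phi> t \<omega> else 0) + (if ok t \<omega> then 0 else ennreal l) \<partial>\<Omega>)"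
    by (subst nn_integral_add) (measurable, simp add: distrib_left)
  also have "(\<integral>\<^sup>+\<omega>. (if ok t \<omega> then ?\<Phi> t \<omega> else 0) + (if ok t \<omega> then 0 else ennreal l) \<partial>\<Omega>)
     = (\<integral>\<^sup>+\<omega>. (if ok t \<omega> then ?\<Phi> t \<omega> else ennreal l) \<partial>\<Omega>)"
    by (intro nn_integral_cong) simp
  also have "ennreal (exp (e (Suc t))) * \<dots> \<le> ennreal (exp (e (Suc t))) *
      ennreal (exp (\<Sum>s=1..t. e s) * (real CARD('k) * ((w 0)\<^sup>2 + c) ^ Suc q))"
    by (rule mult_left_mono[OF Suc.IH]) simp
  also have "\<dots> = ennreal (exp (\<Sum>s=1..Suc t. e s) * (real CARD('k) * ((w 0)\<^sup>2 + c) ^ Suc q))"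
    by (simp add: ennreal_mult'[symmetric] exp_add mult_ac)
  finally show ?case .
qed

section \<open>Markov bounds for the exit and for the final norm\<close>

lemma prob_not_ok:
  fixes q :: nat
  assumes c: "0 < c" and w: "\<And>t. 0 < w t" "\<And>t. w (Suc t) * (1 - \<eta> (Suc t) * \<rho> / 2) \<le> w t"
    and l: "0 < l" "\<And>t. l \<le> ((w t * 4)\<^sup>2 + c) ^ Suc q"
  defines "e \<equiv> \<lambda>s. 2000 * (real (Suc q))\<^sup>2 * (\<eta> s * Mb)\<^sup>2 * (1 + (w s)\<^sup>2 / c)"
  shows "measure \<Omega> {\<omega> \<in> space \<Omega>. \<not> ok t \<omega>} \<le> exp (\<Sum>s=1..t. e s) * (real CARD('k) * ((w 0)\<^sup>2 + c) ^ Suc q) / l"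
proof -
  let ?B = "{\<omega> \<in> space \<Omega>. \<not> ok t \<omega>}"
  have B: "?B \<in> sets \<Omega>" by measurable
  have "ennreal (l * measure \<Omega> ?B) = (\<integral>\<^sup>+\<omega>. ennreal l * indicator ?B \<omega> \<partial>\<Omega>)"
    using B l by (simp add: nn_integral_cmult_indicator P.emeasure_eq_measure ennreal_mult)
  also have "\<dots> \<le> (\<integral>\<^sup>+\<omega>. (if ok t \<omega> then ennreal (ptr c (Suc q) (w t *\<^sub>R traj t \<omega>)) else ennreal l) \<partial>\<Omega>)"
    by (intro nn_integral_mono) (auto simp: indicator_def)
  also have "\<dots> \<le> ennreal (exp (\<Sum>s=1..t. e s) * (real CARD('k) * ((w 0)\<^sup>2 + c) ^ Suc q))"
    unfolding e_def by (rule stopped_bound[OF c w less_imp_le[OF l(1)] l(2)])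
  finally show ?thesis
    using l c by (subst (asm) ennreal_le_iff) (auto simp: field_simps)
qed

lemma prob_large_after_ok:
  fixes q :: nat
  assumes c: "0 < c" and w: "\<And>t. 0 < w t" "\<And>t. w (Suc t) * (1 - \<eta> (Suc t) * \<rho> / 2) \<le> w t"
    and b: "0 \<le> b"
  defines "e \<equiv> \<lambda>s. 2000 * (real (Suc q))\<^sup>2 * (\<eta> s * Mb)\<^sup>2 * (1 + (w s)\<^sup>2 / c)"
  shows "measure \<Omega> {\<omega> \<in> space \<Omega>. ok t \<omega> \<and> b < opnorm (traj (Suc t) \<omega>)}
    \<le> exp (\<Sum>s=1..Suc t. e s) * (real CARD('k) * ((w 0)\<^sup>2 + c) ^ Suc q) / ((w (Suc t) * b)\<^sup>2 + c) ^ Suc q"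
proof -
  let ?B = "{\<omega> \<in> space \<Omega>. ok t \<omega> \<and> b < opnorm (traj (Suc t) \<omega>)}"
  define l where "l = ((w (Suc t) * b)\<^sup>2 + c) ^ Suc q"
  have l: "0 < l" unfolding l_def using c by (intro zero_less_power add_nonneg_pos) auto
  have [measurable]: "(\<lambda>\<omega>. opnorm (traj (Suc t) \<omega>)) \<in> borel_measurable \<Omega>"
    by (intro borel_measurable_opnorm measurable_traj)
  have B: "?B \<in> sets \<Omega>" by measurable
  have "ennreal (l * measure \<Omega> ?B) = (\<integral>\<^sup>+\<omega>. ennreal l * indicator ?B \<omega> \<partial>\<Omega>)"
    using B l by (simp add: nn_integral_cmult_indicator P.emeasure_eq_measure ennreal_mult)
  also have "\<dots> \<le> (\<integral>\<^sup>+\<omega>. (if ok t \<omega> then ennreal (ptr c (Suc q) (w (Suc t) *\<^sub>R traj (Suc t) \<omega>)) else 0) \<partial>\<Omega>)"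
  proof (intro nn_integral_mono)
    fix \<omega> show "ennreal l * indicator ?B \<omega> \<le> (if ok t \<omega> then ennreal (ptr c (Suc q) (w (Suc t) *\<^sub>R traj (Suc t) \<omega>)) else 0)"
    proof (cases "\<omega> \<in> ?B")
      case True
      then have "l \<le> ptr c (Suc q) (w (Suc t) *\<^sub>R traj (Suc t) \<omega>)"
        unfolding l_def using c w(1) b by (intro ptr_ge_opnorm_scaleR) auto
      with True show ?thesis by (simp add: ennreal_leI)
    qed simp
  qed
  also have "\<dots> \<le> ennreal (exp (e (Suc t))) * (\<integral>\<^sup>+\<omega>. (if ok t \<omega> then ennreal (ptr c (Suc q) (w t *\<^sub>R traj t \<omega>)) else 0) \<partial>\<Omega>)"
    unfolding e_def by (rule step_integral[OF c w])
  also have "(\<integral>\<^sup>+\<omega>. (if ok t \<omega> then ennreal (ptr c (Suc q) (w t *\<^sub>R traj t \<omega>)) else 0) \<partial>\<Omega>)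
    \<le> ennreal (exp (\<Sum>s=1..t. e s) * (real CARD('k) * ((w 0)\<^sup>2 + c) ^ Suc q))"
    using stopped_bound[OF c w, of 0 q t] c unfolding ennreal_0 e_def by simp
  also have "ennreal (exp (e (Suc t))) * \<dots> = ennreal (exp (\<Sum>s=1..Suc t. e s) * (real CARD('k) * ((w 0)\<^sup>2 + c) ^ Suc q))"
    by (simp add: ennreal_mult'[symmetric] exp_add mult_ac)
  finally have "ennreal (l * measure \<Omega> ?B) \<le> ennreal (exp (\<Sum>s=1..Suc t. e s) * (real CARD('k) * ((w 0)\<^sup>2 + c) ^ Suc q))"
    by (simp add: mult_left_mono)
  then show ?thesis unfolding l_def[symmetric]
    using l c by (subst (asm) ennreal_le_iff) (auto simp: field_simps)
qed

end

section \<open>Choice of the parameters\<close>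

lemma sum_inverse_squares_le:
  assumes "0 < (b::real)"
  shows "(\<Sum>s=1..t. 1 / (b + real s)\<^sup>2) \<le> 1 / b - 1 / (b + real t)"
proof (induction t)
  case (Suc t)
  let ?x = "b + real t"
  have x: "0 < ?x" using assms by simp
  have "1 / (?x + 1)\<^sup>2 \<le> 1 / (?x * (?x + 1))"
    using x by (intro divide_left_mono) (auto simp: power2_eq_square)
  also have "\<dots> = 1 / ?x - 1 / (?x + 1)" using x by (simp add: field_simps)
  finally show ?case using Suc by (simp add: add_ac)
qed simp

text \<open>As e^2 \<le> 17/2, the power of D1/D2 is at most e^(-2p). One factor e^(-p) cancels exp
  E, the other is at most \<delta>/(2k). The scale \<open>X\<close> lets the estimate serve both
  choices of weights.\<close>

lemma tail_bound:
  fixes \<delta> k E X D1 D2 :: real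
  assumes "0 < \<delta>" "0 < k" and p: "ln (2 * k / \<delta>) \<le> real p" and "E \<le> real p"
    and D: "0 < X" "0 \<le> D1" "D1 \<le> 2 * X" "17 * X \<le> D2"
  shows "exp E * (k * D1 ^ p) / D2 ^ p \<le> \<delta> / 2"
proof -
  have e2: "exp 1 * exp 1 \<le> (17 / 2 :: real)"
    using mult_mono[of "exp 1" "272 / 100" "exp 1" "272 / 100 :: real"] e_less_272 by simp
  have r: "D1 / D2 \<le> 2 / 17"
  proof -
    have "D1 / D2 \<le> (2 * X) / (17 * X)" using D by (intro frac_le) auto
    then show ?thesis using D by simp
  qed
  have "exp 1 * (D1 / D2) \<le> exp 1 * (2 / 17)" by (intro mult_left_mono r) simp
  also have "\<dots> \<le> 1 / exp 1" using e2 by (simp add: field_simps)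
  finally have q: "exp 1 * (D1 / D2) \<le> 1 / exp 1" .
  have "exp E * (k * D1 ^ p) / D2 ^ p = k * (exp E * (D1 / D2) ^ p)"
    by (simp add: power_divide)
  also have "\<dots> \<le> k * (exp (real p) * (D1 / D2) ^ p)"
    using assms by (intro mult_left_mono mult_right_mono) auto
  also have "exp (real p) * (D1 / D2) ^ p = (exp 1 * (D1 / D2)) ^ p"
    using exp_of_nat_mult[of p "1::real"] by (simp add: power_mult_distrib power_divide)
  also have "k * \<dots> \<le> k * (1 / exp 1) ^ p"
    using assms q by (intro mult_left_mono power_mono) auto
  also have "\<dots> = k / exp (real p)"
    using exp_of_nat_mult[of p "1::real"] by (simp add: power_divide)
  also have "\<dots> \<le> k / (2 * k / \<delta>)"
  proof (rule divide_left_mono)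
    have "2 * k / \<delta> = exp (ln (2 * k / \<delta>))" using assms by simp
    also have "\<dots> \<le> exp (real p)" using p by simp
    finally show "2 * k / \<delta> \<le> exp (real p)" .
  qed (use assms in auto)
  also have "\<dots> = \<delta> / 2" using assms by simp
  finally show ?thesis .
qed

text \<open>78 = 2 * 3 * 13, from e \<ge> 2, sqrt 2 \<ge> 1 and 42 * 4 + 5 \<ge> 13^2.\<close>

lemma C3_ge: "78 \<le> C3"
proof -
  have e: "(2::real) \<le> exp 1" using exp_ge_add_one_self[of 1] by simp
  have "1 \<le> sqrt 2" by simp
  then have "1 * 2 \<le> sqrt 2 * exp 1" using e by (intro mult_mono) auto
  moreover have "13 \<le> sqrt (42 * (exp 1)\<^sup>2 + 5)"
  proof (rule real_le_rsqrt)
    have "(2::real)\<^sup>2 \<le> (exp 1)\<^sup>2" using e by (intro power_mono) auto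
    then show "13\<^sup>2 \<le> 42 * (exp 1)\<^sup>2 + (5::real)" by simp
  qed
  ultimately have "(2 * 3) * 13 \<le> (2 * (1 + sqrt 2 * exp 1)) * sqrt (42 * (exp 1)\<^sup>2 + 5)"
    by (intro mult_mono) auto
  then show ?thesis by (simp add: C3_def)
qed

section \<open>Instantiation with the prescribed step sizes\<close>

theorem theorem4p2:
  fixes \<Omega> :: "'w measure"
    and PA :: "(real^'d^'d) measure"
    and A :: "nat \<Rightarrow> 'w \<Rightarrow> real^'d^'d"
    and Z0 :: "'w \<Rightarrow> (real, 'k::enum) vec^'d"
    and Mmat :: "real^'d^'d"
    and Mb :: real
    and V :: "(real, 'k) vec^'d" and U :: "real^'m^'d"
    and lv :: "'k \<Rightarrow> real" and lu :: "'m \<Rightarrow> real"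
    and \<rho> \<rho>bar \<delta> \<alpha> \<beta> :: real
    and \<eta> :: "nat \<Rightarrow> real"
  assumes dims: "CARD('d) \<ge> 2" "CARD('k) < CARD('d)" "CARD('m) = CARD('d) - CARD('k)"
    \<comment> \<open>Assumption 1: P_A is a distribution on symmetric matrices with mean Mmat;
        A_1, A_2, ... are i.i.d. samples from P_A\<close>
    and PA_prob: "prob_space PA" and PA_borel: "sets PA = sets borel"
    and PA_sym: "AE X in PA. transpose X = X"
    and PA_int: "integrable PA (\<lambda>X. X)"
    and Mmat_def: "Mmat = integral\<^sup>L PA (\<lambda>X. X)"
    and Omega_prob: "prob_space \<Omega>"
    and A_indep: "prob_space.indep_vars \<Omega> (\<lambda>_. borel) A {1..}"
    and A_distr: "\<And>i. i \<ge> 1 \<Longrightarrow> distr \<Omega> borel (A i) = PA"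
    \<comment> \<open>Assumption 2\<close>
    and Mb_pos: "Mb > 0"
    and bounded: "AE X in PA. \<forall>P :: (real, 'k) vec^'d. orthonormal_cols P \<longrightarrow>
                      opnorm (transpose P ** (X - Mmat)) \<le> Mb"
    \<comment> \<open>spectral data of Mmat: V, U orthonormal eigenvector bases of the top-k and
        remaining eigenspaces, with eigenvalues lv, lu\<close>
    and V_on: "orthonormal_cols V" and U_on: "orthonormal_cols U"
    and VU_orth: "transpose V ** U = 0"
    and V_eig: "\<And>j. Mmat *v column j V = lv j *\<^sub>R column j V"
    and U_eig: "\<And>j. Mmat *v column j U = lu j *\<^sub>R column j U"
    and eig_order: "\<And>i j. lu j \<le> lv i"
    and rho_def: "\<rho> = Min (range lv) - Max (range lu)"
    and rho_pos: "\<rho> > 0"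
    and rhobar_def: "\<rho>bar = min (\<rho> / Mb) (min (\<rho> / opnorm Mmat) 1)"
    \<comment> \<open>initialization: independent of the samples, and surely V^* Z_0 invertible, ||W_0|| <= 1\<close>
    and Z0_rv: "Z0 \<in> borel_measurable \<Omega>"
    and Z0_indep: "prob_space.indep_set \<Omega>
                     {Z0 -` B \<inter> space \<Omega> | B. B \<in> sets borel}
                     {(\<lambda>\<omega>. restrict (\<lambda>i. A i \<omega>) {1..}) -` B \<inter> space \<Omega> | B.
                        B \<in> sets (PiM {1..} (\<lambda>_. borel))}"
    and Z0_inv: "\<And>\<omega>. \<omega> \<in> space \<Omega> \<Longrightarrow> invertible (transpose V ** Z0 \<omega>)"
    and W0_le: "\<And>\<omega>. \<omega> \<in> space \<Omega> \<Longrightarrow> opnorm (Wmat U V (Z0 \<omega>)) \<le> 1"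
    \<comment> \<open>parameters\<close>
    and delta: "0 < \<delta>" "\<delta> < 1"
    and alpha: "\<alpha> \<ge> 8"
    and beta: "\<beta> \<ge> 2 * (C3 * \<alpha> / \<rho>bar)^2 * ln (C3 * \<alpha> / \<rho>bar * (2 * real CARD('k) / \<delta>))"
    and eta_def: "\<And>i. \<eta> i = \<alpha> / ((\<beta> + real i) * \<rho>)"
  shows "\<forall>T::nat. T \<ge> 1 \<longrightarrow>
    measure \<Omega> {\<omega> \<in> space \<Omega>.
       invertible (transpose V ** oja \<eta> (\<lambda>t. A t \<omega>) (Z0 \<omega>) T) \<and>
       opnorm (transpose U ** gram_schmidt (oja \<eta> (\<lambda>t. A t \<omega>) (Z0 \<omega>) T))
         \<le> opnorm (Wmat U V (oja \<eta> (\<lambda>t. A t \<omega>) (Z0 \<omega>) T)) \<and>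
       opnorm (Wmat U V (oja \<eta> (\<lambda>t. A t \<omega>) (Z0 \<omega>) T))
         \<le> 2 * exp 1 * sqrt ((\<beta> + 1) / (\<beta> + real T))} \<ge> 1 - \<delta>"
proof -
  interpret eigen_split V U Mmat lv lu \<rho>
    by unfold_locales (use dims V_on U_on VU_orth V_eig U_eig rho_def rho_pos in auto)
  define k where "k = real CARD('k)"
  have k: "1 \<le> k" by (simp add: k_def Suc_le_eq)
  have bar: "0 < \<rho>bar" "\<rho>bar \<le> 1" "\<rho>bar \<le> \<rho> / Mb" "\<rho>bar \<le> \<rho> / opnorm Mmat"
    using rho_pos Mb_pos opnorm_pos by (simp_all add: rhobar_def)
  \<comment> \<open>The scale of the relative step: \<eta> t times \<open>Mb\<close> or times the
    norm of the mean is at most L0 / (\<beta> + t).\<close>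
  define L0 where "L0 = \<alpha> / \<rho>bar"
  have L0: "8 \<le> L0"
  proof -
    have "8 \<le> \<alpha> / 1" using alpha by simp
    also have "\<dots> \<le> L0" unfolding L0_def using bar alpha by (intro divide_left_mono) auto
    finally show ?thesis .
  qed
  define lg where "lg = ln (C3 * L0 * (2 * k / \<delta>))"
  have kd: "2 < 2 * k / \<delta>"
    using delta k by (simp add: less_divide_eq)
  have CL: "3 \<le> C3 * L0" using mult_mono[OF C3_ge L0] C3_ge by simp
  have lnp: "0 < ln (2 * k / \<delta>)" using kd by simp
  \<comment> \<open>The exponent in use is \<open>Suc q\<close>. The logarithm is positive, so the
    natural-number subtraction does not truncate.\<close>
  define q where "q = nat \<lceil>ln (2 * k / \<delta>)\<rceil> - 1"
  have pq: "Suc q = nat \<lceil>ln (2 * k / \<delta>)\<rceil>" using lnp by (simp add: q_def)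
  define p where "p = real (Suc q)"
  have p: "ln (2 * k / \<delta>) \<le> p" "p \<le> ln (2 * k / \<delta>) + 1" "1 \<le> p"
  proof -
    have "p = of_int \<lceil>ln (2 * k / \<delta>)\<rceil>" unfolding p_def pq using lnp by simp
    then show "ln (2 * k / \<delta>) \<le> p" "p \<le> ln (2 * k / \<delta>) + 1" by linarith+
    show "1 \<le> p" by (simp add: p_def)
  qed
  \<comment> \<open>The unit lost by rounding up is covered by the factor C3 L0 \<ge> e inside the
    logarithm.\<close>
  have plg: "p \<le> lg"
  proof -
    have "exp 1 \<le> C3 * L0" using CL e_less_272 by simp
    then have "1 \<le> ln (C3 * L0)" using CL by (simp add: ln_ge_iff)
    moreover have "lg = ln (C3 * L0) + ln (2 * k / \<delta>)"
      unfolding lg_def by (rule ln_mult_pos) (use CL kd in linarith)+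
    ultimately show ?thesis using p by simp
  qed
  \<comment> \<open>12168 = 2 * 78^2.\<close>
  have beta_p: "12168 * L0\<^sup>2 * p \<le> \<beta>"
  proof -
    have "78\<^sup>2 \<le> C3\<^sup>2" using C3_ge by (intro power_mono) auto
    then have "2 * (78\<^sup>2 * L0\<^sup>2) * p \<le> 2 * (C3\<^sup>2 * L0\<^sup>2) * lg"
      using plg p by (intro mult_mono) auto
    also have "\<dots> \<le> \<beta>"
      using beta by (simp add: lg_def L0_def k_def power_mult_distrib power_divide)
    finally show ?thesis by simp
  qed
  have beta_L: "12168 * L0\<^sup>2 \<le> \<beta>"
    using beta_p mult_left_mono[OF p(3), of "12168 * L0\<^sup>2"] by simp
  have beta_pos: "0 < \<beta>" using beta_L L0 by (smt (verit) zero_less_power)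
  have Lb: "L0 / (\<beta> + real t) \<le> 1 / 100" for t
  proof -
    have "100 * L0 \<le> 12168 * (8 * L0)" using L0 by simp
    also have "\<dots> \<le> 12168 * (L0 * L0)" using L0 by (intro mult_left_mono mult_right_mono) auto
    also have "\<dots> \<le> \<beta>" using beta_L by (simp add: power2_eq_square)
    finally show ?thesis using beta_pos by (simp add: field_simps)
  qed
  have eta_le: "\<eta> t * r \<le> L0 / (\<beta> + real t)" if "0 < r" "\<rho>bar \<le> \<rho> / r" for t r
  proof -
    have "\<rho>bar * r \<le> \<rho>" using that by (simp add: field_simps)
    then have "r / \<rho> \<le> 1 / \<rho>bar" using bar rho_pos by (simp add: field_simps)
    then have "\<alpha> / (\<beta> + real t) * (r / \<rho>) \<le> \<alpha> / (\<beta> + real t) * (1 / \<rho>bar)"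
      using alpha beta_pos by (intro mult_left_mono) auto
    then show ?thesis by (simp add: eta_def L0_def field_simps)
  qed
  have eta_pos: "0 < \<eta> t" for t using alpha beta_pos rho_pos by (simp add: eta_def)
  have eta_Mb: "\<eta> t * Mb \<le> L0 / (\<beta> + real t)" for t by (rule eta_le[OF Mb_pos bar(3)])
  interpret oja_process V U Mmat lv lu \<rho> \<Omega> PA A Z0 Mb \<eta>
  proof (rule oja_process.intro, rule eigen_split_axioms, rule oja_process_axioms.intro)
    show "AE X in PA. mbound (X - Mmat) Mb"
      using bounded by eventually_elim (rule mbound_of_orthonormal_compressions[OF V_on], blast)
    show "\<eta> t * opnorm Mmat \<le> 1 / 100" for t
      by (rule order_trans[OF eta_le[OF opnorm_pos bar(4)] Lb])
    show "\<eta> t * Mb \<le> 1 / 100" for t by (rule order_trans[OF eta_Mb Lb])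
    show "integral\<^sup>L PA (\<lambda>X. X) = Mmat" by (rule Mmat_def [symmetric])
    show "0 < \<eta> t" for t by (rule eta_pos)
  qed (fact Omega_prob PA_prob PA_int A_indep A_distr Z0_rv Z0_indep Z0_inv W0_le Mb_pos)+
  have sq: "(\<eta> s * Mb)\<^sup>2 \<le> L0\<^sup>2 * (1 / (\<beta> + real s)\<^sup>2)" for s
  proof -
    have "(\<eta> s * Mb)\<^sup>2 \<le> (L0 / (\<beta> + real s))\<^sup>2"
      using eta_Mb[of s] eta_pos[of s] Mb_pos by (intro power_mono) auto
    then show ?thesis by (simp add: power_divide)
  qed
  have sum_sq: "(\<Sum>s=1..t. 1 / (\<beta> + real s)\<^sup>2) \<le> 1 / \<beta>" for t
  proof -
    have "0 \<le> 1 / (\<beta> + real t)" using beta_pos by simp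
    then show ?thesis using sum_inverse_squares_le[OF beta_pos, of t] by linarith
  qed
  \<comment> \<open>The total cost of either stage. The 2000 of a single step doubles: through 1 +
    w^2/c = 2 for constant weights, through two sums of size at most 1/\<beta> each for growing
    ones.\<close>
  have expo: "4000 * p\<^sup>2 * L0\<^sup>2 / \<beta> \<le> p"
  proof -
    have "4000 * (p\<^sup>2 * L0\<^sup>2) \<le> 12168 * (p\<^sup>2 * L0\<^sup>2)"
      by (intro mult_right_mono) auto
    then have "4000 * p\<^sup>2 * L0\<^sup>2 \<le> p * (12168 * L0\<^sup>2 * p)"
      by (simp add: power2_eq_square mult_ac)
    also have "\<dots> \<le> p * \<beta>" using beta_p p by (intro mult_left_mono) auto
    finally show ?thesis using beta_pos by (simp add: field_simps)
  qed
  show ?thesis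
  proof (intro allI impI)
    fix T :: nat assume "1 \<le> T"
    then obtain t where T: "T = Suc t" by (cases T) auto
    define b where "b = 2 * exp 1 * sqrt ((\<beta> + 1) / (\<beta> + real T))"
    have b: "0 \<le> b" using beta_pos by (simp add: b_def)
    let ?B1 = "{\<omega> \<in> space \<Omega>. \<not> ok t \<omega>}"
    let ?B2 = "{\<omega> \<in> space \<Omega>. ok t \<omega> \<and> b < opnorm (traj (Suc t) \<omega>)}"
    have B1: "measure \<Omega> ?B1 \<le> \<delta> / 2"
    proof -
      have "measure \<Omega> ?B1 \<le> exp (\<Sum>s=1..t. 2000 * (real (Suc q))\<^sup>2 * (\<eta> s * Mb)\<^sup>2 * (1 + 1\<^sup>2 / 1))
        * (k * (1\<^sup>2 + 1) ^ Suc q) / 17 ^ Suc q"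
        unfolding k_def
      \<comment> \<open>Per eigenvalue the potential is at most 1^2 + 1 at the start, while the exit
        level is 4^2 + 1 = 17.\<close>
      proof (rule prob_not_ok[of 1 "\<lambda>_. 1"])
        show "1 * (1 - \<eta> (Suc t) * \<rho> / 2) \<le> 1" for t using eta_pos[of "Suc t"] rho_pos by simp
      qed auto
      also have "\<dots> \<le> \<delta> / 2"
      proof (rule tail_bound[where X = 1])
        have "(\<Sum>s=1..t. 2000 * (real (Suc q))\<^sup>2 * (\<eta> s * Mb)\<^sup>2 * (1 + 1\<^sup>2 / 1))
          \<le> (\<Sum>s=1..t. 4000 * p\<^sup>2 * L0\<^sup>2 * (1 / (\<beta> + real s)\<^sup>2))"
        proof (rule sum_mono)
          fix s
          show "2000 * (real (Suc q))\<^sup>2 * (\<eta> s * Mb)\<^sup>2 * (1 + 1\<^sup>2 / 1) \<le> 4000 * p\<^sup>2 * L0\<^sup>2 * (1 / (\<beta> + real s)\<^sup>2)"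
            using mult_left_mono[OF sq[of s], of "4000 * p\<^sup>2"] by (simp add: p_def)
        qed
        also have "\<dots> = 4000 * p\<^sup>2 * L0\<^sup>2 * (\<Sum>s=1..t. 1 / (\<beta> + real s)\<^sup>2)"
          by (rule sum_distrib_left [symmetric])
        also have "\<dots> \<le> 4000 * p\<^sup>2 * L0\<^sup>2 * (1 / \<beta>)"
          using sum_sq[of t] by (intro mult_left_mono) auto
        also have "\<dots> \<le> p" using expo by simp
        finally show "(\<Sum>s=1..t. 2000 * (real (Suc q))\<^sup>2 * (\<eta> s * Mb)\<^sup>2 * (1 + 1\<^sup>2 / 1)) \<le> real (Suc q)"
          by (simp add: p_def)
        show "ln (2 * k / \<delta>) \<le> real (Suc q)" using p by (simp add: p_def)
      qed (use delta k in auto)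
      finally show ?thesis .
    qed
    \<comment> \<open>Three demands meet here: \<beta>^2 \<le> c bounds the initial potential by 2c
      per eigenvalue, the target norm gives (w_T b)^2 = 4 e^2 c, and T/c \<le> 1/\<beta> keeps the
      weighted noise within the budget.\<close>
    define c where "c = (\<beta> + 1) * (\<beta> + real T)"
    have c: "0 < c" using beta_pos by (simp add: c_def)
    have B2: "measure \<Omega> ?B2 \<le> \<delta> / 2"
    proof -
      define w where "w s = \<beta> + real s" for s
      have "measure \<Omega> ?B2 \<le> exp (\<Sum>s=1..Suc t. 2000 * (real (Suc q))\<^sup>2 * (\<eta> s * Mb)\<^sup>2 * (1 + (w s)\<^sup>2 / c))
        * (k * ((w 0)\<^sup>2 + c) ^ Suc q) / ((w (Suc t) * b)\<^sup>2 + c) ^ Suc q"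
        unfolding k_def
      proof (rule prob_large_after_ok[OF c _ _ b])
        show "0 < w t" for t using beta_pos by (simp add: w_def)
        show "w (Suc t) * (1 - \<eta> (Suc t) * \<rho> / 2) \<le> w t" for t
        proof -
          \<comment> \<open>The weight grows by 1 in each step, while the contraction takes off
            \<alpha>/2, which is at least 4.\<close>
          have "w (Suc t) * (\<eta> (Suc t) * \<rho>) = \<alpha>"
            using beta_pos rho_pos by (simp add: w_def eta_def)
          then have "w (Suc t) * (1 - \<eta> (Suc t) * \<rho> / 2) = w (Suc t) - \<alpha> / 2"
            by (simp add: algebra_simps)
          then show ?thesis using alpha by (simp add: w_def)
        qed
      qed
      also have "\<dots> \<le> \<delta> / 2"
      proof (rule tail_bound[where X = c])
        have "(\<Sum>s=1..Suc t. 2000 * (real (Suc q))\<^sup>2 * (\<eta> s * Mb)\<^sup>2 * (1 + (w s)\<^sup>2 / c))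
          \<le> (\<Sum>s=1..Suc t. 2000 * p\<^sup>2 * L0\<^sup>2 * (1 / (\<beta> + real s)\<^sup>2 + 1 / c))"
        proof (rule sum_mono)
          fix s
          have ws: "w s \<noteq> 0" using beta_pos by (simp add: w_def)
          have "2000 * p\<^sup>2 * ((\<eta> s * Mb)\<^sup>2 * (1 + (w s)\<^sup>2 / c)) \<le> 2000 * p\<^sup>2 * (L0\<^sup>2 * (1 / (w s)\<^sup>2) * (1 + (w s)\<^sup>2 / c))"
            using sq[of s] c by (intro mult_left_mono mult_right_mono) (auto simp: w_def)
          also have "1 / (w s)\<^sup>2 * (1 + (w s)\<^sup>2 / c) = 1 / (w s)\<^sup>2 + 1 / c"
            using ws by (simp add: distrib_left)
          then have "L0\<^sup>2 * (1 / (w s)\<^sup>2) * (1 + (w s)\<^sup>2 / c) = L0\<^sup>2 * (1 / (w s)\<^sup>2 + 1 / c)"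
            by (simp only: mult.assoc)
          finally show "2000 * (real (Suc q))\<^sup>2 * (\<eta> s * Mb)\<^sup>2 * (1 + (w s)\<^sup>2 / c)
            \<le> 2000 * p\<^sup>2 * L0\<^sup>2 * (1 / (\<beta> + real s)\<^sup>2 + 1 / c)"
            by (simp add: p_def w_def mult.assoc)
        qed
        also have "\<dots> = 2000 * p\<^sup>2 * L0\<^sup>2 * ((\<Sum>s=1..Suc t. 1 / (\<beta> + real s)\<^sup>2) + real T / c)"
          by (simp only: sum_distrib_left [symmetric] sum.distrib) (simp add: T)
        also have "\<dots> \<le> 2000 * p\<^sup>2 * L0\<^sup>2 * (1 / \<beta> + 1 / \<beta>)"
        proof (intro mult_left_mono add_mono sum_sq)
          have "real T / c = (real T / (\<beta> + real T)) * (1 / (\<beta> + 1))" by (simp add: c_def)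
          also have "\<dots> \<le> 1 * (1 / \<beta>)"
            using beta_pos by (intro mult_mono frac_le) (simp_all add: divide_le_eq)
          finally show "real T / c \<le> 1 / \<beta>" by simp
        qed auto
        also have "\<dots> \<le> p" using expo by simp
        finally show "(\<Sum>s=1..Suc t. 2000 * (real (Suc q))\<^sup>2 * (\<eta> s * Mb)\<^sup>2 * (1 + (w s)\<^sup>2 / c)) \<le> real (Suc q)"
          by (simp add: p_def)
        show "ln (2 * k / \<delta>) \<le> real (Suc q)" using p by (simp add: p_def)
        have "\<beta> * \<beta> \<le> (\<beta> + 1) * (\<beta> + real T)" using beta_pos by (intro mult_mono) auto
        then show "(w 0)\<^sup>2 + c \<le> 2 * c" by (simp add: w_def c_def power2_eq_square)
        have "(w (Suc t) * b)\<^sup>2 = 4 * (exp 1)\<^sup>2 * c"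
        proof -
          have "(sqrt ((\<beta> + 1) / (\<beta> + real T)))\<^sup>2 = (\<beta> + 1) / (\<beta> + real T)" using beta_pos by simp
          then have "(w (Suc t) * b)\<^sup>2 = (\<beta> + real T)\<^sup>2 * (4 * (exp 1)\<^sup>2 * ((\<beta> + 1) / (\<beta> + real T)))"
            by (simp only: w_def T b_def power_mult_distrib) simp
          also have "\<dots> = 4 * (exp 1)\<^sup>2 * c"
            using beta_pos by (simp add: c_def power2_eq_square)
          finally show ?thesis .
        qed
        moreover have "16 * c \<le> 4 * (exp 1)\<^sup>2 * c"
        proof (intro mult_right_mono)
          have "(2::real)\<^sup>2 \<le> (exp 1)\<^sup>2" using exp_ge_add_one_self[of "1::real"] by (intro power_mono) auto
          then show "16 \<le> 4 * (exp 1 :: real)\<^sup>2" by simp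
        qed (use c in simp)
        ultimately show "17 * c \<le> (w (Suc t) * b)\<^sup>2 + c" by simp
      qed (use delta k c in auto)
      finally show ?thesis .
    qed
    let ?inv = "\<lambda>\<omega>. invertible (transpose V ** oja \<eta> (\<lambda>t. A t \<omega>) (Z0 \<omega>) T)"
    define E where "E = {\<omega> \<in> space \<Omega>. ?inv \<omega> \<and> opnorm (traj T \<omega>) \<le> b}"
    have mdet: "(\<lambda>\<omega>. det (transpose V ** oja \<eta> (\<lambda>t. A t \<omega>) (Z0 \<omega>) T)) \<in> borel_measurable \<Omega>"
      by (intro borel_measurable_det borel_measurable_matrix_mult borel_measurable_const borel_measurable_oja Z0_rv)
         (auto intro: A_measurable)
    have mop: "(\<lambda>\<omega>. opnorm (traj s \<omega>)) \<in> borel_measurable \<Omega>" for s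
      by (intro borel_measurable_opnorm measurable_traj)
    have E: "E \<in> sets \<Omega>"
      unfolding E_def invertible_det_nz using mdet mop[of T] by measurable
    have Bs: "?B1 \<in> sets \<Omega>" "?B2 \<in> sets \<Omega>"
      using mop[of "Suc t"] by measurable
    \<comment> \<open>Outside both bad events \<open>ok t\<close> holds and the norm at time
      \<open>T\<close> is at most \<open>b\<close>; invertibility at \<open>T\<close> can then fail
      only on a null set.\<close>
    have "measure \<Omega> (space \<Omega> - E) \<le> measure \<Omega> (?B1 \<union> ?B2)"
    proof (rule P.finite_measure_mono_AE)
      show "AE \<omega> in \<Omega>. \<omega> \<in> space \<Omega> - E \<longrightarrow> \<omega> \<in> ?B1 \<union> ?B2"
        using AE_invertible_Suc[of t] by eventually_elim (auto simp: E_def T)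
    qed (use Bs in auto)
    also have "\<dots> \<le> measure \<Omega> ?B1 + measure \<Omega> ?B2"
      using Bs by (intro measure_Un_le)
    also have "\<dots> \<le> \<delta>" using B1 B2 by simp
    finally have "1 - \<delta> \<le> measure \<Omega> E" using P.prob_compl[OF E] by simp
    \<comment> \<open>The comparison with the orthonormalised iterate holds wherever V^T Z_T is
      invertible, so adding it leaves the event unchanged.\<close>
    also have "E = {\<omega> \<in> space \<Omega>.
       invertible (transpose V ** oja \<eta> (\<lambda>t. A t \<omega>) (Z0 \<omega>) T) \<and>
       opnorm (transpose U ** gram_schmidt (oja \<eta> (\<lambda>t. A t \<omega>) (Z0 \<omega>) T))
         \<le> opnorm (Wmat U V (oja \<eta> (\<lambda>t. A t \<omega>) (Z0 \<omega>) T)) \<and>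
       opnorm (Wmat U V (oja \<eta> (\<lambda>t. A t \<omega>) (Z0 \<omega>) T))
         \<le> 2 * exp 1 * sqrt ((\<beta> + 1) / (\<beta> + real T))}"
      unfolding E_def b_def traj_def using opnorm_gram_schmidt_le[OF V_on] by blast
    finally show "1 - \<delta> \<le> measure \<Omega> {\<omega> \<in> space \<Omega>.
       invertible (transpose V ** oja \<eta> (\<lambda>t. A t \<omega>) (Z0 \<omega>) T) \<and>
       opnorm (transpose U ** gram_schmidt (oja \<eta> (\<lambda>t. A t \<omega>) (Z0 \<omega>) T))
         \<le> opnorm (Wmat U V (oja \<eta> (\<lambda>t. A t \<omega>) (Z0 \<omega>) T)) \<and>
       opnorm (Wmat U V (oja \<eta> (\<lambda>t. A t \<omega>) (Z0 \<omega>) T))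
         \<le> 2 * exp 1 * sqrt ((\<beta> + 1) / (\<beta> + real T))}" .
  qed
qed

end
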